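(* Let $k$ be a field with $\mathrm{char}(k)\neq5$ that contains a primitive fifth root of unity, and let $\phi:\mathbb{P}^1\to\mathbb{P}^2$ be given by $$\phi:[u:v]\mapsto[uv^6-u^7:u^5(u^2+v^2):v^5(u^2+v^2)].$$ Define $C:=\overline{\phi(\mathbb{P}^1)}$, which is an irreducible curve of $\mathbb{P}^2$. Then the point $P=[1:0:0]$ is an inner Galois point of $C$, and the extension induced by the projection $\pi_P:C\dashrightarrow\mathbb{P}^1$ is Galois of degree $5$. Moreover, the identity is the only element of the Galois group $G_P$ that extends to $\mathrm{Bir}(\mathbb{P}^2)$.
   Context: Let $\pi_P:\mathbb{P}^2\dashrightarrow\mathbb{P}^1$, $[X:Y:Z]\mapsto[Y:Z]$, be the projection from $P=[1:0:0]$, and put $K_P=\pi_P^*(k(\mathbb{P}^1))\subseteq k(C)$; the extension induced by $\pi_P$ is $k(C)/K_P$. The point $P$ is a Galois point for $C$ if $k(C)/K_P$ is Galois, and then $G_P=\mathrm{Gal}(k(C)/K_P)$. A Galois point is inner if $P\in C$ and outer if $P\notin C$. Elements of $G_P$ are identified with birational maps $g:C\dashrightarrow C$ satisfying $\pi_P|_C\circ g=\pi_P|_C$. $\mathrm{Bir}(\mathbb{P}^2)$ is the group of birational self-maps of $\mathbb{P}^2$. An element $\varphi\in\mathrm{Bir}(\mathbb{P}^2)$ preserves $C$ if it restricts to a birational transformation of $C$. An element $g\in G_P$ extends to $\mathrm{Bir}(\mathbb{P}^2)$ if there is $\varphi\in\mathrm{Bir}(\mathbb{P}^2)$ preserving $C$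 with $\varphi|_C=g$.
   Formalization: The formal theorem also assumes char(k) ≠ 2: in characteristic 2 the three forms defining φ share the factor (u+v)², and after cancelling it the curve C does not contain P = [1:0:0], so P is not inner and the claim fails. *)

theory Defs
  imports
    "HOL-Computational_Algebra.Computational_Algebra"
    "HOL-Algebra.Finite_Extensions"
    "HOL-Algebra.QuotRing"
    "HOL-Algebra.Bij"
begin

section \<open>Polynomials in two and three variables\<close>

text \<open>
  The ring k[u,v] is k[u][v] and the ring k[X,Y,Z] is k[X][Y][Z]: the last variable is the
  outermost one.
\<close>

type_synonym 'k bipoly = "'k poly poly"
type_synonym 'k tripoly = "'k poly poly poly"

abbreviation const2 :: "'k::comm_ring_1 \<Rightarrow> 'k bipoly" where
  "const2 c \<equiv> [:[:c:]:]"

abbreviation const3 :: "'k::comm_ring_1 \<Rightarrow> 'k tripoly" where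
  "const3 c \<equiv> [:[:[:c:]:]:]"

definition U2 :: "'k::comm_ring_1 bipoly" where "U2 = [:[:0, 1:]:]"
definition V2 :: "'k::comm_ring_1 bipoly" where "V2 = [:0, 1:]"

definition X3 :: "'k::comm_ring_1 tripoly" where "X3 = [:[:[:0, 1:]:]:]"
definition Y3 :: "'k::comm_ring_1 tripoly" where "Y3 = [:[:0, 1:]:]"
definition Z3 :: "'k::comm_ring_1 tripoly" where "Z3 = [:0, 1:]"

definition homogeneous2 :: "nat \<Rightarrow> 'k::comm_ring_1 bipoly \<Rightarrow> bool" where
  "homogeneous2 d p \<longleftrightarrow>
     (\<forall>i j. Polynomial.coeff (Polynomial.coeff p j) i \<noteq> 0 \<longrightarrow> i + j = d)"

definition homogeneous3 :: "nat \<Rightarrow> 'k::comm_ring_1 tripoly \<Rightarrow> bool" where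
  "homogeneous3 d p \<longleftrightarrow>
     (\<forall>i j l. Polynomial.coeff (Polynomial.coeff (Polynomial.coeff p l) j) i \<noteq> 0
        \<longrightarrow> i + j + l = d)"

text \<open>
  Substitution of ring elements for the variables; the argument \<open>h\<close> is the embedding of the
  coefficients into the target ring.
\<close>

definition subst2 ::
  "('k::comm_ring_1 \<Rightarrow> 'r::comm_ring_1) \<Rightarrow> 'r \<times> 'r \<Rightarrow> 'k bipoly \<Rightarrow> 'r" where
  "subst2 h = (\<lambda>(a, b) p. poly (map_poly (\<lambda>q. poly (map_poly h q) a) p) b)"

definition subst3 ::
  "('k::comm_ring_1 \<Rightarrow> 'r::comm_ring_1) \<Rightarrow> 'r \<times> 'r \<times> 'r \<Rightarrow> 'k tripoly \<Rightarrow> 'r" where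
  "subst3 h = (\<lambda>(a, b, c) p. poly (map_poly (subst2 h (a, b)) p) c)"


section \<open>Closed subvarieties of the projective plane\<close>

text \<open>
  An irreducible closed subvariety of the plane is represented by its homogeneous prime ideal in
  k[X,Y,Z], the plane itself by the zero ideal.  Working with ideals rather than with sets of
  k-rational points gives the right notion also when k is finite.
\<close>

definition plane_ideal :: "'k::field tripoly set" where
  "plane_ideal = {0}"

text \<open>
  The ideal of the Zariski closure of the image of a map from the line to the plane: the
  polynomials that vanish identically along the parametrization.
\<close>

definition image_ideal :: "'k::field bipoly \<times> 'k bipoly \<times> 'k bipoly \<Rightarrow> 'k tripoly set" where
  "image_ideal f = {G. subst3 const2 f G = 0}"

definition irreducible_plane_curve :: "'k::field tripoly set \<Rightarrow> bool" where
  "irreducible_plane_curve I \<longleftrightarrow>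
     (\<exists>F d. homogeneous3 d F \<and> Factorial_Ring.irreducible F \<and> I = {G. F dvd G})"

definition point_on :: "'k::field \<times> 'k \<times> 'k \<Rightarrow> 'k tripoly set \<Rightarrow> bool" where
  "point_on p I \<longleftrightarrow> (\<forall>G d. G \<in> I \<and> homogeneous3 d G \<longrightarrow> subst3 id p G = 0)"


section \<open>Function fields\<close>

text \<open>
  The function field of V(I) is the residue field of the local ring of the plane at the generic
  point of V(I).  That local ring consists of the fractions A/B of forms of the same degree
  with B not in I, and in its maximal ideal A belongs to I.
\<close>

definition generic_local_ring :: "'k::field tripoly set \<Rightarrow> 'k tripoly fract ring" where
  "generic_local_ring I =
     \<lparr>carrier = {Fract A B | A B d. homogeneous3 d A \<and> homogeneous3 d B \<and> B \<notin> I},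
      monoid.mult = (*), one = 1, zero = 0, add = (+)\<rparr>"

definition generic_maximal_ideal :: "'k::field tripoly set \<Rightarrow> 'k tripoly fract set" where
  "generic_maximal_ideal I =
     {Fract A B | A B d. homogeneous3 d A \<and> homogeneous3 d B \<and> B \<notin> I \<and> A \<in> I}"

definition function_field :: "'k::field tripoly set \<Rightarrow> 'k tripoly fract set ring" where
  "function_field I = generic_local_ring I Quot generic_maximal_ideal I"

definition rational_function ::
  "'k::field tripoly set \<Rightarrow> 'k tripoly \<Rightarrow> 'k tripoly \<Rightarrow> 'k tripoly fract set" where
  "rational_function I A B =
     generic_maximal_ideal I +>\<^bsub>generic_local_ring I\<^esub> Fract A B"

text \<open>
  The subfield of the function field obtained by pulling back the rational functions
  a(s,t)/b(s,t) of the line along the projection [X:Y:Z] to [Y:Z] from [1:0:0].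
\<close>

definition projection_subfield :: "'k::field tripoly set \<Rightarrow> 'k tripoly fract set set" where
  "projection_subfield I =
     {rational_function I (subst2 const3 (Y3, Z3) a) (subst2 const3 (Y3, Z3) b) | a b d.
        homogeneous2 d a \<and> homogeneous2 d b \<and> subst2 const3 (Y3, Z3) b \<notin> I}"


section \<open>Galois extensions\<close>

definition galois_group :: "('a, 'b) ring_scheme \<Rightarrow> 'a set \<Rightarrow> ('a \<Rightarrow> 'a) monoid" where
  "galois_group L K = BijGroup (carrier L)
     \<lparr>carrier := {\<sigma> \<in> Bij (carrier L). \<sigma> \<in> ring_hom L L \<and> (\<forall>x\<in>K. \<sigma> x = x)}\<rparr>"

definition galois_extension :: "('a, 'b) ring_scheme \<Rightarrow> 'a set \<Rightarrow> bool" where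
  "galois_extension L K \<longleftrightarrow>
     field L \<and> subfield K L \<and>
     (\<forall>x\<in>carrier L. (ring.algebraic L over K) x) \<and>
     {x \<in> carrier L. \<forall>\<sigma>\<in>carrier (galois_group L K). \<sigma> x = x} = K"

text \<open>The point [1:0:0] is Galois for V(I).\<close>

definition galois_point :: "'k::field tripoly set \<Rightarrow> bool" where
  "galois_point I \<longleftrightarrow> galois_extension (function_field I) (projection_subfield I)"

definition inner_galois_point :: "'k::field tripoly set \<Rightarrow> bool" where
  "inner_galois_point I \<longleftrightarrow> galois_point I \<and> point_on (1, 0, 0) I"


section \<open>Birational self-maps\<close>

text \<open>
  A rational self-map of V(I) is represented by a triple of forms of the same degree, not all of
  which vanish on V(I), that maps V(I) to itself.  Two triples represent the same map if they
  are proportional modulo I.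
\<close>

type_synonym 'k triple = "'k tripoly \<times> 'k tripoly \<times> 'k tripoly"

definition rational_self_map :: "'k::field tripoly set \<Rightarrow> 'k triple \<Rightarrow> bool" where
  "rational_self_map I f \<longleftrightarrow> (case f of (f0, f1, f2) \<Rightarrow>
     (\<exists>d. homogeneous3 d f0 \<and> homogeneous3 d f1 \<and> homogeneous3 d f2) \<and>
     \<not> {f0, f1, f2} \<subseteq> I) \<and>
     (\<forall>G\<in>I. subst3 const3 f G \<in> I)"

definition same_rational_map :: "'k::field tripoly set \<Rightarrow> 'k triple \<Rightarrow> 'k triple \<Rightarrow> bool" where
  "same_rational_map I = (\<lambda>(f0, f1, f2) (g0, g1, g2).
     f0 * g1 - f1 * g0 \<in> I \<and> f0 * g2 - f2 * g0 \<in> I \<and> f1 * g2 - f2 * g1 \<in> I)"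

definition comp_triple :: "'k::field triple \<Rightarrow> 'k triple \<Rightarrow> 'k triple" where
  "comp_triple = (\<lambda>(g0, g1, g2) f. (subst3 const3 f g0, subst3 const3 f g1, subst3 const3 f g2))"

text \<open>
  The condition that the composite triple is again a rational self-map says that the composite
  is defined, i.e. that its components do not all vanish on V(I).
\<close>

definition inverse_rational_maps :: "'k::field tripoly set \<Rightarrow> 'k triple \<Rightarrow> 'k triple \<Rightarrow> bool" where
  "inverse_rational_maps I f g \<longleftrightarrow>
     rational_self_map I (comp_triple g f) \<and>
     same_rational_map I (comp_triple g f) (X3, Y3, Z3) \<and>
     rational_self_map I (comp_triple f g) \<and>
     same_rational_map I (comp_triple f g) (X3, Y3, Z3)"

definition birational_self_map :: "'k::field tripoly set \<Rightarrow> 'k triple \<Rightarrow> bool" where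
  "birational_self_map I f \<longleftrightarrow> rational_self_map I f \<and>
     (\<exists>g. rational_self_map I g \<and> inverse_rational_maps I f g)"

text \<open>
  The automorphism \<open>\<sigma>\<close> of the function field is the pullback, A/B to A(f)/B(f), along the
  self-map f of V(I).  This identifies automorphisms over the base with birational self-maps
  commuting with the projection.
\<close>

definition is_pullback ::
  "'k::field tripoly set \<Rightarrow> 'k triple \<Rightarrow>
    ('k tripoly fract set \<Rightarrow> 'k tripoly fract set) \<Rightarrow> bool" where
  "is_pullback I f \<sigma> \<longleftrightarrow>
     (\<forall>A B d. homogeneous3 d A \<and> homogeneous3 d B \<and> B \<notin> I \<longrightarrow>
        subst3 const3 f B \<notin> I \<and>
        \<sigma> (rational_function I A B) =
          rational_function I (subst3 const3 f A) (subst3 const3 f B))"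

text \<open>
  The triples representing an element of Bir of the plane include one without common factor,
  which then does not vanish identically on a given curve.  So restricting an element of Bir to
  the curve amounts to reading a suitable representing triple modulo the ideal of the curve.
\<close>

definition preserves :: "'k::field triple \<Rightarrow> 'k tripoly set \<Rightarrow> bool" where
  "preserves f I \<longleftrightarrow> birational_self_map I f"

definition extends_to_Bir_plane ::
  "'k::field tripoly set \<Rightarrow> ('k tripoly fract set \<Rightarrow> 'k tripoly fract set) \<Rightarrow> bool" where
  "extends_to_Bir_plane I \<sigma> \<longleftrightarrow>
     (\<exists>f. birational_self_map plane_ideal f \<and> preserves f I \<and> is_pullback I f \<sigma>)"


section \<open>The parametrized curve\<close>

text \<open>
  The three forms have no common zero, and hence define a morphism on the projective line,
  exactly when the characteristic of k is not 2.  In characteristic 2 they have the common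
  factor \<open>(u + v)^2\<close>, and the closure of the image is a curve of degree 5 that does not contain
  [1:0:0].
\<close>

definition curve_param :: "'k::field bipoly \<times> 'k bipoly \<times> 'k bipoly" where
  "curve_param =
     (U2 * V2 ^ 6 - U2 ^ 7, U2 ^ 5 * (U2 ^ 2 + V2 ^ 2), V2 ^ 5 * (U2 ^ 2 + V2 ^ 2))"

definition curve_C :: "'k::field tripoly set" where
  "curve_C = image_ideal curve_param"

end

theory Submission
  imports Defs "HOL-Algebra.Algebraic_Closure_Type"
begin

text \<open>
  With t = u/v the curve satisfies Y = t^5 Z and (X + Y) t^2 - Z t + X = 0.  Its equation F of
  degree 7 (\<open>curve_form\<close>) is the norm of this quadratic expression: on Y = s^5 Z it is Z^2 times the
  product of the expressions (X + Y) r^2 - Z r + X over the five conjugates r = \<zeta>^i s of s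
  (\<open>curve_eq_factorization\<close>).

  Reducing the relation t^5 = Y/Z modulo the quadratic equation expresses t as a
  rational function on the curve (\<open>inverse_of_parametrization\<close>), so that the function field is k(t)
  (\<open>function_field_iso\<close>).  Since Y/Z = t^5, the functions pulled back along the projection form
  k(t^5) (\<open>projection_subfield_image\<close>).  As k contains the fifth roots of unity, k(t)/k(t^5) is a
  Kummer extension of degree 5 whose automorphisms are t \<mapsto> \<zeta>^j t (\<open>kummer_dimension\<close>,
  \<open>rotate_fixed_iff\<close>, \<open>kummer_automorphism\<close>).

  The curve has degree 7 and, over an algebraic closure, only points
  of multiplicity at most 2 < 7/3.  A Noether-Fano argument shows that a plane Cremona map that
  preserves such a curve is linear (\<open>cremona_preserving_curve_linear\<close>).  In detail, let f be a triple
  of forms of degree d without common factor that represents the map.  If g represents the inverse,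
  then g(f) = M (X,Y,Z) for a form M, and F(f) divides M^7 F; in particular F divides F(f) only
  once.  Let E be another prime factor of F(f).  It divides M, hence f contracts it to a point of
  the curve.  Because this point has multiplicity at most 2, the exponent of E in F(f) is at most
  twice its exponent in W, the Jacobian determinant of f with the factor d removed
  (\<open>contracted_bound\<close>): if a function A of the image coordinates vanishes to the order n along a
  contracted curve, then the product of W with a suitable partial derivative of A vanishes to the
  order n, and one applies this to F and, if necessary, once more to its partial derivative
  (\<open>power_dvd_jacobian\<close>, \<open>power_dvd_jacobian_square\<close>).
  Therefore F(f) divides F W^2, and comparing degrees gives 7 d \<le> 7 + 6 (d - 1), that is, d = 1.

  Finally, if a linear map restricts to t \<mapsto> \<eta> t with \<eta>^5 = 1, then comparing coefficients
  gives \<eta>^2 = 1 and so \<eta> = 1 (\<open>linear_rotation_trivial\<close>).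
\<close>

hide_const (open) Polynomials.degree up_ring.coeff up_ring.monom module.smult
  Divisibility.prime Divisibility.irreducible

section \<open>Ring homomorphisms and substitution\<close>

locale ring_map =
  fixes h :: "'a::comm_ring_1 \<Rightarrow> 'b::comm_ring_1"
  assumes map_add: "h (x + y) = h x + h y"
    and map_mult: "h (x * y) = h x * h y"
    and map_one: "h 1 = 1"
begin

lemma map_zero: "h 0 = 0"
  using map_add[of 0 0] by simp

lemma map_minus: "h (- x) = - h x"
proof -
  have "h x + h (- x) = 0"
    using map_add[of x "- x"] map_zero by simp
  then show ?thesis by (simp add: eq_neg_iff_add_eq_0 add.commute)
qed

lemma map_diff: "h (x - y) = h x - h y"
  using map_add[of x "- y"] map_minus by simp

lemma map_power: "h (x ^ n) = h x ^ n"
  by (induction n) (simp_all add: map_one map_mult)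

lemma map_of_nat: "h (of_nat n) = of_nat n"
  by (induction n) (simp_all add: map_one map_add map_zero)

lemma map_numeral: "h (numeral n) = numeral n"
  using map_of_nat[of "numeral n"] by simp

lemma map_sum: "h (sum f A) = (\<Sum>x\<in>A. h (f x))"
  by (induction A rule: infinite_finite_induct) (simp_all add: map_zero map_add)

lemma map_prod: "h (prod f A) = (\<Prod>x\<in>A. h (f x))"
  by (induction A rule: infinite_finite_induct) (simp_all add: map_one map_mult)

lemma map_dvd: "x dvd y \<Longrightarrow> h x dvd h y"
  by (auto simp: dvd_def map_mult)

lemmas map_simps =
  map_add map_mult map_one map_zero map_minus map_diff map_power map_numeral

lemma map_poly_pCons: "map_poly h (pCons c p) = pCons (h c) (map_poly h p)"
  by (rule Polynomial.map_poly_pCons) (rule map_zero)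

lemma eval_pCons: "poly (map_poly h (pCons c p)) a = h c + a * poly (map_poly h p) a"
  by (simp add: map_poly_pCons)

lemma eval_add:
  "poly (map_poly h (p + q)) a = poly (map_poly h p) a + poly (map_poly h q) a"
proof -
  have "map_poly h (p + q) = map_poly h p + map_poly h q"
    by (rule poly_eqI) (simp add: coeff_map_poly map_zero map_add)
  then show ?thesis by simp
qed

lemma eval_ring_map: "ring_map (\<lambda>p. poly (map_poly h p) a)"
proof
  fix p q
  show "poly (map_poly h (p * q)) a = poly (map_poly h p) a * poly (map_poly h q) a"
  proof (induction p)
    case (pCons c p)
    have smult: "poly (map_poly h (smult c q)) a = h c * poly (map_poly h q) a"
      by (induction q) (simp_all add: eval_pCons map_mult algebra_simps)
    have "poly (map_poly h (pCons 0 (p * q))) a = a * poly (map_poly h (p * q)) a"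
      by (simp only: eval_pCons map_zero) simp
    then show ?case
      by (simp only: mult_pCons_left eval_add smult eval_pCons pCons.IH) (simp add: algebra_simps)
  qed simp
qed (simp_all add: eval_add map_one)

end

lemma ring_map_comp: "ring_map h \<Longrightarrow> ring_map g \<Longrightarrow> ring_map (\<lambda>x. g (h x))"
  by (simp add: ring_map_def)

lemma ring_map_id: "ring_map (\<lambda>x. x)"
  by (simp add: ring_map_def)

lemma ring_map_const_poly: "ring_map (\<lambda>c. [:c:])"
  by (simp add: ring_map_def one_pCons)

lemma ring_map_const2: "ring_map const2"
  using ring_map_comp[OF ring_map_const_poly ring_map_const_poly] .

lemma ring_map_const3: "ring_map const3"
  using ring_map_comp[OF ring_map_const2 ring_map_const_poly] .

lemma ring_map_poly: "ring_map (\<lambda>p. poly p a)"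
  by (simp add: ring_map_def)

lemma ring_map_pcompose: "ring_map (\<lambda>p. pcompose p a)"
  by (simp add: ring_map_def pcompose_add pcompose_mult pcompose_1)

lemma ring_map_subst2: "ring_map h \<Longrightarrow> ring_map (subst2 h ab)"
  by (cases ab) (simp add: subst2_def ring_map.eval_ring_map)

lemma ring_map_subst3: "ring_map h \<Longrightarrow> ring_map (subst3 h abc)"
  by (cases abc) (simp add: subst3_def ring_map.eval_ring_map ring_map_subst2)

lemma subst2_gens:
  assumes "ring_map h"
  shows "subst2 h (a, b) (const2 c) = h c" "subst2 h (a, b) U2 = a" "subst2 h (a, b) V2 = b"
proof -
  interpret ring_map h by fact
  interpret e: ring_map "\<lambda>p. poly (map_poly h p) a" by (rule eval_ring_map)
  show "subst2 h (a, b) (const2 c) = h c" "subst2 h (a, b) U2 = a" "subst2 h (a, b) V2 = b"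
    by (simp_all add: subst2_def U2_def V2_def map_poly_pCons e.map_poly_pCons e.map_one map_simps)
qed

lemma subst3_gens:
  assumes "ring_map h"
  shows "subst3 h (a, b, c) (const3 k) = h k" "subst3 h (a, b, c) X3 = a"
    "subst3 h (a, b, c) Y3 = b" "subst3 h (a, b, c) Z3 = c"
proof -
  interpret ring_map h by fact
  interpret e: ring_map "subst2 h (a, b)" by (rule ring_map_subst2) fact
  show "subst3 h (a, b, c) (const3 k) = h k" "subst3 h (a, b, c) X3 = a"
    "subst3 h (a, b, c) Y3 = b" "subst3 h (a, b, c) Z3 = c"
    using subst2_gens[OF assms, of a b]
    by (simp_all add: subst3_def X3_def Y3_def Z3_def U2_def V2_def e.map_poly_pCons e.map_simps)
qed

lemma ring_map_poly_eqI:
  assumes f: "ring_map f" and g: "ring_map g"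
    and c: "\<And>c. f [:c:] = g [:c:]" and x: "f [:0, 1:] = g [:0, 1:]"
  shows "f p = g p"
proof (induction p)
  case 0 then show ?case using f g by (simp add: ring_map.map_zero)
next
  case (pCons c p)
  have "pCons c p = [:c:] + [:0, 1:] * p" by simp
  then show ?case using pCons.IH
    by (simp only: ring_map.map_add[OF f] ring_map.map_add[OF g]
        ring_map.map_mult[OF f] ring_map.map_mult[OF g] c x)
qed

lemma ring_map_bipoly_eqI:
  assumes f: "ring_map f" and g: "ring_map g"
    and c: "\<And>c. f (const2 c) = g (const2 c)" and U: "f U2 = g U2" and V: "f V2 = g V2"
  shows "f p = g p"
proof (rule ring_map_poly_eqI[OF f g])
  show "f [:q:] = g [:q:]" for q
    by (rule ring_map_poly_eqI[OF ring_map_comp[OF ring_map_const_poly f]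
          ring_map_comp[OF ring_map_const_poly g] c U[unfolded U2_def]])
qed (rule V[unfolded V2_def])

lemma ring_map_tripoly_eqI:
  assumes f: "ring_map f" and g: "ring_map g"
    and c: "\<And>c. f (const3 c) = g (const3 c)"
    and X: "f X3 = g X3" and Y: "f Y3 = g Y3" and Z: "f Z3 = g Z3"
  shows "f p = g p"
proof (rule ring_map_poly_eqI[OF f g])
  show "f [:q:] = g [:q:]" for q
    by (rule ring_map_bipoly_eqI[OF ring_map_comp[OF ring_map_const_poly f]
          ring_map_comp[OF ring_map_const_poly g] c])
       (use X Y in \<open>simp_all only: X3_def Y3_def U2_def V2_def\<close>)
qed (rule Z[unfolded Z3_def])

text \<open>
  A homomorphism out of k[X,Y,Z] is determined by its values on constants and variables, so that
  a homomorphism applied after a substitution is again a substitution.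
\<close>
lemma ring_map_subst2_comp:
  assumes "ring_map \<psi>" "ring_map h"
  shows "\<psi> (subst2 h (a, b) p) = subst2 (\<lambda>x. \<psi> (h x)) (\<psi> a, \<psi> b) p"
  by (rule ring_map_bipoly_eqI[OF ring_map_comp[OF ring_map_subst2 assms(1)] ring_map_subst2])
     (use assms in \<open>auto simp: ring_map_comp subst2_gens\<close>)

lemma ring_map_subst3_comp:
  assumes "ring_map \<psi>" "ring_map h"
  shows "\<psi> (subst3 h (a, b, c) p) = subst3 (\<lambda>x. \<psi> (h x)) (\<psi> a, \<psi> b, \<psi> c) p"
  by (rule ring_map_tripoly_eqI[OF ring_map_comp[OF ring_map_subst3 assms(1)] ring_map_subst3])
     (use assms in \<open>auto simp: ring_map_comp subst3_gens\<close>)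

lemma subst3_variables: "subst3 const3 (X3, Y3, Z3) p = p"
  by (rule ring_map_tripoly_eqI[OF ring_map_subst3 ring_map_id])
     (simp_all add: ring_map_const3 subst3_gens)

section \<open>Forms\<close>

lemma poly_as_sum_of_powers:
  fixes q :: "'a::comm_ring_1 poly"
  shows "(\<Sum>i\<le>degree q. [:coeff q i:] * [:0, 1:] ^ i) = q"
proof -
  have "[:c:] * [:0, 1:] ^ i = monom c i" for c :: 'a and i
    by (simp add: monom_altdef)
  then show ?thesis by (simp only: poly_as_sum_of_monoms)
qed

lemma const_poly_as_sum:
  fixes q :: "'a::comm_ring_1 poly"
  shows "[:q:] = (\<Sum>j\<le>degree q. [:[:coeff q j:]:] * [:[:0, 1:]:] ^ j)"
proof -
  interpret c: ring_map "\<lambda>c::'a poly. [:c:]" by (rule ring_map_const_poly)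
  show ?thesis
    by (simp only: c.map_sum[symmetric] c.map_mult[symmetric] c.map_power[symmetric]
        poly_as_sum_of_powers)
qed

lemma const_const_poly_as_sum:
  fixes q :: "'a::comm_ring_1 poly"
  shows "[:[:q:]:] = (\<Sum>j\<le>degree q. [:[:[:coeff q j:]:]:] * [:[:[:0, 1:]:]:] ^ j)"
proof -
  interpret c: ring_map "\<lambda>c::'a poly poly. [:c:]" by (rule ring_map_const_poly)
  show ?thesis
    by (simp only: c.map_sum[symmetric] c.map_mult[symmetric] c.map_power[symmetric]
        const_poly_as_sum[symmetric])
qed

lemma tripoly_as_sum:
  "(\<Sum>l\<le>degree p. \<Sum>j\<le>degree (coeff p l). \<Sum>i\<le>degree (coeff (coeff p l) j).
      const3 (coeff (coeff (coeff p l) j) i) * X3 ^ i * Y3 ^ j * Z3 ^ l) = p"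
  unfolding X3_def Y3_def Z3_def
  by (simp only: sum_distrib_right[symmetric] const_const_poly_as_sum[symmetric]
      const_poly_as_sum[symmetric] poly_as_sum_of_powers)

lemma bipoly_as_sum:
  "(\<Sum>j\<le>degree p. \<Sum>i\<le>degree (coeff p j).
      const2 (coeff (coeff p j) i) * U2 ^ i * V2 ^ j) = p"
  unfolding U2_def V2_def
  by (simp only: sum_distrib_right[symmetric] const_poly_as_sum[symmetric] poly_as_sum_of_powers)

lemma sum_closed: "P 0 \<Longrightarrow> (\<And>p q. P p \<Longrightarrow> P q \<Longrightarrow> P (p + q)) \<Longrightarrow> (\<And>i. i \<in> A \<Longrightarrow> P (f i)) \<Longrightarrow> P (sum f A)"
  by (induction A rule: infinite_finite_induct) auto

lemma tripoly_induct:
  assumes "P 0" "\<And>p q. P p \<Longrightarrow> P q \<Longrightarrow> P (p + q)"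
    and "\<And>c i j l. P (const3 c * X3 ^ i * Y3 ^ j * Z3 ^ l)"
  shows "P p"
  by (subst tripoly_as_sum[of p, symmetric]) (intro sum_closed[of P, OF assms(1,2)] assms(3))

lemma homogeneous3_induct [consumes 1, case_names zero add monomial]:
  assumes hom: "homogeneous3 d p" and "P 0" "\<And>p q. P p \<Longrightarrow> P q \<Longrightarrow> P (p + q)"
    and mono: "\<And>c i j l. i + j + l = d \<Longrightarrow> P (const3 c * X3 ^ i * Y3 ^ j * Z3 ^ l)"
  shows "P p"
proof -
  have "P (const3 (coeff (coeff (coeff p l) j) i) * X3 ^ i * Y3 ^ j * Z3 ^ l)" for i j l
    using hom mono[of i j l] \<open>P 0\<close> by (cases "coeff (coeff (coeff p l) j) i = 0") (auto simp: homogeneous3_def)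
  then show ?thesis
    by (subst tripoly_as_sum[of p, symmetric]) (intro sum_closed[of P, OF assms(2,3)])
qed

lemma homogeneous2_induct [consumes 1, case_names zero add monomial]:
  assumes hom: "homogeneous2 d p" and "P 0" "\<And>p q. P p \<Longrightarrow> P q \<Longrightarrow> P (p + q)"
    and mono: "\<And>c i j. i + j = d \<Longrightarrow> P (const2 c * U2 ^ i * V2 ^ j)"
  shows "P p"
proof -
  have "P (const2 (coeff (coeff p j) i) * U2 ^ i * V2 ^ j)" for i j
    using hom mono[of i j] \<open>P 0\<close> by (cases "coeff (coeff p j) i = 0") (auto simp: homogeneous2_def)
  then show ?thesis
    by (subst bipoly_as_sum[of p, symmetric]) (intro sum_closed[of P, OF assms(2,3)])
qed

lemma monomial3_eq: "const3 c * X3 ^ i * Y3 ^ j * Z3 ^ l = monom (monom (monom c i) j) l"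
proof -
  have 1: "X3 ^ i = [:[:monom 1 i:]:]"
    by (simp add: X3_def ring_map.map_power[OF ring_map_const2, symmetric] monom_altdef)
  have 2: "Y3 ^ j = [:monom 1 j:]"
    by (simp add: Y3_def ring_map.map_power[OF ring_map_const_poly, symmetric] monom_altdef)
  have 3: "Z3 ^ l = monom 1 l"
    by (simp add: Z3_def monom_altdef)
  show ?thesis by (simp add: 1 2 3 smult_monom)
qed

lemma coeff_monomial3:
  "coeff (coeff (coeff (const3 c * X3 ^ i * Y3 ^ j * Z3 ^ l) l') j') i' =
     (if i = i' \<and> j = j' \<and> l = l' then c else 0)"
  unfolding monomial3_eq by simp

text \<open>
  The substitution of XT, YT, ZT for the variables.  A polynomial is a form of degree d if and only
  if this multiplies it by T^d, which makes statements about forms accessible to the arithmetic of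
  polynomials in T.
\<close>
definition scale3 :: "'a::comm_ring_1 tripoly \<Rightarrow> 'a tripoly poly" where
  "scale3 = subst3 (\<lambda>c. [:const3 c:]) ([:0, X3:], [:0, Y3:], [:0, Z3:])"

lemma ring_map_scale3: "ring_map scale3"
  unfolding scale3_def by (intro ring_map_subst3 ring_map_comp[OF ring_map_const3 ring_map_const_poly])

lemma scale3_gens: "scale3 (const3 c) = [:const3 c:]" "scale3 X3 = monom X3 1" "scale3 Y3 = monom Y3 1"
  "scale3 Z3 = monom Z3 1"
  by (simp_all add: scale3_def subst3_gens ring_map_comp[OF ring_map_const3 ring_map_const_poly] monom_Suc monom_0)

lemma scale3_monomial:
  "scale3 (const3 c * X3 ^ i * Y3 ^ j * Z3 ^ l) = monom (const3 c * X3 ^ i * Y3 ^ j * Z3 ^ l) (i + j + l)"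
  by (simp only: ring_map.map_mult[OF ring_map_scale3] ring_map.map_power[OF ring_map_scale3] scale3_gens
      monom_power monom_0[of "const3 c", symmetric] mult_monom) simp

lemma coeff_scale3:
  "coeff (coeff (coeff (coeff (scale3 p) n) l) j) i = (if i + j + l = n then coeff (coeff (coeff p l) j) i else 0)"
proof (induction p rule: tripoly_induct)
  case 1 then show ?case by (simp add: ring_map.map_zero[OF ring_map_scale3])
next
  case (2 p q) then show ?case by (simp add: ring_map.map_add[OF ring_map_scale3])
next
  case (3 c i' j' l')
  have "coeff (coeff (coeff (coeff (scale3 (const3 c * X3 ^ i' * Y3 ^ j' * Z3 ^ l')) n) l) j) i
      = (if i' + j' + l' = n then coeff (coeff (coeff (const3 c * X3 ^ i' * Y3 ^ j' * Z3 ^ l') l) j) i else 0)"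
    unfolding scale3_monomial by (simp only: coeff_monom) simp
  then show ?case unfolding coeff_monomial3 by auto
qed

lemma homogeneous3_iff_scale3: "homogeneous3 d p \<longleftrightarrow> scale3 p = monom p d"
  unfolding homogeneous3_def poly_eq_iff coeff_scale3
  by (auto split: if_splits)

lemma poly_scale3_one: "poly (scale3 p) 1 = p"
proof -
  have "poly (scale3 p) 1 = subst3 const3 (X3, Y3, Z3) p"
    unfolding scale3_def
    by (subst ring_map_subst3_comp[OF ring_map_poly ring_map_comp[OF ring_map_const3 ring_map_const_poly]]) simp
  then show ?thesis by (simp add: subst3_variables)
qed

lemma homogeneous3_0: "homogeneous3 d 0"
  by (simp add: homogeneous3_def)

lemma homogeneous3_add: "homogeneous3 d p \<Longrightarrow> homogeneous3 d q \<Longrightarrow> homogeneous3 d (p + q)"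
  by (simp add: homogeneous3_iff_scale3 ring_map.map_add[OF ring_map_scale3] add_monom)

lemma homogeneous3_minus: "homogeneous3 d p \<Longrightarrow> homogeneous3 d (- p)"
  by (simp add: homogeneous3_iff_scale3 ring_map.map_minus[OF ring_map_scale3] minus_monom)

lemma homogeneous3_diff: "homogeneous3 d p \<Longrightarrow> homogeneous3 d q \<Longrightarrow> homogeneous3 d (p - q)"
  using homogeneous3_add[of d p "- q"] homogeneous3_minus by force

lemma homogeneous3_mult: "homogeneous3 d p \<Longrightarrow> homogeneous3 e q \<Longrightarrow> homogeneous3 (d + e) (p * q)"
  by (simp add: homogeneous3_iff_scale3 ring_map.map_mult[OF ring_map_scale3] mult_monom)

lemma homogeneous3_power: "homogeneous3 d p \<Longrightarrow> homogeneous3 (n * d) (p ^ n)"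
  by (simp add: homogeneous3_iff_scale3 ring_map.map_power[OF ring_map_scale3] monom_power mult.commute)

lemma homogeneous3_sum: "(\<And>i. i \<in> A \<Longrightarrow> homogeneous3 d (f i)) \<Longrightarrow> homogeneous3 d (sum f A)"
  by (rule sum_closed) (auto simp: homogeneous3_0 homogeneous3_add)

lemma homogeneous3_const: "homogeneous3 0 (const3 c)"
  and homogeneous3_X: "homogeneous3 1 X3" and homogeneous3_Y: "homogeneous3 1 Y3"
  and homogeneous3_Z: "homogeneous3 1 Z3"
  by (simp_all only: homogeneous3_iff_scale3 scale3_gens monom_0)

lemma homogeneous3_subst3:
  assumes G: "homogeneous3 e G" and f: "homogeneous3 d f0" "homogeneous3 d f1" "homogeneous3 d f2"
  shows "homogeneous3 (e * d) (subst3 const3 (f0, f1, f2) G)"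
proof -
  interpret s: ring_map "subst3 const3 (f0, f1, f2)" by (intro ring_map_subst3 ring_map_const3)
  show ?thesis using G
  proof (induction rule: homogeneous3_induct)
    case (monomial c i j l)
    have "homogeneous3 (0 + i * d + j * d + l * d) (const3 c * f0 ^ i * f1 ^ j * f2 ^ l)"
      by (intro homogeneous3_mult homogeneous3_power homogeneous3_const f)
    then show ?case using monomial
      by (simp only: s.map_simps subst3_gens[OF ring_map_const3]) (auto simp: algebra_simps)
  qed (simp_all add: s.map_simps homogeneous3_0 homogeneous3_add)
qed

lemma subst3_homogeneous_scale:
  assumes G: "homogeneous3 e G" and h: "ring_map h"
  shows "subst3 h (t * a, t * b, t * c) G = t ^ e * subst3 h (a, b, c) G"
proof -
  interpret s: ring_map "subst3 h (a, b, c)" by (intro ring_map_subst3 h)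
  interpret t: ring_map "subst3 h (t * a, t * b, t * c)" by (intro ring_map_subst3 h)
  show ?thesis using G
  proof (induction rule: homogeneous3_induct)
    case (monomial k i j l)
    then show ?case
      by (auto simp only: s.map_simps t.map_simps subst3_gens[OF h]) (simp add: algebra_simps power_mult_distrib power_add)
  qed (simp_all only: s.map_simps t.map_simps distrib_left mult_zero_right)
qed

text \<open>
  The indeterminate is prime, so a product equal to a monomial loses one power of it from one of the
  factors at a time, until it is constant.
\<close>
lemma monom_factor:
  fixes p q :: "'a::idom poly"
  assumes "p * q = monom c n" "c \<noteq> 0"
  shows "\<exists>a i. p = monom a i"
  using assms
proof (induction n arbitrary: p q)
  case 0
  then have "degree p + degree q = 0"
    by (metis degree_monom_eq degree_mult_eq mult_eq_0_iff monom_eq_0_iff)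
  then show ?case by (metis add_is_0 degree_eq_zeroE monom_0)
next
  case (Suc n)
  then have "coeff (p * q) 0 = 0" by simp
  then consider "coeff p 0 = 0" | "coeff q 0 = 0" by (auto simp: mult_poly_0 coeff_mult)
  then show ?case
  proof cases
    case 1
    then obtain p' where p: "p = pCons 0 p'" by (metis coeff_pCons_0 pCons_cases)
    with Suc.prems have "p' * q = monom c n" by (simp add: monom_Suc)
    with Suc.IH Suc.prems obtain a i where "p' = monom a i" by blast
    then show ?thesis by (metis p monom_Suc)
  next
    case 2
    then obtain q' where q: "q = pCons 0 q'" by (metis coeff_pCons_0 pCons_cases)
    with Suc.prems have "p * q' = monom c n" by (simp add: monom_Suc)
    with Suc.IH Suc.prems show ?thesis by blast
  qed
qed

text \<open>
  If the product is a form, then \<open>scale3\<close> of the factors are polynomials in T whose product is a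
  monomial, hence they are monomials themselves.
\<close>
lemma homogeneous3_factor:
  fixes p q :: "'a::idom tripoly"
  assumes "homogeneous3 d (p * q)" "p * q \<noteq> 0"
  shows "\<exists>i j. homogeneous3 i p \<and> homogeneous3 j q \<and> i + j = d"
proof -
  interpret s: ring_map scale3 by (rule ring_map_scale3)
  have h: "homogeneous3 i r" if "scale3 r = monom a i" for a i and r :: "'a tripoly"
    using that poly_scale3_one[of r] by (simp add: homogeneous3_iff_scale3 poly_monom)
  have pq: "scale3 p * scale3 q = monom (p * q) d"
    using assms by (simp add: homogeneous3_iff_scale3 s.map_mult)
  obtain a i b j where ij: "scale3 p = monom a i" "scale3 q = monom b j"
    using monom_factor[OF pq assms(2)] monom_factor[of "scale3 q" "scale3 p", OF _ assms(2)] pq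
    by (metis mult.commute)
  then have "homogeneous3 (i + j) (p * q)" using h by (metis homogeneous3_mult)
  with assms have "monom (p * q) (i + j) = monom (p * q) d" by (metis homogeneous3_iff_scale3)
  with assms(2) have "i + j = d" by (metis degree_monom_eq)
  with ij h show ?thesis by blast
qed

lemma homogeneous3_dvd_degree_le:
  fixes p q :: "'a::idom tripoly"
  assumes "homogeneous3 d p" "homogeneous3 e q" "p dvd q" "q \<noteq> 0"
  shows "d \<le> e"
proof -
  obtain r where r: "q = p * r" using assms by (auto simp: dvd_def)
  with assms obtain i j where "homogeneous3 i p" "i + j = e" by (metis homogeneous3_factor)
  moreover have "i = d"
    using calculation assms r by (metis homogeneous3_iff_scale3 degree_monom_eq mult_zero_left)
  ultimately show ?thesis by simp
qed

section \<open>The equation of the curve\<close>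

text \<open>
  The result of eliminating s from y = s^5 z and (x + y) s^2 - z s + x = 0.
\<close>
definition curve_eq :: "'a::comm_ring_1 \<Rightarrow> 'a \<Rightarrow> 'a \<Rightarrow> 'a" where
  "curve_eq x y z = x ^ 5 * z ^ 2 - y * z ^ 6 + 5 * x * y * (x + y) * z ^ 4
     - 5 * x ^ 2 * y * (x + y) ^ 2 * z ^ 2 + y ^ 2 * (x + y) ^ 5"

definition curve_form :: "'a::comm_ring_1 tripoly" where
  "curve_form = curve_eq X3 Y3 Z3"

lemma ring_map_curve_eq: "ring_map h \<Longrightarrow> h (curve_eq x y z) = curve_eq (h x) (h y) (h z)"
  by (simp add: curve_eq_def ring_map.map_simps)

lemma subst3_curve_form: "ring_map h \<Longrightarrow> subst3 h (a, b, c) curve_form = curve_eq a b c"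
  by (simp add: curve_form_def ring_map_curve_eq[OF ring_map_subst3] subst3_gens)

lemma fifth_root_sum:
  fixes \<zeta> :: "'a::idom"
  assumes "\<zeta> ^ 5 = 1" "\<zeta> \<noteq> 1"
  shows "\<zeta> ^ 4 + \<zeta> ^ 3 + \<zeta> ^ 2 + \<zeta> + 1 = 0"
proof -
  have "(\<zeta> - 1) * (\<zeta> ^ 4 + \<zeta> ^ 3 + \<zeta> ^ 2 + \<zeta> + 1) = \<zeta> ^ 5 - 1"
    by (simp add: algebra_simps power_numeral_reduce)
  with assms show ?thesis by simp
qed

text \<open>
  Conjugate factors are multiplied in pairs.  The outcome depends on \<zeta> only through
  p = \<zeta> + \<zeta>^4 and q = \<zeta>^2 + \<zeta>^3, which satisfy p + q = p q = -1.
\<close>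
lemma norm_quadratic:
  fixes \<zeta> :: "'a::idom"
  assumes z: "\<zeta> ^ 4 + \<zeta> ^ 3 + \<zeta> ^ 2 + \<zeta> + 1 = 0"
  shows "(a * s ^ 2 - b * s + c) * (a * (\<zeta> * s) ^ 2 - b * (\<zeta> * s) + c) *
      (a * (\<zeta> ^ 2 * s) ^ 2 - b * (\<zeta> ^ 2 * s) + c) * (a * (\<zeta> ^ 3 * s) ^ 2 - b * (\<zeta> ^ 3 * s) + c) *
      (a * (\<zeta> ^ 4 * s) ^ 2 - b * (\<zeta> ^ 4 * s) + c)
    = c ^ 5 + a ^ 5 * s ^ 10 - s ^ 5 * (b ^ 5 - 5 * b ^ 3 * a * c + 5 * b * a ^ 2 * c ^ 2)"
proof -
  have "\<zeta> ^ 5 - 1 = (\<zeta> - 1) * (\<zeta> ^ 4 + \<zeta> ^ 3 + \<zeta> ^ 2 + \<zeta> + 1)"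
    by (simp add: algebra_simps power_numeral_reduce)
  then have z5: "\<zeta> ^ 5 = 1" using z by simp
  have 1: "(a * (\<zeta> * s) ^ 2 - b * (\<zeta> * s) + c) * (a * (\<zeta> ^ 4 * s) ^ 2 - b * (\<zeta> ^ 4 * s) + c)
    = a^2*s^4 + b^2*s^2 + c^2 - a*b*s^3*(\<zeta> + \<zeta>^4) - b*c*s*(\<zeta> + \<zeta>^4) + a*c*s^2*(\<zeta>^2 + \<zeta>^3)"
    using z5 by Groebner_Basis.algebra
  have 2: "(a * (\<zeta>^2 * s) ^ 2 - b * (\<zeta>^2 * s) + c) * (a * (\<zeta> ^ 3 * s) ^ 2 - b * (\<zeta> ^ 3 * s) + c)
    = a^2*s^4 + b^2*s^2 + c^2 - a*b*s^3*(\<zeta>^2 + \<zeta>^3) - b*c*s*(\<zeta>^2 + \<zeta>^3) + a*c*s^2*(\<zeta> + \<zeta>^4)"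
    using z5 by Groebner_Basis.algebra
  define p where "p = \<zeta> + \<zeta>^4"
  define q where "q = \<zeta>^2 + \<zeta>^3"
  have pq: "p + q = -1" "p * q = -1" unfolding p_def q_def using z by Groebner_Basis.algebra+
  have "(a * s ^ 2 - b * s + c) * ((a * (\<zeta> * s) ^ 2 - b * (\<zeta> * s) + c) * (a * (\<zeta> ^ 4 * s) ^ 2 - b * (\<zeta> ^ 4 * s) + c)) *
      ((a * (\<zeta> ^ 2 * s) ^ 2 - b * (\<zeta> ^ 2 * s) + c) * (a * (\<zeta> ^ 3 * s) ^ 2 - b * (\<zeta> ^ 3 * s) + c))
    = c ^ 5 + a ^ 5 * s ^ 10 - s ^ 5 * (b ^ 5 - 5 * b ^ 3 * a * c + 5 * b * a ^ 2 * c ^ 2)"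
    unfolding 1 2 p_def[symmetric] q_def[symmetric] using pq by Groebner_Basis.algebra
  then show ?thesis by (simp only: mult_ac)
qed

text \<open>
  A line y = s^5 z through [1:0:0] meets the curve, apart from [1:0:0], in five points given by
  linear equations for x, one for each conjugate of s.  The multiplicities of the points of the
  curve are read off from this.
\<close>
lemma curve_eq_factorization:
  fixes \<zeta> :: "'a::idom"
  assumes z: "\<zeta> ^ 4 + \<zeta> ^ 3 + \<zeta> ^ 2 + \<zeta> + 1 = 0" and y: "y = s ^ 5 * z"
  shows "curve_eq x y z = z ^ 2 *
     (((x + y) * s ^ 2 - z * s + x) * ((x + y) * (\<zeta> * s) ^ 2 - z * (\<zeta> * s) + x) *
      ((x + y) * (\<zeta> ^ 2 * s) ^ 2 - z * (\<zeta> ^ 2 * s) + x) * ((x + y) * (\<zeta> ^ 3 * s) ^ 2 - z * (\<zeta> ^ 3 * s) + x) *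
      ((x + y) * (\<zeta> ^ 4 * s) ^ 2 - z * (\<zeta> ^ 4 * s) + x))"
proof -
  have "x ^ 5 * z ^ 2 - s ^ 5 * z * z ^ 6 + 5 * x * (s ^ 5 * z) * a * z ^ 4
      - 5 * x ^ 2 * (s ^ 5 * z) * a ^ 2 * z ^ 2 + (s ^ 5 * z) ^ 2 * a ^ 5
    = z ^ 2 * (x ^ 5 + a ^ 5 * s ^ 10 - s ^ 5 * (z ^ 5 - 5 * z ^ 3 * a * x + 5 * z * a ^ 2 * x ^ 2))"
    for a by Groebner_Basis.algebra
  then show ?thesis
    unfolding norm_quadratic[OF z] curve_eq_def y by blast
qed

lemma curve_eq_param:
  fixes u v :: "'a::idom"
  shows "curve_eq (u * v ^ 6 - u ^ 7) (u ^ 5 * (u ^ 2 + v ^ 2)) (v ^ 5 * (u ^ 2 + v ^ 2)) = 0"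
proof -
  \<comment> \<open>The coordinates are x = u A, y = u^5 S, z = v^5 S, and x + y = u v^2 B.  Dividing the equation by
    u^5 v^10 S^2 leaves an identity in u^2 and v^2 only, which is much smaller.\<close>
  define A where "A = v ^ 6 - u ^ 6"
  define S where "S = u ^ 2 + v ^ 2"
  define B where "B = u ^ 4 + v ^ 4"
  have "(V ^ 3 - U ^ 3) ^ 5 - V ^ 10 * (U + V) ^ 5
      + 5 * U * V ^ 6 * (V ^ 3 - U ^ 3) * (U ^ 2 + V ^ 2) * (U + V) ^ 3
      - 5 * U ^ 2 * V ^ 2 * (V ^ 3 - U ^ 3) ^ 2 * (U ^ 2 + V ^ 2) ^ 2 * (U + V)
      + U ^ 5 * (U ^ 2 + V ^ 2) ^ 5 = 0" for U V :: 'a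
    by Groebner_Basis.algebra
  from this[where U = "u ^ 2" and V = "v ^ 2"]
  have 0: "A ^ 5 - v ^ 20 * S ^ 5 + 5 * u ^ 2 * v ^ 12 * A * B * S ^ 3
      - 5 * u ^ 4 * v ^ 4 * A ^ 2 * B ^ 2 * S + u ^ 10 * B ^ 5 = 0"
    unfolding A_def S_def B_def by simp
  have X: "u * v ^ 6 - u ^ 7 = u * A" unfolding A_def by Groebner_Basis.algebra
  have XY: "u * A + u ^ 5 * S = u * v ^ 2 * B" unfolding A_def S_def B_def by Groebner_Basis.algebra
  show ?thesis
    unfolding curve_eq_def S_def[symmetric] X XY using 0 by Groebner_Basis.algebra
qed

section \<open>The ideal of the curve\<close>

locale curve_field =
  fixes \<zeta> :: "'a::field"
  assumes two: "(2::'a) \<noteq> 0" and root: "\<zeta> ^ 5 = 1"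
    and primitive: "\<And>m. 0 < m \<Longrightarrow> m < 5 \<Longrightarrow> \<zeta> ^ m \<noteq> 1"
begin

lemma zeta_sum: "\<zeta> ^ 4 + \<zeta> ^ 3 + \<zeta> ^ 2 + \<zeta> + 1 = 0"
  using fifth_root_sum[OF root] primitive[of 1] by simp

lemma zeta_nonzero: "\<zeta> \<noteq> 0"
  using root by auto

lemma zeta_power_inj: "i < 5 \<Longrightarrow> j < 5 \<Longrightarrow> \<zeta> ^ i = \<zeta> ^ j \<Longrightarrow> i = j"
proof (induction i j rule: linorder_wlog)
  case (le i j)
  have "\<zeta> ^ i * \<zeta> ^ (j - i) = \<zeta> ^ i * 1"
    using le by (metis power_add le_add_diff_inverse mult_1_right)
  then have "\<zeta> ^ (j - i) = 1" using zeta_nonzero by simp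
  then show ?case using le primitive[of "j - i"] by (cases "i = j") auto
qed auto

end

lemma curve_C_iff: "G \<in> curve_C \<longleftrightarrow> subst3 const2 curve_param G = 0"
  by (simp add: curve_C_def image_ideal_def)

lemma curve_form_in_curve_C: "curve_form \<in> curve_C"
  unfolding curve_C_iff curve_param_def
  by (simp add: subst3_curve_form ring_map_const2 curve_eq_param)

lemma ring_map_pcompose_gens:
  "pcompose (const2 c) q = const2 c" "pcompose U2 q = U2" "pcompose V2 q = q"
  by (simp_all add: U2_def V2_def pcompose_pCons)

text \<open>
  The affine parametrization (s - s^7, s^5 (s^2 + 1), s^2 + 1) is multiplied by
  1 - s^2 + s^4 - s^6 + s^8, which turns s^2 + 1 into 1 + s^10.  Then the second and third coordinate
  depend on s^5 only, and the five conjugates of s give points of the affine cone that differ only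
  in the first coordinate \<open>cone_N\<close>.
\<close>
definition cone_N :: "'b::comm_ring_1 \<Rightarrow> 'b" where
  "cone_N s = (s - s ^ 7) * (1 - s ^ 2 + s ^ 4 - s ^ 6 + s ^ 8)"

lemma ring_map_cone_N: "ring_map h \<Longrightarrow> h (cone_N s) = cone_N (h s)"
  by (simp add: cone_N_def ring_map.map_simps)

lemma cone_factor:
  fixes u v :: "'b::idom"
  shows "v * cone_N u = v * (1 - u ^ 2 + u ^ 4 - u ^ 6 + u ^ 8) * (u - u ^ 7)"
    "v * (u ^ 5 * (1 + u ^ 10)) = v * (1 - u ^ 2 + u ^ 4 - u ^ 6 + u ^ 8) * (u ^ 5 * (u ^ 2 + 1))"
    "v * (1 + u ^ 10) = v * (1 - u ^ 2 + u ^ 4 - u ^ 6 + u ^ 8) * (u ^ 2 + 1)"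
  unfolding cone_N_def by Groebner_Basis.algebra+

text \<open>
  A generic point of the affine cone over the curve: U2 is the parameter s, and V2 is a scaling
  factor independent of it.
\<close>
definition cone_subst :: "'a::field tripoly \<Rightarrow> 'a bipoly" where
  "cone_subst = subst3 const2 (V2 * cone_N U2, V2 * (U2 ^ 5 * (1 + U2 ^ 10)), V2 * (1 + U2 ^ 10))"

lemma ring_map_cone_subst: "ring_map cone_subst"
  unfolding cone_subst_def by (intro ring_map_subst3 ring_map_const2)

text \<open>
  Putting u = s v turns the homogeneous parametrization into v^7 times the affine one.  Since v^7 is
  transcendental over k(s), it may be replaced by an arbitrary scaling factor.
\<close>
lemma curve_C_cone:
  fixes G :: "'a::field tripoly"
  assumes "G \<in> curve_C"
  shows "cone_subst G = 0"
proof -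
  note c2 = ring_map_const2
  define P :: "'a bipoly" where "P = subst3 const2 (V2 * (U2 - U2 ^ 7), V2 * (U2 ^ 5 * (U2 ^ 2 + 1)), V2 * (U2 ^ 2 + 1)) G"
  have "subst2 const2 (U2 * V2, V2) (subst3 const2 curve_param G) = 0"
    using assms by (simp add: curve_C_iff ring_map.map_zero[OF ring_map_subst2[OF c2]])
  also have "subst2 const2 (U2 * V2, V2) (subst3 const2 curve_param G)
      = subst3 const2 (V2 ^ 7 * (U2 - U2 ^ 7), V2 ^ 7 * (U2 ^ 5 * (U2 ^ 2 + 1)), V2 ^ 7 * (U2 ^ 2 + 1)) G"
  proof -
    have "U2 * V2 * V2 ^ 6 - (U2 * V2) ^ 7 = V2 ^ 7 * (U2 - U2 ^ 7 :: 'a bipoly)"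
      "(U2 * V2) ^ 5 * ((U2 * V2) ^ 2 + V2 ^ 2) = V2 ^ 7 * (U2 ^ 5 * (U2 ^ 2 + 1 :: 'a bipoly))"
      "V2 ^ 5 * ((U2 * V2) ^ 2 + V2 ^ 2) = V2 ^ 7 * (U2 ^ 2 + 1 :: 'a bipoly)"
      by Groebner_Basis.algebra+
    then show ?thesis
      unfolding curve_param_def
      by (subst ring_map_subst3_comp[OF ring_map_subst2[OF c2] c2])
         (simp only: ring_map.map_simps[OF ring_map_subst2[OF c2]] subst2_gens[OF c2])
  qed
  also have "\<dots> = pcompose P (V2 ^ 7)"
    unfolding P_def
    by (subst ring_map_subst3_comp[OF ring_map_pcompose c2])
       (simp only: ring_map_pcompose_gens ring_map.map_simps[OF ring_map_pcompose])
  finally have "pcompose P (V2 ^ 7) = 0" .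
  moreover have "degree (V2 ^ 7 :: 'a bipoly) > 0"
    by (simp add: V2_def degree_power_eq)
  ultimately have "P = 0"
    using pcompose_eq_0 by blast
  then have "pcompose P (V2 * (1 - U2 ^ 2 + U2 ^ 4 - U2 ^ 6 + U2 ^ 8)) = 0" by simp
  also have "pcompose P (V2 * (1 - U2 ^ 2 + U2 ^ 4 - U2 ^ 6 + U2 ^ 8)) = cone_subst G"
    unfolding P_def cone_subst_def cone_factor(1,2) unfolding cone_factor(3)
    by (subst ring_map_subst3_comp[OF ring_map_pcompose c2])
       (simp only: ring_map_pcompose_gens ring_map.map_simps[OF ring_map_pcompose])
  finally show ?thesis .
qed

text \<open>
  The third and second coordinate of the generic point of the cone are algebraically independent:
  up to the scaling factor they are 1 + s^10 and s^5 (1 + s^10), whose quotient s^5 is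
  transcendental.
\<close>
lemma subst2_independent:
  fixes q :: "'a::field bipoly"
  assumes "subst2 const2 (V2 * (1 + U2 ^ 10), V2 * (U2 ^ 5 * (1 + U2 ^ 10))) q = 0"
  shows "q = 0"
proof -
  note c2 = ring_map_const2
  define Q where "Q = subst2 const2 (V2, V2 * U2 ^ 5) q"
  have "pcompose Q (V2 * (1 + U2 ^ 10)) = subst2 const2 (V2 * (1 + U2 ^ 10), V2 * (U2 ^ 5 * (1 + U2 ^ 10))) q"
    unfolding Q_def
    by (subst ring_map_subst2_comp[OF ring_map_pcompose c2])
       (simp only: ring_map_pcompose_gens ring_map.map_simps[OF ring_map_pcompose], simp only: mult_ac)
  moreover have "degree (V2 * (1 + U2 ^ 10) :: 'a bipoly) > 0"
  proof -
    have "1 + U2 ^ 10 = ([:1 + [:0, 1:] ^ 10:] :: 'a bipoly)"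
      by (simp only: U2_def ring_map.map_simps[OF ring_map_const_poly])
    moreover have "coeff (1 + [:0, 1:] ^ 10 :: 'a poly) 0 = 1"
      by (simp add: coeff_0_power)
    then have "(1 + [:0, 1:] ^ 10 :: 'a poly) \<noteq> 0" by (metis coeff_0 zero_neq_one)
    ultimately show ?thesis by (simp add: V2_def)
  qed
  ultimately have "Q = 0"
    using assms pcompose_eq_0 by metis
  then have "subst2 const2 (V2, U2) Q = 0"
    by (simp add: ring_map.map_zero[OF ring_map_subst2[OF c2]])
  also have "subst2 const2 (V2, U2) Q = subst2 const2 (U2, U2 * V2 ^ 5) q"
    unfolding Q_def
    by (subst ring_map_subst2_comp[OF ring_map_subst2[OF c2] c2])
       (simp add: ring_map.map_simps[OF ring_map_subst2[OF c2]] subst2_gens[OF c2])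
  also have "\<dots> = pcompose q (U2 * V2 ^ 5)"
    by (rule ring_map_bipoly_eqI[OF ring_map_subst2[OF c2] ring_map_pcompose])
       (simp_all add: subst2_gens[OF c2] ring_map_pcompose_gens)
  finally have "pcompose q (U2 * V2 ^ 5) = 0" .
  moreover have "degree (U2 * V2 ^ 5 :: 'a bipoly) > 0"
    by (simp add: V2_def U2_def degree_power_eq)
  ultimately show ?thesis using pcompose_eq_0 by blast
qed

text \<open>Interchanging the outer and inner variables makes X the main variable.\<close>
definition swap3 :: "'a::comm_ring_1 tripoly \<Rightarrow> 'a tripoly" where
  "swap3 = subst3 const3 (Z3, Y3, X3)"

lemma ring_map_swap3: "ring_map swap3"
  unfolding swap3_def by (intro ring_map_subst3 ring_map_const3)

lemma swap3_gens: "swap3 (const3 c) = const3 c" "swap3 X3 = Z3" "swap3 Y3 = Y3" "swap3 Z3 = X3"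
  by (simp_all add: swap3_def subst3_gens ring_map_const3)

lemma swap3_swap3: "swap3 (swap3 p) = p"
  by (rule ring_map_tripoly_eqI[OF ring_map_comp[OF ring_map_swap3 ring_map_swap3] ring_map_id])
     (simp_all add: swap3_gens)

lemma swap3_dvd_iff: "swap3 p dvd swap3 q \<longleftrightarrow> p dvd q"
  using ring_map.map_dvd[OF ring_map_swap3, of p q] ring_map.map_dvd[OF ring_map_swap3, of "swap3 p" "swap3 q"]
  by (auto simp: swap3_swap3)

lemma subst3_swap3: "ring_map h \<Longrightarrow> subst3 h (a, b, c) (swap3 p) = subst3 h (c, b, a) p"
  unfolding swap3_def
  by (subst ring_map_subst3_comp[OF ring_map_subst3 ring_map_const3])
     (simp_all add: subst3_gens)

lemma swap3_curve_form:
  fixes y z :: "'a::field bipoly"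
  defines "y \<equiv> V2" and "z \<equiv> U2"
  shows "swap3 curve_form =
    [: y ^ 7 - y * z ^ 6, 5 * y ^ 2 * z ^ 4 + 5 * y ^ 6, 5 * y * z ^ 4 - 5 * y ^ 3 * z ^ 2 + 10 * y ^ 5,
       10 * y ^ 4 - 10 * y ^ 2 * z ^ 2, 5 * y ^ 3 - 5 * y * z ^ 2, z ^ 2 + y ^ 2 :]"
proof -
  have Y: "Y3 = [:y:]" and Z: "X3 = [:z:]" by (simp_all add: Y3_def X3_def y_def z_def U2_def V2_def)
  have "curve_eq x y' z' = (y' ^ 7 - y' * z' ^ 6) + x * ((5 * y' ^ 2 * z' ^ 4 + 5 * y' ^ 6)
      + x * ((5 * y' * z' ^ 4 - 5 * y' ^ 3 * z' ^ 2 + 10 * y' ^ 5) + x * ((10 * y' ^ 4 - 10 * y' ^ 2 * z' ^ 2) +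
        x * ((5 * y' ^ 3 - 5 * y' * z' ^ 2) + x * (z' ^ 2 + y' ^ 2)))))" for x y' z' :: "'a tripoly"
    unfolding curve_eq_def by Groebner_Basis.algebra
  from this[of Z3 Y3 X3]
  have "swap3 curve_form = [:y ^ 7 - y * z ^ 6:] + Z3 * ([:5 * y ^ 2 * z ^ 4 + 5 * y ^ 6:]
      + Z3 * ([:5 * y * z ^ 4 - 5 * y ^ 3 * z ^ 2 + 10 * y ^ 5:] + Z3 * ([:10 * y ^ 4 - 10 * y ^ 2 * z ^ 2:] +
        Z3 * ([:5 * y ^ 3 - 5 * y * z ^ 2:] + Z3 * [:z ^ 2 + y ^ 2:]))))"
    unfolding curve_form_def ring_map_curve_eq[OF ring_map_swap3] swap3_gens unfolding Y Z
    by (simp only: ring_map.map_simps[OF ring_map_const_poly])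
  then show ?thesis unfolding Z3_def by simp
qed

lemma coeff_cone_N: "coeff (cone_N [:0, c::'a::field:]) 1 = c"
proof -
  have "cone_N s = s + s * (s * (- s * (1 - s ^ 2 + s ^ 4 - s ^ 6 + s ^ 8) * s ^ 4
          + (- s + s ^ 3 - s ^ 5 + s ^ 7)))" for s :: "'a poly"
    unfolding cone_N_def by Groebner_Basis.algebra
  from this[of "[:0, c:]"] show ?thesis by simp
qed

text \<open>
  As a polynomial in X over k[Y,Z], such a G vanishes at the first coordinates of the five conjugate
  points of the cone, which share the values of Y and Z.  They are distinct because the linear
  coefficient of \<open>cone_N\<close> distinguishes the conjugates of s.
\<close>
lemma (in curve_field) cone_degree:
  fixes G :: "'a tripoly"
  assumes G: "cone_subst G = 0" and deg: "degree (swap3 G) < 5"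
  shows "G = 0"
proof -
  note c2 = ring_map_const2
  define Y :: "'a bipoly" where "Y = V2 * (U2 ^ 5 * (1 + U2 ^ 10))"
  define Z :: "'a bipoly" where "Z = V2 * (1 + U2 ^ 10)"
  define root_i :: "nat \<Rightarrow> 'a bipoly" where "root_i i = V2 * cone_N (const2 (\<zeta> ^ i) * U2)" for i
  define H where "H = map_poly (subst2 const2 (Z, Y)) (swap3 G)"
  have s0: "subst2 const2 (Z, Y) 0 = 0"
    by (rule ring_map.map_zero[OF ring_map_subst2[OF c2]])
  have H_root: "poly H (root_i i) = 0" for i
  proof -
    let ?c = "const2 (\<zeta> ^ i)" and ?s = "subst2 const2 (const2 (\<zeta> ^ i) * U2, V2)"
    have "?c ^ 5 = const2 ((\<zeta> ^ i) ^ 5)" by (simp only: ring_map.map_power[OF c2])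
    also have "(\<zeta> ^ i) ^ 5 = 1" using root by (metis power_mult mult.commute power_one)
    finally have c5: "?c ^ 5 = 1" by (simp add: one_pCons)
    then have c10: "?c ^ 10 = 1" using power_mult[of ?c 5 2] by simp
    have "?s (subst3 const2 (V2 * cone_N U2, Y, Z) G) = 0"
      using G ring_map.map_zero[OF ring_map_subst2[OF c2]]
      unfolding Y_def Z_def cone_subst_def by simp
    also have "?s (subst3 const2 (V2 * cone_N U2, Y, Z) G) = subst3 const2 (root_i i, Y, Z) G"
      unfolding Y_def Z_def root_i_def
      by (subst ring_map_subst3_comp[OF ring_map_subst2[OF c2] c2])
         (simp only: ring_map.map_simps[OF ring_map_subst2[OF c2]] subst2_gens[OF c2] power_mult_distrib
            c5 c10 ring_map_cone_N[OF ring_map_subst2[OF c2]] mult_1_left)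
    also have "subst3 const2 (root_i i, Y, Z) G = subst3 const2 (Z, Y, root_i i) (swap3 G)"
      by (simp only: subst3_swap3[OF c2])
    finally show ?thesis by (simp only: subst3_def H_def prod.case)
  qed
  have "inj_on root_i {..<5}"
  proof
    fix i j assume ij: "i \<in> {..<5}" "j \<in> {..<5}" "root_i i = root_i j"
    have "const2 c * U2 = [:[:0, c:]:]" for c :: 'a by (simp add: U2_def)
    then have "cone_N (const2 c * U2) = [:cone_N [:0, c:]:]" for c :: 'a
      using ring_map_cone_N[OF ring_map_const_poly, of "[:0, c:]"] by metis
    moreover have "cone_N (const2 (\<zeta> ^ i) * U2) = cone_N (const2 (\<zeta> ^ j) * U2)"
      using ij(3) unfolding root_i_def by (simp add: V2_def)
    ultimately have "cone_N [:0, \<zeta> ^ i:] = cone_N [:0, \<zeta> ^ j:]" by simp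
    then have "\<zeta> ^ i = \<zeta> ^ j" by (metis coeff_cone_N)
    then show "i = j" using ij zeta_power_inj by simp
  qed
  then have card: "card (root_i ` {..<5}) = 5" by (simp add: card_image)
  have "H = 0"
  proof (rule ccontr)
    assume H: "H \<noteq> 0"
    have "card (root_i ` {..<5}) \<le> card {x. poly H x = 0}"
      using H_root by (intro card_mono poly_roots_finite[OF H]) auto
    also have "\<dots> \<le> degree H" by (rule card_poly_roots_bound[OF H])
    also have "\<dots> \<le> degree (swap3 G)"
      by (rule degree_le) (simp add: H_def coeff_map_poly s0 coeff_eq_0)
    finally show False using deg card by simp
  qed
  then have "subst2 const2 (Z, Y) (coeff (swap3 G) n) = 0" for n
    using coeff_map_poly[of "subst2 const2 (Z, Y)" "swap3 G" n] s0 by (simp add: H_def)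
  then have "coeff (swap3 G) n = 0" for n
    using subst2_independent unfolding Y_def Z_def by blast
  then have "swap3 G = 0" by (simp add: poly_eq_iff)
  then have "swap3 (swap3 G) = swap3 0" by simp
  then show ?thesis by (simp add: swap3_swap3 ring_map.map_zero[OF ring_map_swap3])
qed

lemma dvd_cancel_prime:
  fixes a :: "'a::idom"
  assumes "prime_elem p" "\<not> p dvd a" "a dvd x * p"
  shows "a dvd x"
proof -
  obtain k where k: "x * p = a * k" using assms(3) by (elim dvdE)
  then have "p dvd a * k" by (metis dvd_triv_right)
  then obtain k' where "k = p * k'" using assms by (auto simp: prime_elem_dvd_mult_iff elim: dvdE)
  with k assms(1) have "x = a * k'" by (auto simp: prime_elem_def)
  then show ?thesis by simp
qed

text \<open>
  A form of Gauss's lemma for removing the powers of the leading coefficient that pseudo-division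
  introduces: if a has no common factor with the constant coefficient of F, then a can be split
  off from the coefficients of the quotient one after the other, beginning with the lowest.
\<close>
lemma dvd_cancel_lead_coeff:
  fixes F G :: "'a::idom poly"
  assumes cancel: "\<And>x. a dvd coeff F 0 * x \<Longrightarrow> a dvd x" and a: "a \<noteq> 0"
    and dvd: "F dvd smult (a ^ n) G"
  shows "F dvd G"
  using dvd
proof (induction n)
  case (Suc n)
  then obtain q where q: "smult (a ^ Suc n) G = F * q" by (elim dvdE)
  have "a dvd coeff q m" for m
  proof (induction m rule: less_induct)
    case (less m)
    have "coeff (F * q) m = coeff F 0 * coeff q m + (\<Sum>i\<in>{..m} - {0}. coeff F i * coeff q (m - i))"
      by (simp add: coeff_mult sum.remove[of "{..m}" 0])
    moreover have "a dvd coeff (F * q) m"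
      unfolding q[symmetric] by simp
    moreover have "a dvd (\<Sum>i\<in>{..m} - {0}. coeff F i * coeff q (m - i))"
    proof (rule dvd_sum)
      fix i assume "i \<in> {..m} - {0}"
      then show "a dvd coeff F i * coeff q (m - i)" by (intro dvd_mult less) auto
    qed
    ultimately have "a dvd coeff F 0 * coeff q m" by (simp add: dvd_add_left_iff)
    then show ?case by (rule cancel)
  qed
  then have "[:a:] dvd q" by (simp add: const_poly_dvd_iff)
  then obtain r where "q = smult a r" by (auto elim!: dvdE)
  then have "smult a (smult (a ^ n) G) = smult a (F * r)" using q by simp
  then have "smult (a ^ n) G = F * r" using a unfolding poly_eq_iff coeff_smult by simp
  then show ?case using Suc.IH by simp
qed simp

lemma indeterminate_dvd_iff: "[:0, 1:] dvd p \<longleftrightarrow> coeff p 0 = (0 :: 'a::comm_ring_1)"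
  by (simp add: poly_eq_0_iff_dvd[of p 0, simplified, symmetric] poly_0_coeff_0)

lemma prime_elem_indeterminate: "prime_elem ([:0, 1:] :: 'a::idom poly)"
proof (rule prime_elemI)
  show "[:0, 1:] dvd a \<or> [:0, 1:] dvd b" if "[:0, 1:] dvd a * b" for a b :: "'a poly"
    using that unfolding indeterminate_dvd_iff by (simp add: coeff_mult)
  show "\<not> [:0, 1:] dvd (1 :: 'a poly)" unfolding indeterminate_dvd_iff by simp
qed simp

lemma prime_elem_V2: "prime_elem (V2 :: 'a::field bipoly)"
  unfolding V2_def by (rule prime_elem_indeterminate)

lemma prime_elem_U2: "prime_elem (U2 :: 'a::field bipoly)"
  unfolding U2_def by (simp add: prime_elem_const_poly_iff prime_elem_indeterminate)

lemma lead_coeff_nonzero: "U2 ^ 2 + V2 ^ 2 \<noteq> (0 :: 'a::field bipoly)"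
proof -
  have "coeff (U2 ^ 2 + V2 ^ 2 :: 'a bipoly) 2 = 1"
    by (simp add: U2_def V2_def power2_eq_square eval_nat_numeral)
  then show ?thesis by (metis coeff_0 zero_neq_one)
qed

context curve_field begin

text \<open>
  Modulo the leading coefficient Y^2 + Z^2 of the equation (with respect to X) its constant
  coefficient Y^7 - Y Z^6 is -2 Y Z^6, and 2 is invertible while neither Y nor Z divides Y^2 + Z^2.
\<close>
lemma lead_coeff_cancel:
  fixes x :: "'a bipoly"
  assumes "U2 ^ 2 + V2 ^ 2 dvd (V2 ^ 7 - V2 * U2 ^ 6) * x"
  shows "U2 ^ 2 + V2 ^ 2 dvd x"
proof -
  let ?a = "U2 ^ 2 + V2 ^ 2 :: 'a bipoly"
  have "?a dvd (V2 ^ 7 - V2 * U2 ^ 6) * x - ?a * (V2 * (V2 ^ 4 - V2 ^ 2 * U2 ^ 2 + U2 ^ 4) * x)"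
    using assms by (rule dvd_diff) simp
  also have "(V2 ^ 7 - V2 * U2 ^ 6) * x - ?a * (V2 * (V2 ^ 4 - V2 ^ 2 * U2 ^ 2 + U2 ^ 4) * x)
     = - 2 * (x * V2 * U2 ^ 6)" by Groebner_Basis.algebra
  finally have "?a dvd const2 (- inverse 2) * (- 2 * (x * V2 * U2 ^ 6))" by (rule dvd_mult)
  moreover have "const2 (- inverse 2) * (- 2) = (1 :: 'a bipoly)"
  proof -
    have "const2 (- inverse 2 :: 'a) * const2 (- 2) = const2 (- inverse 2 * (- 2))"
      by (simp only: ring_map.map_mult[OF ring_map_const2])
    moreover have "- inverse 2 * (- 2) = (1::'a)" using two by simp
    ultimately show ?thesis
      by (simp only: ring_map.map_simps[OF ring_map_const2])
  qed
  ultimately have *: "?a dvd x * V2 * U2 ^ 6"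
    by (simp only: mult.assoc[of "const2 (- inverse 2)", symmetric] mult_1_left)
  have nz: "\<not> U2 dvd ?a" "\<not> V2 dvd ?a"
  proof -
    have "U2 dvd (V2 :: 'a bipoly)" if "U2 dvd ?a"
      using that prime_elem_dvd_power[OF prime_elem_U2, of V2 2] by (simp add: dvd_add_right_iff)
    moreover have "\<not> U2 dvd (V2 :: 'a bipoly)"
    proof
      assume "U2 dvd (V2 :: 'a bipoly)"
      then have "[:0, 1:] dvd coeff (V2 :: 'a bipoly) 1" unfolding U2_def const_poly_dvd_iff by blast
      then have "[:0, 1:] dvd (1 :: 'a poly)" by (simp add: V2_def)
      then show False by (simp add: is_unit_pCons_iff)
    qed
    ultimately show "\<not> U2 dvd ?a" by blast
    have "V2 dvd (U2 :: 'a bipoly)" if "V2 dvd ?a"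
      using that prime_elem_dvd_power[OF prime_elem_V2, of U2 2] by (simp add: dvd_add_left_iff)
    moreover have "\<not> V2 dvd (U2 :: 'a bipoly)"
      by (auto simp: U2_def V2_def elim!: dvdE)
    ultimately show "\<not> V2 dvd ?a" by blast
  qed
  have "?a dvd x * V2 * U2 ^ n \<Longrightarrow> ?a dvd x * V2" for n
  proof (induction n)
    case (Suc n)
    then have "?a dvd x * V2 * U2 ^ n * U2" by (simp add: mult_ac)
    then show ?case using dvd_cancel_prime[OF prime_elem_U2 nz(1)] Suc.IH by blast
  qed simp
  then show ?thesis using * dvd_cancel_prime[OF prime_elem_V2 nz(2)] by blast
qed

text \<open>
  Pseudo-division by the equation, of degree 5 in X, leaves a remainder that vanishes on the cone and
  has degree less than 5 in X.
\<close>
lemma curve_form_dvd_of_cone: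
  fixes G :: "'a tripoly"
  assumes G: "cone_subst G = 0"
  shows "curve_form dvd G"
proof -
  let ?F = "swap3 curve_form :: 'a tripoly" and ?a = "U2 ^ 2 + V2 ^ 2 :: 'a bipoly"
  obtain q r where qr: "pseudo_divmod (swap3 G) ?F = (q, r)" by fastforce
  note a = lead_coeff_nonzero[where 'a = 'a]
  have F: "degree ?F = 5" "coeff ?F 5 = ?a" "coeff ?F 0 = V2 ^ 7 - V2 * U2 ^ 6"
    unfolding swap3_curve_form using a by (simp_all add: eval_nat_numeral)
  then have "?F \<noteq> 0" by auto
  from pseudo_divmod[OF this qr] F obtain n where
    n: "smult (?a ^ n) (swap3 G) = ?F * q + r" and r: "r = 0 \<or> degree r < 5" by auto
  have "cone_subst (swap3 r) = 0"
  proof -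
    have "swap3 (smult (?a ^ n) (swap3 G)) = swap3 [:?a ^ n:] * G"
    proof -
      have "smult (?a ^ n) (swap3 G) = [:?a ^ n:] * swap3 G" by simp
      then show ?thesis by (simp only: ring_map.map_mult[OF ring_map_swap3] swap3_swap3)
    qed
    moreover have "swap3 (?F * q + r) = curve_form * swap3 q + swap3 r"
      by (simp only: ring_map.map_mult[OF ring_map_swap3] ring_map.map_add[OF ring_map_swap3] swap3_swap3)
    ultimately have "swap3 r = swap3 [:?a ^ n:] * G - curve_form * swap3 q"
      using n by (simp add: algebra_simps)
    then show ?thesis using G curve_C_cone[OF curve_form_in_curve_C[where 'a = 'a]]
      by (simp add: ring_map.map_simps[OF ring_map_cone_subst])
  qed
  moreover have "degree (swap3 (swap3 r)) < 5" using r by (auto simp: swap3_swap3)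
  ultimately have "swap3 r = 0" by (rule cone_degree)
  then have "r = 0" by (metis swap3_swap3 ring_map.map_zero ring_map_swap3)
  then have "?F dvd smult (?a ^ n) (swap3 G)" using n by simp
  moreover have "?a dvd x" if "?a dvd coeff ?F 0 * x" for x
    using that unfolding F(3) by (rule lead_coeff_cancel)
  ultimately have "?F dvd swap3 G"
    using dvd_cancel_lead_coeff[of ?a ?F n "swap3 G"] a by blast
  then show ?thesis by (simp add: swap3_dvd_iff)
qed

lemma curve_C_eq: "curve_C = {G :: 'a tripoly. curve_form dvd G}"
proof (intro Set.set_eqI iffI)
  fix G :: "'a tripoly" assume "G \<in> curve_C"
  then show "G \<in> {G. curve_form dvd G}" using curve_form_dvd_of_cone curve_C_cone by blast
next
  fix G :: "'a tripoly" assume "G \<in> {G. curve_form dvd G}"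
  then show "G \<in> curve_C" using curve_form_in_curve_C[where 'a = 'a]
    by (auto simp: curve_C_iff ring_map.map_mult[OF ring_map_subst3[OF ring_map_const2]] elim!: dvdE)
qed

text \<open>
  The multiples of the equation are the kernel of a homomorphism to a domain.
\<close>
lemma prime_elem_curve_form: "prime_elem (curve_form :: 'a tripoly)"
proof (rule prime_elemI)
  have dvd: "curve_form dvd G \<longleftrightarrow> subst3 const2 curve_param G = 0" for G :: "'a tripoly"
    using curve_C_eq curve_C_iff by blast
  interpret s: ring_map "subst3 const2 (curve_param :: 'a bipoly \<times> 'a bipoly \<times> 'a bipoly)"
    by (rule ring_map_subst3[OF ring_map_const2])
  show "\<not> curve_form dvd (1 :: 'a tripoly)" unfolding dvd by (simp add: s.map_one)
  show "curve_form dvd a \<or> curve_form dvd b" if "curve_form dvd a * b" for a b :: "'a tripoly"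
    using that unfolding dvd by (simp add: s.map_mult)
  have "swap3 curve_form \<noteq> (0 :: 'a tripoly)"
    unfolding swap3_curve_form using lead_coeff_nonzero[where 'a = 'a] by simp
  then show "curve_form \<noteq> (0 :: 'a tripoly)"
    by (metis ring_map.map_zero ring_map_swap3)
qed

lemma homogeneous3_curve_form: "homogeneous3 7 (curve_form :: 'a tripoly)"
proof -
  have "scale3 (curve_form :: 'a tripoly) = curve_eq (monom X3 1) (monom Y3 1) (monom Z3 1)"
    by (simp only: curve_form_def ring_map_curve_eq[OF ring_map_scale3] scale3_gens)
  also have "\<dots> = curve_eq ([:X3:] * [:0, 1:]) ([:Y3:] * [:0, 1:]) ([:Z3:] * [:0, 1:])"
    by (simp add: monom_Suc monom_0)
  also have "\<dots> = curve_eq [:X3:] [:Y3:] [:Z3:] * [:0, 1:] ^ 7"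
    unfolding curve_eq_def by Groebner_Basis.algebra
  also have "curve_eq [:X3:] [:Y3:] [:Z3:] = [:curve_form :: 'a tripoly:]"
    by (simp only: curve_form_def ring_map_curve_eq[OF ring_map_const_poly])
  finally show ?thesis by (simp add: homogeneous3_iff_scale3 monom_altdef)
qed

end

text \<open>The parametrization in the affine coordinate t = u/v.\<close>
definition affine_param :: "'a::field poly \<times> 'a poly \<times> 'a poly" where
  "affine_param = ([:0, 1:] - [:0, 1:] ^ 7, [:0, 1:] ^ 5 * ([:0, 1:] ^ 2 + 1), [:0, 1:] ^ 2 + 1)"

definition on_curve :: "'a::field tripoly \<Rightarrow> 'a poly" where
  "on_curve = subst3 (\<lambda>c. [:c:]) affine_param"

lemma ring_map_on_curve: "ring_map on_curve"
  unfolding on_curve_def by (intro ring_map_subst3 ring_map_const_poly)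

lemma on_curve_gens:
  "on_curve (const3 c) = [:c:]" "on_curve X3 = [:0, 1:] - [:0, 1:] ^ 7"
  "on_curve Y3 = [:0, 1:] ^ 5 * ([:0, 1:] ^ 2 + 1)" "on_curve Z3 = [:0, 1:] ^ 2 + 1"
  unfolding on_curve_def affine_param_def by (rule subst3_gens[OF ring_map_const_poly])+

lemma on_curve_Z3_nonzero: "on_curve Z3 \<noteq> 0"
  unfolding on_curve_gens by (simp add: power2_eq_square one_pCons)

lemma on_curve_curve_form: "on_curve curve_form = 0"
  unfolding curve_form_def ring_map_curve_eq[OF ring_map_on_curve] on_curve_gens
  using curve_eq_param[of "[:0, 1:]" 1] by simp

lemma (in curve_field) on_curve_eq_0_iff:
  fixes G :: "'a tripoly"
  assumes G: "homogeneous3 d G"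
  shows "on_curve G = 0 \<longleftrightarrow> G \<in> curve_C"
proof
  assume "G \<in> curve_C"
  then show "on_curve G = 0"
    unfolding curve_C_eq using on_curve_curve_form[where 'a = 'a]
    by (auto simp: ring_map.map_mult[OF ring_map_on_curve] elim!: dvdE)
next
  assume 0: "on_curve G = 0"
  define E where "E = 1 - U2 ^ 2 + U2 ^ 4 - U2 ^ 6 + (U2 :: 'a bipoly) ^ 8"
  have "cone_subst G = (V2 * E) ^ d * subst3 const2 (U2 - U2 ^ 7, U2 ^ 5 * (U2 ^ 2 + 1), U2 ^ 2 + 1) G"
    unfolding cone_subst_def E_def cone_factor(1,2) unfolding cone_factor(3)
    by (simp only: subst3_homogeneous_scale[OF G ring_map_const2])
  also have "subst3 const2 (U2 - U2 ^ 7, U2 ^ 5 * (U2 ^ 2 + 1), U2 ^ 2 + 1) G = [:on_curve G:]"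
    unfolding on_curve_def affine_param_def
    by (subst ring_map_subst3_comp[OF ring_map_const_poly ring_map_const_poly])
       (simp only: ring_map.map_simps[OF ring_map_const_poly] U2_def)
  finally have "cone_subst G = 0" using 0 by simp
  then show "G \<in> curve_C" using curve_form_dvd_of_cone curve_C_eq by blast
qed

section \<open>Derivations\<close>

locale derivation =
  fixes \<delta> :: "'r::comm_ring_1 \<Rightarrow> 'r"
  assumes deriv_add: "\<delta> (x + y) = \<delta> x + \<delta> y"
    and deriv_mult: "\<delta> (x * y) = \<delta> x * y + x * \<delta> y"
begin

lemma deriv_0: "\<delta> 0 = 0"
  using deriv_add[of 0 0] by simp

lemma deriv_1: "\<delta> 1 = 0"
  using deriv_mult[of 1 1] by simp

lemma deriv_minus: "\<delta> (- x) = - \<delta> x"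
proof -
  have "\<delta> x + \<delta> (- x) = 0"
    using deriv_add[of x "- x"] deriv_0 by simp
  then show ?thesis by (simp add: eq_neg_iff_add_eq_0 add.commute)
qed

lemma deriv_diff: "\<delta> (x - y) = \<delta> x - \<delta> y"
  using deriv_add[of x "- y"] deriv_minus by simp

lemma deriv_of_nat: "\<delta> (of_nat n) = 0"
  by (induction n) (simp_all add: deriv_0 deriv_1 deriv_add)

lemma deriv_numeral: "\<delta> (numeral n) = 0"
  using deriv_of_nat[of "numeral n"] by simp

lemma deriv_Suc_power: "\<delta> (x ^ Suc n) = of_nat (Suc n) * x ^ n * \<delta> x"
  by (induction n) (simp_all add: deriv_mult algebra_simps)

lemma deriv_power: "\<delta> (x ^ n) = of_nat n * x ^ (n - 1) * \<delta> x"
  by (cases n) (simp_all only: deriv_Suc_power, simp_all add: deriv_1)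

lemma deriv_power_numeral: "\<delta> (x ^ numeral n) = numeral n * x ^ pred_numeral n * \<delta> x"
  using deriv_Suc_power[of x "pred_numeral n"]
  by (simp del: power_Suc add: numeral_eq_Suc[symmetric] of_nat_Suc[symmetric])

lemmas deriv_simps = deriv_add deriv_mult deriv_0 deriv_1 deriv_minus deriv_diff
  deriv_numeral deriv_power_numeral

end

text \<open>
  The derivative along the polynomial vector field (a, b, c): the coefficient of \<epsilon> in
  p(X + a \<epsilon>, Y + b \<epsilon>, Z + c \<epsilon>).
\<close>
definition dir_deriv :: "'a::comm_ring_1 tripoly \<times> 'a tripoly \<times> 'a tripoly \<Rightarrow> 'a tripoly \<Rightarrow> 'a tripoly" where
  "dir_deriv = (\<lambda>(a, b, c) p. coeff (subst3 (\<lambda>k. [:const3 k:]) ([:X3, a:], [:Y3, b:], [:Z3, c:]) p) 1)"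

lemma derivation_dir_deriv: "derivation (dir_deriv v)"
  and dir_deriv_gens: "dir_deriv v (const3 k) = 0" "dir_deriv (a, b, c) X3 = a"
    "dir_deriv (a, b, c) Y3 = b" "dir_deriv (a, b, c) Z3 = c"
proof -
  note c3 = ring_map_comp[OF ring_map_const3 ring_map_const_poly]
  obtain a' b' c' where v: "v = (a', b', c')" by (cases v)
  let ?s = "subst3 (\<lambda>k. [:const3 k:]) ([:X3, a':], [:Y3, b':], [:Z3, c':])"
  interpret s: ring_map ?s by (rule ring_map_subst3[OF c3])
  have s0: "coeff (?s p) 0 = p" for p
  proof -
    have "poly (?s p) 0 = subst3 const3 (X3, Y3, Z3) p"
      by (subst ring_map_subst3_comp[OF ring_map_poly c3]) simp
    then show ?thesis by (simp add: subst3_variables poly_0_coeff_0)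
  qed
  show "derivation (dir_deriv v)"
    by unfold_locales
       (simp_all add: v dir_deriv_def s.map_add s.map_mult coeff_mult s0)
  show "dir_deriv v (const3 k) = 0" "dir_deriv (a, b, c) X3 = a"
    "dir_deriv (a, b, c) Y3 = b" "dir_deriv (a, b, c) Z3 = c"
    by (simp_all add: v dir_deriv_def subst3_gens[OF c3])
qed

lemma dir_deriv_linear:
  fixes p :: "'a::idom tripoly"
  shows "dir_deriv (a, b, c) p = a * dir_deriv (1, 0, 0) p + b * dir_deriv (0, 1, 0) p + c * dir_deriv (0, 0, 1) p"
proof (induction p rule: tripoly_induct)
  case 1
  show ?case by (simp add: derivation.deriv_0[OF derivation_dir_deriv])
next
  case (2 p q)
  then show ?case by (simp add: derivation.deriv_add[OF derivation_dir_deriv] algebra_simps)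
next
  case (3 k i j l)
  show ?case
    by (simp only: derivation.deriv_mult[OF derivation_dir_deriv]
        derivation.deriv_power[OF derivation_dir_deriv] dir_deriv_gens) Groebner_Basis.algebra
qed

text \<open>
  Euler's identity is the case of the radial vector field, with \<mu> = 1.  The general case transfers
  the property of being an eigenvector of a derivation from three elements to the forms in them.
\<close>
lemma derivation_homogeneous:
  fixes G :: "'a::idom tripoly"
  assumes "derivation \<delta>" and const: "\<And>k. \<delta> (const3 k) = 0"
    and f: "\<delta> f0 = \<mu> * f0" "\<delta> f1 = \<mu> * f1" "\<delta> f2 = \<mu> * f2"
    and G: "homogeneous3 e G"
  shows "\<delta> (subst3 const3 (f0, f1, f2) G) = of_nat e * \<mu> * subst3 const3 (f0, f1, f2) G"
proof -
  interpret derivation \<delta> by fact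
  interpret s: ring_map "subst3 const3 (f0, f1, f2)" by (intro ring_map_subst3 ring_map_const3)
  have pow: "\<delta> (x ^ n) = of_nat n * \<mu> * x ^ n" if "\<delta> x = \<mu> * x" for x n
    using that by (induction n) (simp_all add: deriv_mult deriv_1 algebra_simps)
  from G show ?thesis
  proof (induction rule: homogeneous3_induct)
    case (monomial k i j l)
    have "subst3 const3 (f0, f1, f2) (const3 k * X3 ^ i * Y3 ^ j * Z3 ^ l)
      = const3 k * f0 ^ i * f1 ^ j * f2 ^ l"
      by (simp only: s.map_simps subst3_gens[OF ring_map_const3])
    moreover have "\<delta> (const3 k * f0 ^ i * f1 ^ j * f2 ^ l) =
      of_nat (i + j + l) * \<mu> * (const3 k * f0 ^ i * f1 ^ j * f2 ^ l)"
      by (simp only: deriv_mult const pow[OF f(1)] pow[OF f(2)] pow[OF f(3)] of_nat_add) Groebner_Basis.algebra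
    ultimately show ?case using monomial by simp
  qed (simp_all only: s.map_simps deriv_simps distrib_left mult_zero_right)
qed

lemma euler_homogeneous:
  fixes p :: "'a::idom tripoly"
  assumes "homogeneous3 d p"
  shows "X3 * dir_deriv (1, 0, 0) p + Y3 * dir_deriv (0, 1, 0) p + Z3 * dir_deriv (0, 0, 1) p = of_nat d * p"
  using derivation_homogeneous[OF derivation_dir_deriv, of "(X3, Y3, Z3)" X3 1 Y3 Z3 d p] assms
    dir_deriv_linear[of X3 Y3 Z3 p]
  by (simp add: dir_deriv_gens subst3_variables)

lemma homogeneous3_dir_deriv:
  fixes p :: "'a::idom tripoly"
  assumes "homogeneous3 d p" and v: "v \<in> {(1, 0, 0), (0, 1, 0), (0, 0, 1)}"
  shows "homogeneous3 (d - 1) (dir_deriv v p)"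
  using assms(1)
proof (induction rule: homogeneous3_induct)
  case (monomial k i j l)
  have scalar: "homogeneous3 d (of_nat n * q)" if "n \<noteq> 0 \<Longrightarrow> homogeneous3 d q" for n d and q :: "'a tripoly"
    using that homogeneous3_mult[OF homogeneous3_const[of "of_nat n"], of d q]
    by (cases "n = 0") (auto simp: ring_map.map_of_nat[OF ring_map_const3] homogeneous3_0)
  have h: "homogeneous3 n (const3 k * X3 ^ i * Y3 ^ j * Z3 ^ l)" if "n = i + j + l" for n i j l
    using that homogeneous3_mult[OF homogeneous3_mult[OF homogeneous3_mult[OF homogeneous3_const[of k]
      homogeneous3_power[OF homogeneous3_X, of i]] homogeneous3_power[OF homogeneous3_Y, of j]]
      homogeneous3_power[OF homogeneous3_Z, of l]] by simp
  have "dir_deriv (1, 0, 0) (const3 k * X3 ^ i * Y3 ^ j * Z3 ^ l) = of_nat i * (const3 k * X3 ^ (i - 1) * Y3 ^ j * Z3 ^ l)"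
    "dir_deriv (0, 1, 0) (const3 k * X3 ^ i * Y3 ^ j * Z3 ^ l) = of_nat j * (const3 k * X3 ^ i * Y3 ^ (j - 1) * Z3 ^ l)"
    "dir_deriv (0, 0, 1) (const3 k * X3 ^ i * Y3 ^ j * Z3 ^ l) = of_nat l * (const3 k * X3 ^ i * Y3 ^ j * Z3 ^ (l - 1))"
    by (simp_all only: derivation.deriv_mult[OF derivation_dir_deriv]
        derivation.deriv_power[OF derivation_dir_deriv] dir_deriv_gens
        mult_zero_left mult_zero_right add_0_left add_0_right mult_1_left mult_1_right mult_ac)
  moreover have "homogeneous3 (d - 1) (of_nat i * (const3 k * X3 ^ (i - 1) * Y3 ^ j * Z3 ^ l))"
    using monomial by (intro scalar h) auto
  moreover have "homogeneous3 (d - 1) (of_nat j * (const3 k * X3 ^ i * Y3 ^ (j - 1) * Z3 ^ l))"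
    using monomial by (intro scalar h) auto
  moreover have "homogeneous3 (d - 1) (of_nat l * (const3 k * X3 ^ i * Y3 ^ j * Z3 ^ (l - 1)))"
    using monomial by (intro scalar h) auto
  ultimately show ?case using v by auto
qed (simp_all add: derivation.deriv_simps[OF derivation_dir_deriv] homogeneous3_0 homogeneous3_add)

section \<open>Divisibility of Jacobians\<close>

lemma prime_elem_dvd_sym:
  fixes p q :: "'a::idom"
  assumes p: "prime_elem p" and q: "prime_elem q" and "p dvd q"
  shows "q dvd p"
proof (rule ccontr)
  assume "\<not> q dvd p"
  obtain k where k: "q = p * k" using \<open>p dvd q\<close> by (elim dvdE)
  then have "q dvd k" using q \<open>\<not> q dvd p\<close> by (metis dvd_refl prime_elem_dvd_multD)
  then obtain j where "k = q * j" by (elim dvdE)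
  with k have "q * 1 = q * (p * j)" by (simp add: mult.left_commute)
  then have "p * j = 1" using q unfolding prime_elem_def by (metis mult_cancel_left)
  then show False using p by (metis dvd_triv_left prime_elem_def)
qed

lemma prime_power_dvd_multD:
  fixes p :: "'a::idom"
  assumes p: "prime_elem p" "\<not> p dvd a"
  shows "p ^ n dvd a * x \<Longrightarrow> p ^ n dvd x"
proof (induction n arbitrary: x)
  case (Suc n)
  then have "p dvd a * x" by (metis dvd_mult_left power_Suc)
  then obtain y where y: "x = p * y" using p by (auto simp: prime_elem_dvd_mult_iff elim: dvdE)
  have "p * p ^ n dvd p * (a * y)" using Suc.prems unfolding y by (simp add: mult_ac)
  then have "p ^ n dvd a * y" using p(1) by (simp add: prime_elem_def)
  then have "p ^ n dvd y" by (rule Suc.IH)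
  then show ?case unfolding y by simp
qed simp

context
  fixes \<delta>1 \<delta>2 :: "'r::idom \<Rightarrow> 'r"
  assumes d1: "derivation \<delta>1" and d2: "derivation \<delta>2"
begin

definition bracket :: "'r \<Rightarrow> 'r \<Rightarrow> 'r" where
  "bracket a b = \<delta>1 a * \<delta>2 b - \<delta>2 a * \<delta>1 b"

text \<open>
  The determinant with the rows (a, b, c), (\<delta>1 a, \<delta>1 b, \<delta>1 c), (\<delta>2 a, \<delta>2 b, \<delta>2 c).  For forms of
  degree d and two partial derivatives it is, by Euler's identity, a coordinate times 1/d of the
  Jacobian determinant, and it makes sense also if the characteristic divides d.
\<close>
definition jacobian :: "'r \<Rightarrow> 'r \<Rightarrow> 'r \<Rightarrow> 'r" where
  "jacobian a b c = a * bracket b c + b * bracket c a + c * bracket a b"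

text \<open>
  A derivation lowers the exponent of E in A by one, but only through a term with the factor \<open>\<delta> E\<close>.
  In the bracket of u and A this term carries the bracket of u and E, which is divisible by E
  because u is, and in the last summand the missing factor E is supplied by u.
\<close>
lemma bracket_dvd:
  assumes "E dvd u" "E ^ n dvd A"
  shows "E ^ n dvd z * bracket u A - m * A * bracket u z - u * bracket z A"
proof (cases n)
  case (Suc k)
  interpret d1: derivation \<delta>1 by (rule d1)
  interpret d2: derivation \<delta>2 by (rule d2)
  obtain u' where u: "u = E * u'" using assms(1) by (elim dvdE)
  obtain A' where A: "A = E ^ Suc k * A'" using assms(2) Suc by (elim dvdE) auto
  define P where "P = E ^ k"
  have dA: "\<delta>1 A = E * P * \<delta>1 A' + of_nat (Suc k) * P * \<delta>1 E * A'"
    "\<delta>2 A = E * P * \<delta>2 A' + of_nat (Suc k) * P * \<delta>2 E * A'"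
    unfolding A P_def by (simp_all add: d1.deriv_mult d2.deriv_mult d1.deriv_Suc_power d2.deriv_Suc_power
        del: power_Suc of_nat_Suc) simp_all
  have A2: "A = E * P * A'" by (simp add: A P_def)
  define N :: 'r where "N = of_nat (Suc k)"
  define r where "r = z * (u' * (\<delta>1 E * \<delta>2 A' - \<delta>2 E * \<delta>1 A') + E * (\<delta>1 u' * \<delta>2 A' - \<delta>2 u' * \<delta>1 A')
      + N * A' * (\<delta>1 u' * \<delta>2 E - \<delta>2 u' * \<delta>1 E)) - m * A' * bracket u z
      - u' * (E * (\<delta>1 z * \<delta>2 A' - \<delta>2 z * \<delta>1 A') + N * A' * (\<delta>1 z * \<delta>2 E - \<delta>2 z * \<delta>1 E))"
  have "z * bracket u A - m * A * bracket u z - u * bracket z A = (E * P) * r"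
    unfolding r_def bracket_def u d1.deriv_mult d2.deriv_mult dA N_def[symmetric] unfolding A2
    by Groebner_Basis.algebra
  then show ?thesis unfolding Suc P_def by simp
qed simp

text \<open>
  The formal properties of a form A of degree m in x, y, z with partial derivatives H0, H1, H2: the
  chain rule for both derivations and Euler's identity.
\<close>
definition gradient :: "'r \<Rightarrow> 'r \<Rightarrow> 'r \<times> 'r \<times> 'r \<Rightarrow> 'r \<times> 'r \<times> 'r \<Rightarrow> bool" where
  "gradient m A = (\<lambda>(H0, H1, H2) (x, y, z).
     \<delta>1 A = H0 * \<delta>1 x + H1 * \<delta>1 y + H2 * \<delta>1 z \<and>
     \<delta>2 A = H0 * \<delta>2 x + H1 * \<delta>2 y + H2 * \<delta>2 z \<and>
     m * A = H0 * x + H1 * y + H2 * z)"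

lemma bracket_form:
  assumes "gradient m A (H0, H1, H2) (x, y, z)"
    and u: "u = p * x - q * z" and du: "\<delta>1 u = p * \<delta>1 x - q * \<delta>1 z" "\<delta>2 u = p * \<delta>2 x - q * \<delta>2 z"
  shows "z * bracket u A - m * A * bracket u z - u * bracket z A = p * H1 * jacobian x y z"
proof -
  have g: "\<delta>1 A = H0 * \<delta>1 x + H1 * \<delta>1 y + H2 * \<delta>1 z"
    "\<delta>2 A = H0 * \<delta>2 x + H1 * \<delta>2 y + H2 * \<delta>2 z" "m * A = H0 * x + H1 * y + H2 * z"
    using assms(1) by (simp_all add: gradient_def)
  show ?thesis unfolding bracket_def jacobian_def g du unfolding u by Groebner_Basis.algebra
qed

text \<open>
  The geometric situation is that (x, y, z) maps the curve E into the line given by p x = q z.  Then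
  H1 is the derivative of A in the direction of this line, and \<open>bracket_form\<close> expresses H1 times the
  Jacobian by A and by u = p x - q z, which vanishes on E.
\<close>
lemma power_dvd_jacobian:
  assumes E: "prime_elem E" "\<not> E dvd p" "E dvd u" "E ^ n dvd A"
    and A: "gradient m A (H0, H1, H2) (x, y, z)"
    and u: "u = p * x - q * z" "\<delta>1 u = p * \<delta>1 x - q * \<delta>1 z" "\<delta>2 u = p * \<delta>2 x - q * \<delta>2 z"
  shows "E ^ n dvd H1 * jacobian x y z"
proof -
  have "E ^ n dvd p * (H1 * jacobian x y z)"
    using bracket_dvd[OF E(3,4), of z m] unfolding bracket_form[OF A u] by (simp add: mult.assoc)
  then show ?thesis by (rule prime_power_dvd_multD[OF E(1,2)])
qed

end

text \<open>
  Let e be the exponent of E in H1.  If n > e, applying \<open>power_dvd_jacobian\<close> to A gives the exponent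
  n - e for the Jacobian, and applying it to H1, whose derivative G1 is not divisible by E, gives the
  exponent e.  The sum is n.  This is where multiplicity at most 2 enters.
\<close>
lemma power_dvd_jacobian_square:
  fixes E :: "'r::{idom, factorial_semiring}"
  assumes d: "derivation \<delta>1" "derivation \<delta>2"
    and E: "prime_elem E" "\<not> E dvd p" "E dvd u" "E ^ n dvd A"
    and A: "gradient \<delta>1 \<delta>2 m A (H0, H1, H2) (x, y, z)"
    and H1: "\<not> E dvd H1 \<or> (\<exists>m' G0 G1 G2. gradient \<delta>1 \<delta>2 m' H1 (G0, G1, G2) (x, y, z) \<and> \<not> E dvd G1)"
    and u: "u = p * x - q * z" "\<delta>1 u = p * \<delta>1 x - q * \<delta>1 z" "\<delta>2 u = p * \<delta>2 x - q * \<delta>2 z"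
  shows "E ^ n dvd (jacobian \<delta>1 \<delta>2 x y z) ^ 2"
proof -
  let ?D = "jacobian \<delta>1 \<delta>2 x y z"
  have 1: "E ^ n dvd H1 * ?D" by (rule power_dvd_jacobian[OF d E A u])
  show ?thesis
  proof (cases "E dvd H1")
    case False
    then have "E ^ n dvd ?D" using 1 prime_power_dvd_multD[OF E(1)] by blast
    then show ?thesis by (simp add: power2_eq_square)
  next
    case True
    then obtain m' G0 G1 G2 where G: "gradient \<delta>1 \<delta>2 m' H1 (G0, G1, G2) (x, y, z)" "\<not> E dvd G1"
      using H1 by blast
    have 2: "E ^ k dvd ?D" if "E ^ k dvd H1" for k
      using power_dvd_jacobian[OF d E(1-3) that G(1) u] prime_power_dvd_multD[OF E(1) G(2)] by blast
    show ?thesis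
    proof (cases "H1 = 0")
      case True
      then have "E ^ n dvd ?D" by (intro 2) simp
      then show ?thesis by (simp add: power2_eq_square)
    next
      case False
      define e where "e = multiplicity E H1"
      obtain h where h: "H1 = E ^ e * h" "\<not> E dvd h"
        using multiplicity_decompose'[of H1 E] False E(1) unfolding e_def
        by (metis prime_elem_def prime_elem_not_unit)
      have e: "E ^ e dvd ?D" using 2 h(1) by simp
      show ?thesis
      proof (cases "n \<le> e")
        case True
        then have "E ^ n dvd ?D" using e power_le_dvd by blast
        then show ?thesis by (simp add: power2_eq_square)
      next
        case False
        then have "E ^ e * E ^ (n - e) dvd E ^ e * (h * ?D)"
          using 1 unfolding h(1) by (simp add: power_add[symmetric] mult.assoc)
        then have "E ^ (n - e) dvd h * ?D" using E(1) by (simp add: prime_elem_def)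
        then have "E ^ (n - e) dvd ?D" using prime_power_dvd_multD[OF E(1) h(2)] by blast
        with e have "E ^ e * E ^ (n - e) dvd ?D * ?D" by (intro mult_dvd_mono)
        then show ?thesis using False by (simp add: power2_eq_square power_add[symmetric])
      qed
    qed
  qed
qed

section \<open>Partial derivatives of the equation\<close>

definition curve_X :: "'a::comm_ring_1 \<Rightarrow> 'a \<Rightarrow> 'a \<Rightarrow> 'a" where
  "curve_X x y z = 5 * x ^ 4 * z ^ 2 + 5 * y * (2 * x + y) * z ^ 4 - 10 * x * y * (x + y) * (2 * x + y) * z ^ 2
     + 5 * y ^ 2 * (x + y) ^ 4"

definition curve_Y :: "'a::comm_ring_1 \<Rightarrow> 'a \<Rightarrow> 'a \<Rightarrow> 'a" where
  "curve_Y x y z = 5 * x * (x + 2 * y) * z ^ 4 - z ^ 6 - 5 * x ^ 2 * (x + y) * (x + 3 * y) * z ^ 2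
     + y * (x + y) ^ 4 * (2 * x + 7 * y)"

definition curve_Z :: "'a::comm_ring_1 \<Rightarrow> 'a \<Rightarrow> 'a \<Rightarrow> 'a" where
  "curve_Z x y z = 2 * x ^ 5 * z - 6 * y * z ^ 5 + 20 * x * y * (x + y) * z ^ 3 - 10 * x ^ 2 * y * (x + y) ^ 2 * z"

definition curve_XX :: "'a::comm_ring_1 \<Rightarrow> 'a \<Rightarrow> 'a \<Rightarrow> 'a" where
  "curve_XX x y z = 20 * x ^ 3 * z ^ 2 + 10 * y * z ^ 4 - 10 * y * (6 * x ^ 2 + 6 * x * y + y ^ 2) * z ^ 2
     + 20 * y ^ 2 * (x + y) ^ 3"

definition curve_ZZ :: "'a::comm_ring_1 \<Rightarrow> 'a \<Rightarrow> 'a \<Rightarrow> 'a" where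
  "curve_ZZ x y z = 2 * x ^ 5 - 30 * y * z ^ 4 + 60 * x * y * (x + y) * z ^ 2 - 10 * x ^ 2 * y * (x + y) ^ 2"

lemma derivation_curve_eq:
  fixes \<delta> :: "'r::idom \<Rightarrow> 'r"
  assumes "derivation \<delta>"
  shows "\<delta> (curve_eq x y z) = curve_X x y z * \<delta> x + curve_Y x y z * \<delta> y + curve_Z x y z * \<delta> z"
proof -
  interpret derivation \<delta> by fact
  show ?thesis
    unfolding curve_eq_def curve_X_def curve_Y_def curve_Z_def
    by (simp only: deriv_simps pred_numeral_simps arith_simps numeral_One power_one_right BitM.simps) Groebner_Basis.algebra
qed

lemma derivation_curve_X:
  fixes \<delta> :: "'r::idom \<Rightarrow> 'r"
  assumes "derivation \<delta>"
  shows "\<delta> (curve_X x y z) = curve_XX x y z * \<delta> x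
    + (10 * (x + y) * z ^ 4 - 10 * (2 * x ^ 3 + 6 * x ^ 2 * y + 3 * x * y ^ 2) * z ^ 2 + 10 * y * (x + y) ^ 4 + 20 * y ^ 2 * (x + y) ^ 3) * \<delta> y
    + (10 * x ^ 4 * z + 20 * y * (2 * x + y) * z ^ 3 - 20 * x * y * (x + y) * (2 * x + y) * z) * \<delta> z"
proof -
  interpret derivation \<delta> by fact
  show ?thesis
    unfolding curve_X_def curve_XX_def
    by (simp only: deriv_simps pred_numeral_simps arith_simps numeral_One power_one_right BitM.simps) Groebner_Basis.algebra
qed

lemma derivation_curve_Z:
  fixes \<delta> :: "'r::idom \<Rightarrow> 'r"
  assumes "derivation \<delta>"
  shows "\<delta> (curve_Z x y z) = (10 * x ^ 4 * z + 20 * y * (2 * x + y) * z ^ 3 - 20 * x * y * (x + y) * (2 * x + y) * z) * \<delta> x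
    + (20 * x * (x + 2 * y) * z ^ 3 - 6 * z ^ 5 - 10 * x ^ 2 * (x + y) * (x + 3 * y) * z) * \<delta> y
    + curve_ZZ x y z * \<delta> z"
proof -
  interpret derivation \<delta> by fact
  show ?thesis
    unfolding curve_Z_def curve_ZZ_def
    by (simp only: deriv_simps pred_numeral_simps arith_simps numeral_One power_one_right BitM.simps) Groebner_Basis.algebra
qed

section \<open>Elimination\<close>

text \<open>
  The homogenization a^n q(b/a) of degree n.
\<close>
definition binary_form :: "('a::field \<Rightarrow> 'r::comm_ring_1) \<Rightarrow> nat \<Rightarrow> 'a poly \<Rightarrow> 'r \<Rightarrow> 'r \<Rightarrow> 'r" where
  "binary_form h n q a b = (\<Sum>i\<le>n. h (coeff q i) * b ^ i * a ^ (n - i))"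

lemma binary_form_linear_factor:
  assumes "ring_map h" and q: "degree q \<le> n"
  shows "binary_form h (Suc n) ([:- \<alpha>, 1:] * q) a b = (b - h \<alpha> * a) * binary_form h n q a b"
proof -
  interpret ring_map h by fact
  have c: "coeff ([:- \<alpha>, 1:] * q) i = (case i of 0 \<Rightarrow> 0 | Suc j \<Rightarrow> coeff q j) - \<alpha> * coeff q i" for i
    by (simp add: coeff_pCons)
  have "binary_form h (Suc n) ([:- \<alpha>, 1:] * q) a b
    = (\<Sum>i\<le>Suc n. h (case i of 0 \<Rightarrow> 0 | Suc j \<Rightarrow> coeff q j) * b ^ i * a ^ (Suc n - i))
      - (\<Sum>i\<le>Suc n. h (\<alpha> * coeff q i) * b ^ i * a ^ (Suc n - i))"
    unfolding binary_form_def c by (simp only: map_diff left_diff_distrib sum_subtractf)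
  also have "(\<Sum>i\<le>Suc n. h (case i of 0 \<Rightarrow> 0 | Suc j \<Rightarrow> coeff q j) * b ^ i * a ^ (Suc n - i))
      = b * binary_form h n q a b"
    by (subst sum.atMost_Suc_shift) (simp add: binary_form_def map_zero sum_distrib_left mult_ac)
  also have "(\<Sum>i\<le>Suc n. h (\<alpha> * coeff q i) * b ^ i * a ^ (Suc n - i)) = h \<alpha> * a * binary_form h n q a b"
    using q by (simp add: binary_form_def map_mult map_zero sum_distrib_left coeff_eq_0 Suc_diff_le mult_ac)
  finally show ?thesis by (simp add: algebra_simps)
qed

text \<open>
  Over an algebraically closed field q is a product of linear factors, and the prime E divides the
  homogenization of one of them, or a if the degree of q is less than n.
\<close>
lemma prime_dvd_binary_form:
  fixes q :: "'a::alg_closed_field poly" and a b :: "'r::idom"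
  assumes h: "ring_map h" and E: "prime_elem E"
    and "E dvd binary_form h n q a b" "q \<noteq> 0" "degree q \<le> n"
  shows "E dvd a \<or> (\<exists>\<alpha>. E dvd b - h \<alpha> * a)"
  using assms(3-5)
proof (induction n arbitrary: q)
  interpret ring_map h by fact
  have unit: "\<not> E dvd h c" if "c \<noteq> 0" for c
  proof
    assume "E dvd h c"
    then have "E dvd h c * h (inverse c)" by simp
    moreover have "h c * h (inverse c) = h (c * inverse c)" by (simp only: map_mult)
    ultimately have "E dvd 1" using that by (simp add: map_one)
    with E show False by (simp add: prime_elem_def)
  qed
  {
    case (0 q)
    then have "E dvd h (coeff q 0)" "coeff q 0 \<noteq> 0"
      by (auto simp: binary_form_def elim: degree_eq_zeroE)
    with unit show ?case by blast
  next
    case (Suc n q)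
    show ?case
    proof (cases "degree q = 0")
      case True
      then obtain c where c: "q = [:c:]" "c \<noteq> 0" using Suc.prems by (auto elim: degree_eq_zeroE)
      have "binary_form h (Suc n) q a b = h c * a ^ Suc n"
        unfolding binary_form_def
        by (subst sum.atMost_Suc_shift) (simp add: c(1) map_zero del: power_Suc)
      then have "E dvd h c * a ^ Suc n" using Suc.prems(1) by simp
      then have "E dvd a ^ Suc n" using unit[OF c(2)] E by (simp add: prime_elem_dvd_mult_iff)
      then show ?thesis using E prime_elem_dvd_power by blast
    next
      case False
      then obtain \<alpha> where "poly q \<alpha> = 0" using alg_closed_imp_poly_has_root by blast
      then obtain q' where q': "q = [:- \<alpha>, 1:] * q'" by (auto simp: poly_eq_0_iff_dvd elim: dvdE)
      with Suc.prems have nz: "q' \<noteq> 0" by auto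
      then have "degree q = Suc (degree q')" unfolding q' by (subst degree_mult_eq) auto
      with Suc.prems have deg: "degree q' \<le> n" by simp
      have "E dvd (b - h \<alpha> * a) * binary_form h n q' a b"
        using Suc.prems(1) unfolding q' binary_form_linear_factor[OF h deg] .
      then show ?thesis using Suc.IH[OF _ nz deg] E by (auto simp: prime_elem_dvd_mult_iff)
    qed
  }
qed

definition dehomogenize :: "'a::field bipoly \<Rightarrow> 'a poly" where
  "dehomogenize = subst2 (\<lambda>c. [:c:]) (1, [:0, 1:])"

lemma subst2_eq_binary_form:
  assumes r: "homogeneous2 n r" and h: "ring_map h"
  shows "subst2 h (a, b) r = binary_form h n (dehomogenize r) a b" (is ?eq)
    and "degree (dehomogenize r) \<le> n" (is ?deg)
proof -
  interpret ring_map h by fact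
  interpret s: ring_map "subst2 h (a, b)" by (rule ring_map_subst2[OF h])
  interpret d: ring_map "dehomogenize :: 'a bipoly \<Rightarrow> 'a poly"
    unfolding dehomogenize_def by (intro ring_map_subst2 ring_map_const_poly)
  have "?eq \<and> ?deg" using r
  proof (induction rule: homogeneous2_induct)
    case zero
    show ?case by (simp add: binary_form_def map_zero s.map_zero d.map_zero)
  next
    case (add p p')
    then show ?case
      by (auto simp: binary_form_def map_add s.map_add d.map_add degree_add_le algebra_simps sum.distrib)
  next
    case (monomial c i j)
    have d: "dehomogenize (const2 c * U2 ^ i * V2 ^ j) = monom c j"
      by (simp only: d.map_simps, simp only: dehomogenize_def subst2_gens[OF ring_map_const_poly])
         (simp add: monom_altdef)
    have "binary_form h n (monom c j) a b = (\<Sum>k\<le>n. if j = k then h c * b ^ k * a ^ (n - k) else 0)"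
      unfolding binary_form_def by (intro sum.cong) (auto simp: map_zero)
    also have "\<dots> = h c * b ^ j * a ^ i" using monomial by (auto simp: sum.delta')
    finally have "subst2 h (a, b) (const2 c * U2 ^ i * V2 ^ j) = binary_form h n (monom c j) a b"
      by (simp only: s.map_simps subst2_gens[OF h]) (simp only: mult_ac)
    then show ?case unfolding d using monomial degree_monom_le[of c j] by auto
  qed
  then show ?eq ?deg by auto
qed

lemma prime_dvd_homogeneous2:
  fixes r :: "'a::alg_closed_field bipoly" and a b :: "'r::idom"
  assumes h: "ring_map h" and E: "prime_elem E" and r: "homogeneous2 n r" "r \<noteq> 0"
    and "E dvd subst2 h (a, b) r"
  shows "E dvd a \<or> (\<exists>\<alpha>. E dvd b - h \<alpha> * a)"
proof -
  note q = subst2_eq_binary_form[OF r(1)]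
  have "r = subst2 const2 (U2, V2) r"
    by (rule ring_map_bipoly_eqI[OF ring_map_id ring_map_subst2[OF ring_map_const2]])
       (simp_all add: subst2_gens[OF ring_map_const2])
  also have "\<dots> = binary_form const2 n (dehomogenize r) U2 V2"
    by (rule q(1)[OF ring_map_const2])
  finally have "dehomogenize r \<noteq> 0" using r(2) by (auto simp: binary_form_def)
  then show ?thesis
    using prime_dvd_binary_form[OF h E] assms(5) q(1)[OF h] q(2)[OF h] by metis
qed

text \<open>
  Elimination without resultants.  By pseudo-division, an element s of least degree in the ideal
  (p, q) divides nonzero constant multiples of p and of q.  Since p is prime and does not divide q,
  it does not divide s, and so s divides a nonzero constant.
\<close>
lemma prime_elem_eliminate:
  fixes p q :: "'a::idom poly"
  assumes p: "prime_elem p" "degree p > 0" and "\<not> p dvd q"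
  obtains a b r where "a * p + b * q = [:r:]" "r \<noteq> 0"
proof -
  define ideal where "ideal = {a * p + b * q | a b. True}"
  have "p = 1 * p + 0 * q" "q = 0 * p + 1 * q" by simp_all
  then have pq: "p \<in> ideal" "q \<in> ideal" unfolding ideal_def by blast+
  have closed: "c * x - y * d \<in> ideal" if "x \<in> ideal" "y \<in> ideal" for c x d y
  proof -
    obtain a b a' b' where "x = a * p + b * q" "y = a' * p + b' * q" using \<open>x \<in> ideal\<close> \<open>y \<in> ideal\<close> by (auto simp: ideal_def)
    then have "c * x - y * d = (c * a - a' * d) * p + (c * b - b' * d) * q" by (simp add: algebra_simps)
    then show ?thesis unfolding ideal_def by blast
  qed
  have "p \<in> ideal \<and> p \<noteq> 0" using pq p by (auto simp: prime_elem_def)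
  then obtain s where s: "s \<in> ideal" "s \<noteq> 0" and min: "\<And>t. t \<in> ideal \<Longrightarrow> t \<noteq> 0 \<Longrightarrow> degree s \<le> degree t"
    using ex_has_least_nat[of "\<lambda>s. s \<in> ideal \<and> s \<noteq> 0" p degree] by blast
  have dvd: "\<exists>c. c \<noteq> 0 \<and> s dvd [:c:] * t" if t: "t \<in> ideal" for t
  proof -
    obtain d r where "pseudo_divmod t s = (d, r)" by fastforce
    from pseudo_divmod[OF s(2) this] obtain c where c: "smult c t = s * d + r" "c \<noteq> 0" and r: "r = 0 \<or> degree r < degree s"
      using s(2) by (metis leading_coeff_0_iff power_not_zero)
    have "r = [:c:] * t - s * d" using c(1) by simp
    then have "r \<in> ideal" using closed[OF t s(1), of "[:c:]" d] by simp
    with r min have "r = 0" by (metis not_le)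
    with c show ?thesis by (intro exI[of _ c]) simp
  qed
  have "degree s = 0"
  proof -
    obtain c k where c: "c \<noteq> 0" and k: "[:c:] * p = s * k" using dvd[OF pq(1)] by (elim exE conjE dvdE)
    then have "p dvd s * k" by (metis dvd_triv_right)
    then consider "p dvd s" | "p dvd k" using p(1) by (auto simp: prime_elem_dvd_mult_iff)
    then show ?thesis
    proof cases
      case 1
      obtain c' where c': "c' \<noteq> 0" "s dvd [:c':] * q" using dvd[OF pq(2)] by blast
      with 1 have "p dvd [:c':] * q" using dvd_trans by blast
      then have "p dvd [:c':]" using assms(3) p(1) prime_elem_dvd_multD by blast
      then have "degree p \<le> degree [:c':]" using c' by (intro dvd_imp_degree_le) auto
      with p(2) show ?thesis by simp
    next
      case 2
      then obtain k' where "k = p * k'" by (elim dvdE)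
      with k have "p * [:c:] = p * (s * k')" by (simp only: mult_ac)
      moreover have "p \<noteq> 0" using p(2) by auto
      ultimately have "[:c:] = s * k'" by (metis mult_cancel_left)
      then have "s dvd [:c:]" by simp
      then have "degree s \<le> degree [:c:]" using c by (intro dvd_imp_degree_le) auto
      then show ?thesis by simp
    qed
  qed
  then obtain r where r: "s = [:r:]" by (elim degree_eq_zeroE)
  obtain a b where "s = a * p + b * q" using s(1) unfolding ideal_def by blast
  with r s(2) show ?thesis using that[of a b r] by simp
qed

lemma homogeneous3_swap3: "homogeneous3 d p \<Longrightarrow> homogeneous3 d (swap3 p)"
  using homogeneous3_subst3[OF _ homogeneous3_Z homogeneous3_Y homogeneous3_X, of d p]
  by (simp add: swap3_def)

text \<open>
  Eliminating X gives a polynomial in Y and Z, which need not be a form.  Since both generators are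
  forms, each of its homogeneous components is again in the ideal.
\<close>
lemma (in curve_field) eliminate_from_curve:
  fixes h :: "'a tripoly"
  assumes h: "homogeneous3 e h" "\<not> curve_form dvd h"
  obtains a b n r where "a * curve_form + b * h = subst2 const3 (Z3, Y3) r" "homogeneous2 n r" "r \<noteq> 0"
proof -
  let ?F = "swap3 curve_form :: 'a tripoly"
  interpret sw: ring_map "swap3 :: 'a tripoly \<Rightarrow> 'a tripoly" by (rule ring_map_swap3)
  interpret sc: ring_map "scale3 :: 'a tripoly \<Rightarrow> 'a tripoly poly" by (rule ring_map_scale3)
  have prime: "prime_elem ?F"
  proof (rule prime_elemI)
    show "?F \<noteq> 0" using prime_elem_curve_form by (metis prime_elem_def swap3_swap3 sw.map_zero)
    show "\<not> ?F dvd 1" using prime_elem_curve_form swap3_dvd_iff[of curve_form 1] by (metis prime_elem_def sw.map_one)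
    show "?F dvd a \<or> ?F dvd b" if "?F dvd a * b" for a b
    proof -
      have "curve_form dvd swap3 a * swap3 b"
        using that sw.map_dvd[OF that] by (simp add: swap3_swap3 sw.map_mult)
      then have "curve_form dvd swap3 a \<or> curve_form dvd swap3 b"
        using prime_elem_curve_form by (simp add: prime_elem_dvd_mult_iff)
      then show ?thesis using swap3_dvd_iff by (metis swap3_swap3)
    qed
  qed
  have deg: "degree ?F > 0"
    unfolding swap3_curve_form using lead_coeff_nonzero[where 'a = 'a] by simp
  obtain a b r where abr: "a * ?F + b * swap3 h = [:r:]" "r \<noteq> 0"
    using prime_elem_eliminate[OF prime deg, of "swap3 h"] h(2) by (auto simp: swap3_dvd_iff)
  have "poly (scale3 [:r:]) 1 \<noteq> 0" using abr(2) by (simp add: poly_scale3_one)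
  then have "scale3 [:r:] \<noteq> 0" by auto
  then obtain n where n: "coeff (scale3 [:r:]) n \<noteq> 0" by (metis poly_eqI coeff_0)
  define r' where "r' = coeff (coeff (scale3 [:r:]) n) 0"
  have r': "coeff (scale3 [:r:]) n = [:r':]"
  proof (rule poly_eqI)
    show "coeff (coeff (scale3 [:r:]) n) l = coeff [:r':] l" for l
    proof (cases l)
      case (Suc l')
      then have "coeff (coeff (coeff (coeff (scale3 [:r:]) n) l) j) i = 0" for i j
        unfolding coeff_scale3 by simp
      then have "coeff (coeff (scale3 [:r:]) n) l = 0" by (intro poly_eqI) simp
      then show ?thesis using Suc by simp
    qed (simp add: r'_def)
  qed
  have hom: "homogeneous2 n r'"
    unfolding homogeneous2_def r'_def coeff_scale3 by auto
  define a' where "a' = coeff (scale3 a * monom 1 7) n"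
  define b' where "b' = coeff (scale3 b * monom 1 e) n"
  have "scale3 [:r:] = scale3 a * monom ?F 7 + scale3 b * monom (swap3 h) e"
    unfolding abr(1)[symmetric] sc.map_add sc.map_mult
    using homogeneous3_swap3[OF homogeneous3_curve_form] homogeneous3_swap3[OF h(1)]
    by (simp add: homogeneous3_iff_scale3)
  also have "\<dots> = smult ?F (scale3 a * monom 1 7) + smult (swap3 h) (scale3 b * monom 1 e)"
    by (simp only: mult_smult_right[symmetric] smult_monom mult_1_right)
  finally have "[:r':] = ?F * a' + swap3 h * b'"
    unfolding r'[symmetric] a'_def b'_def by simp
  then have "swap3 [:r':] = curve_form * swap3 a' + h * swap3 b'"
    by (simp only: sw.map_add sw.map_mult swap3_swap3)
  moreover have "swap3 [:r':] = subst2 const3 (Z3, Y3) r'"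
    by (simp add: swap3_def subst3_def ring_map.map_poly_pCons[OF ring_map_subst2[OF ring_map_const3]])
  moreover have "r' \<noteq> 0" using n r' by auto
  ultimately show ?thesis using that[of "swap3 a'" "swap3 b'" r' n] hom by (simp add: mult.commute)
qed

section \<open>Lines through the Galois point\<close>

text \<open>
  No point of the line y = s^5 z other than [1:0:0] is a triple intersection with the curve.  The
  equation restricted to the line is the product of five linear polynomials l i in x, so at a triple
  point x three of them would vanish.  Then three of the five distinct conjugates of s would be roots
  of the quadratic polynomial (x + s^5) r^2 - r + x.
\<close>
lemma lines_meet_curve:
  fixes \<zeta> x s :: "'a::field_gcd"
  assumes "curve_field \<zeta>" and s: "s \<noteq> 0"
    and F: "curve_eq x (s ^ 5) 1 = 0" "curve_X x (s ^ 5) 1 = 0"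
  shows "curve_XX x (s ^ 5) 1 \<noteq> 0"
proof
  assume F2: "curve_XX x (s ^ 5) 1 = 0"
  interpret curve_field \<zeta> by fact
  let ?x = "[:0, 1:] :: 'a poly" and ?y = "[:s ^ 5:]" and ?L = "[:- x, 1:]"
  define q where "q = curve_eq ?x ?y 1"
  define l where "l i = [:s ^ 5 * (\<zeta> ^ i * s) ^ 2 - \<zeta> ^ i * s, 1 + (\<zeta> ^ i * s) ^ 2:]" for i :: nat
  have der: "derivation (pderiv :: 'a poly \<Rightarrow> 'a poly)"
    by unfold_locales (simp_all add: pderiv_add pderiv_mult)
  have q1: "pderiv q = curve_X ?x ?y 1"
    unfolding q_def derivation_curve_eq[OF der] by (simp add: pderiv_pCons)
  have q2: "pderiv (pderiv q) = curve_XX ?x ?y 1"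
    unfolding q1 derivation_curve_X[OF der] by (simp add: pderiv_pCons)
  have q_l: "q = (\<Prod>i<5. l i)"
  proof -
    have sum: "[:\<zeta>:] ^ 4 + [:\<zeta>:] ^ 3 + [:\<zeta>:] ^ 2 + [:\<zeta>:] + 1 = 0"
    proof -
      have "[:\<zeta>:] ^ 4 + [:\<zeta>:] ^ 3 + [:\<zeta>:] ^ 2 + [:\<zeta>:] + 1 = [:\<zeta> ^ 4 + \<zeta> ^ 3 + \<zeta> ^ 2 + \<zeta> + 1:]"
        by (simp only: ring_map.map_simps[OF ring_map_const_poly])
      then show ?thesis by (simp add: zeta_sum)
    qed
    have l: "l i = (?x + ?y) * ([:\<zeta>:] ^ i * [:s:]) ^ 2 - 1 * ([:\<zeta>:] ^ i * [:s:]) + ?x" for i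
    proof -
      have "[:\<zeta>:] ^ i * [:s:] = [:\<zeta> ^ i * s:]" by (simp only: ring_map.map_simps[OF ring_map_const_poly])
      moreover have "(?x + ?y) * [:t:] ^ 2 - 1 * [:t:] + ?x = [:s ^ 5 * t ^ 2 - t, 1 + t ^ 2:]" for t
        by (simp add: power2_eq_square)
      ultimately show ?thesis by (simp add: l_def)
    qed
    have y: "?y = [:s:] ^ 5 * 1" by (simp only: ring_map.map_simps[OF ring_map_const_poly] mult_1_right)
    show ?thesis
      unfolding q_def
      by (subst curve_eq_factorization[OF sum y])
         (simp add: l lessThan_nat_numeral lessThan_Suc numeral_eq_Suc mult_ac del: mult_pCons_left mult_pCons_right)
  qed
  have l_nz: "l i \<noteq> 0" for i
  proof
    define t where "t = \<zeta> ^ i * s"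
    have "(\<zeta> ^ i) ^ 5 = 1" using root by (metis power_mult mult.commute power_one)
    then have t5: "t ^ 5 = s ^ 5" by (simp only: t_def power_mult_distrib mult_1_left)
    assume "l i = 0"
    then have "t ^ 5 * t ^ 2 - t = 0" "1 + t ^ 2 = 0"
      unfolding t5 unfolding l_def t_def by simp_all
    moreover have "2 * t = (1 + t ^ 2) * (t ^ 5 - t ^ 3 + t) - (t ^ 5 * t ^ 2 - t)"
      by Groebner_Basis.algebra
    ultimately have "2 * t = 0" by simp
    then have "t = 0" using two by simp
    then show False using s zeta_nonzero by (simp add: t_def)
  qed
  have 0: "poly q x = 0" "poly (pderiv q) x = 0" "poly (pderiv (pderiv q)) x = 0"
  proof -
    interpret ev: ring_map "\<lambda>p :: 'a poly. poly p x" by (rule ring_map_poly)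
    have gens: "poly ?x x = x" "poly ?y x = s ^ 5" "poly (1 :: 'a poly) x = 1" by simp_all
    show "poly q x = 0"
      unfolding q_def curve_eq_def using F(1)
      by (simp only: ev.map_simps gens) (simp only: curve_eq_def)
    show "poly (pderiv q) x = 0"
      unfolding q1 curve_X_def using F(2)
      by (simp only: ev.map_simps gens) (simp only: curve_X_def)
    show "poly (pderiv (pderiv q)) x = 0"
      unfolding q2 curve_XX_def using F2
      by (simp only: ev.map_simps gens) (simp only: curve_XX_def)
  qed
  obtain t where t: "q = ?L * t" using 0(1) by (auto simp: poly_eq_0_iff_dvd elim: dvdE)
  have "pderiv ?L = 1" by (simp add: pderiv_pCons)
  then have dL: "pderiv (?L * r) = ?L * pderiv r + r" for r by (simp only: pderiv_mult mult_1_right)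
  have evL: "poly (?L * r) x = 0" for r by simp
  have "poly t x = 0" using 0(2) unfolding t dL poly_add evL by simp
  then obtain t2 where t2: "t = ?L * t2" by (auto simp: poly_eq_0_iff_dvd elim: dvdE)
  have "2 * poly t2 x = 0"
    using 0(3) unfolding t t2 dL pderiv_add poly_add evL by simp
  then have "poly t2 x = 0" using two by simp
  then obtain t3 where t3: "t2 = ?L * t3" by (auto simp: poly_eq_0_iff_dvd elim: dvdE)
  have "q = ?L ^ 3 * t3" unfolding t t2 t3 by (simp only: power3_eq_cube mult.assoc)
  then have L3: "?L ^ 3 dvd (\<Prod>i<5. l i)" unfolding q_l by simp
  define A where "A = {i. i < 5 \<and> poly (l i) x = 0}"
  have split: "(\<Prod>i<5. l i) = (\<Prod>i\<in>{..<5} - A. l i) * (\<Prod>i\<in>A. l i)"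
    by (subst prod.subset_diff[of A]) (auto simp: A_def)
  have L: "prime_elem ?L" by (rule prime_elem_linear_field_poly) simp
  have "\<not> ?L dvd (\<Prod>i\<in>{..<5} - A. l i)"
    unfolding poly_eq_0_iff_dvd[symmetric] poly_prod by (auto simp: A_def)
  then have "?L ^ 3 dvd (\<Prod>i\<in>A. l i)"
    using L3 prime_power_dvd_multD[OF L] unfolding split by blast
  moreover have "(\<Prod>i\<in>A. l i) \<noteq> 0" using l_nz by (simp add: A_def)
  ultimately have "degree (?L ^ 3) \<le> degree (\<Prod>i\<in>A. l i)" by (intro dvd_imp_degree_le)
  also have "degree (?L ^ 3) = 3" by (simp add: degree_power_eq)
  also have "degree (\<Prod>i\<in>A. l i) \<le> (\<Sum>i\<in>A. degree (l i))"
    using degree_prod_sum_le[of A l] by (simp add: A_def comp_def)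
  also have "\<dots> \<le> (\<Sum>i\<in>A. 1)" by (intro sum_mono) (simp add: l_def)
  finally have "3 \<le> card A" by simp
  moreover have "card A \<le> 2"
  proof -
    let ?Q = "[:x, - 1, x + s ^ 5:]"
    have "inj_on (\<lambda>i. \<zeta> ^ i * s) A"
      using s zeta_power_inj by (auto simp: inj_on_def A_def)
    then have "card A = card ((\<lambda>i. \<zeta> ^ i * s) ` A)" by (simp add: card_image)
    also have "\<dots> \<le> card {r. poly ?Q r = 0}"
    proof (intro card_mono poly_roots_finite subsetI)
      fix r assume "r \<in> (\<lambda>i. \<zeta> ^ i * s) ` A"
      then obtain i where "r = \<zeta> ^ i * s" "poly (l i) x = 0" by (auto simp: A_def)
      then have "s ^ 5 * r ^ 2 - r + x * (1 + r ^ 2) = 0" by (simp add: l_def)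
      then show "r \<in> {r. poly ?Q r = 0}" by (simp add: algebra_simps power2_eq_square)
    qed simp
    also have "\<dots> \<le> degree ?Q" by (rule card_poly_roots_bound) simp
    also have "\<dots> \<le> 2" by simp
    finally show ?thesis .
  qed
  ultimately show False by simp
qed

section \<open>Contracted curves\<close>

text \<open>
  Congruence modulo E, written as divisibility of the difference; it is compatible with all
  polynomial expressions.
\<close>
lemma dvd_diff_arith:
  fixes E :: "'a::comm_ring_1"
  shows dvd_diff_refl: "E dvd a - a"
    and dvd_diff_add: "E dvd a - a' \<Longrightarrow> E dvd b - b' \<Longrightarrow> E dvd (a + b) - (a' + b')"
    and dvd_diff_diff: "E dvd a - a' \<Longrightarrow> E dvd b - b' \<Longrightarrow> E dvd (a - b) - (a' - b')"
    and dvd_diff_mult: "E dvd a - a' \<Longrightarrow> E dvd b - b' \<Longrightarrow> E dvd a * b - a' * b'"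
    and dvd_diff_power: "E dvd a - a' \<Longrightarrow> E dvd a ^ n - a' ^ n"
proof -
  show "E dvd a - a" by simp
  show "E dvd (a + b) - (a' + b')" if "E dvd a - a'" "E dvd b - b'"
    using dvd_add[OF that] by (simp add: algebra_simps)
  show "E dvd (a - b) - (a' - b')" if "E dvd a - a'" "E dvd b - b'"
    using dvd_diff[OF that] by (simp add: algebra_simps)
  show mult: "E dvd a * b - a' * b'" if "E dvd a - a'" "E dvd b - b'" for a b a' b'
  proof -
    have "a * b - a' * b' = (a - a') * b + a' * (b - b')" by (simp add: algebra_simps)
    then show ?thesis using that by simp
  qed
  show "E dvd a ^ n - a' ^ n" if "E dvd a - a'"
    by (induction n) (use that in \<open>auto intro: mult\<close>)
qed

lemma curve_cong:
  fixes E :: "'a::comm_ring_1"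
  assumes "E dvd x - x'" "E dvd y - y'" "E dvd z - z'"
  shows "E dvd curve_eq x y z - curve_eq x' y' z'" "E dvd curve_X x y z - curve_X x' y' z'"
    "E dvd curve_XX x y z - curve_XX x' y' z'" "E dvd curve_Y x y z - curve_Y x' y' z'"
    "E dvd curve_ZZ x y z - curve_ZZ x' y' z'"
  unfolding curve_eq_def curve_X_def curve_XX_def curve_Y_def curve_ZZ_def
  by (intro dvd_diff_add dvd_diff_diff dvd_diff_mult dvd_diff_power assms dvd_diff_refl)+

lemma dvd_diff_iff: "E dvd a - b \<Longrightarrow> E dvd a \<longleftrightarrow> E dvd (b :: 'a::comm_ring_1)"
  by (metis diff_add_cancel dvd_add_right_iff)

text \<open>
  The order of the variables puts the direction in which a derivative does not vanish into the middle,
  as required by \<open>power_dvd_jacobian_square\<close>.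
\<close>
lemma gradient_curve_eq:
  fixes \<delta>1 \<delta>2 :: "'r::idom \<Rightarrow> 'r"
  assumes d: "derivation \<delta>1" "derivation \<delta>2"
  shows "gradient \<delta>1 \<delta>2 7 (curve_eq a b c) (curve_Y a b c, curve_X a b c, curve_Z a b c) (b, a, c)"
    and "gradient \<delta>1 \<delta>2 7 (curve_eq a b c) (curve_X a b c, curve_Y a b c, curve_Z a b c) (a, b, c)"
    and "gradient \<delta>1 \<delta>2 7 (curve_eq a b c) (curve_Y a b c, curve_Z a b c, curve_X a b c) (b, c, a)"
proof -
  have "7 * curve_eq a b c = curve_X a b c * a + curve_Y a b c * b + curve_Z a b c * c"
    unfolding curve_eq_def curve_X_def curve_Y_def curve_Z_def by Groebner_Basis.algebra
  then show "gradient \<delta>1 \<delta>2 7 (curve_eq a b c) (curve_Y a b c, curve_X a b c, curve_Z a b c) (b, a, c)"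
    "gradient \<delta>1 \<delta>2 7 (curve_eq a b c) (curve_X a b c, curve_Y a b c, curve_Z a b c) (a, b, c)"
    "gradient \<delta>1 \<delta>2 7 (curve_eq a b c) (curve_Y a b c, curve_Z a b c, curve_X a b c) (b, c, a)"
    unfolding gradient_def[OF d] derivation_curve_eq[OF d(1)] derivation_curve_eq[OF d(2)]
    by (simp_all add: add_ac)
qed

lemma gradient_curve_X:
  fixes \<delta>1 \<delta>2 :: "'r::idom \<Rightarrow> 'r"
  assumes d: "derivation \<delta>1" "derivation \<delta>2"
  shows "\<exists>G0 G2. gradient \<delta>1 \<delta>2 6 (curve_X a b c) (G0, curve_XX a b c, G2) (b, a, c)"
proof -
  let ?G0 = "10 * (a + b) * c ^ 4 - 10 * (2 * a ^ 3 + 6 * a ^ 2 * b + 3 * a * b ^ 2) * c ^ 2 + 10 * b * (a + b) ^ 4 + 20 * b ^ 2 * (a + b) ^ 3"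
  let ?G2 = "10 * a ^ 4 * c + 20 * b * (2 * a + b) * c ^ 3 - 20 * a * b * (a + b) * (2 * a + b) * c"
  have "6 * curve_X a b c = ?G0 * b + curve_XX a b c * a + ?G2 * c"
    unfolding curve_X_def curve_XX_def by Groebner_Basis.algebra
  then have "gradient \<delta>1 \<delta>2 6 (curve_X a b c) (?G0, curve_XX a b c, ?G2) (b, a, c)"
    unfolding gradient_def[OF d] derivation_curve_X[OF d(1)] derivation_curve_X[OF d(2)] by simp
  then show ?thesis by blast
qed

lemma gradient_curve_Z:
  fixes \<delta>1 \<delta>2 :: "'r::idom \<Rightarrow> 'r"
  assumes d: "derivation \<delta>1" "derivation \<delta>2"
  shows "\<exists>G0 G2. gradient \<delta>1 \<delta>2 6 (curve_Z a b c) (G0, curve_ZZ a b c, G2) (b, c, a)"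
proof -
  let ?G0 = "20 * a * (a + 2 * b) * c ^ 3 - 6 * c ^ 5 - 10 * a ^ 2 * (a + b) * (a + 3 * b) * c"
  let ?G2 = "10 * a ^ 4 * c + 20 * b * (2 * a + b) * c ^ 3 - 20 * a * b * (a + b) * (2 * a + b) * c"
  have "6 * curve_Z a b c = ?G0 * b + curve_ZZ a b c * c + ?G2 * a"
    unfolding curve_Z_def curve_ZZ_def by Groebner_Basis.algebra
  then have "gradient \<delta>1 \<delta>2 6 (curve_Z a b c) (?G0, curve_ZZ a b c, ?G2) (b, c, a)"
    unfolding gradient_def[OF d] derivation_curve_Z[OF d(1)] derivation_curve_Z[OF d(2)] by simp
  then show ?thesis by blast
qed

lemma jacobian_square_perm:
  fixes \<delta>1 \<delta>2 :: "'r::idom \<Rightarrow> 'r"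
  assumes d: "derivation \<delta>1" "derivation \<delta>2"
  shows "(jacobian \<delta>1 \<delta>2 b a c) ^ 2 = (jacobian \<delta>1 \<delta>2 a b c) ^ 2"
    and "(jacobian \<delta>1 \<delta>2 b c a) ^ 2 = (jacobian \<delta>1 \<delta>2 a b c) ^ 2"
  unfolding jacobian_def[OF d] bracket_def[OF d] by Groebner_Basis.algebra+

lemma prime_elem_not_dvd_const3:
  assumes "prime_elem E" "c \<noteq> (0 :: 'a::field)"
  shows "\<not> E dvd const3 c"
proof
  assume "E dvd const3 c"
  then have "E dvd const3 c * const3 (inverse c)" by (rule dvd_mult2)
  also have "const3 c * const3 (inverse c) = const3 (c * inverse c)"
    by (simp only: ring_map.map_mult[OF ring_map_const3])
  also have "\<dots> = 1" using assms(2) by (simp add: one_pCons)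
  finally show False using assms(1) by (simp add: prime_elem_def)
qed

text \<open>
  The last hypothesis says that f maps the curve E into a line through [1:0:0].  As the image also
  lies on the curve, it is a single point.  For every such point a direction is chosen in which the
  first or the second derivative of the equation does not vanish there: the direction of Y at
  [0:0:1], the direction of Z at the points [1:0:0] and [1:-1:0] at infinity, and the direction of X
  at all others, by \<open>lines_meet_curve\<close>.
\<close>
lemma contracted_bound:
  fixes f0 f1 f2 E :: "'a::{alg_closed_field,field_gcd} tripoly"
  assumes \<zeta>: "curve_field (\<zeta> :: 'a)" and d: "derivation \<delta>1" "derivation \<delta>2"
    and const: "\<And>c. \<delta>1 (const3 c) = 0" "\<And>c. \<delta>2 (const3 c) = 0"
    and E: "prime_elem E" and f: "\<not> (E dvd f0 \<and> E dvd f1 \<and> E dvd f2)"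
    and n: "E ^ n dvd curve_eq f0 f1 f2" "n > 0"
    and line: "E dvd f2 \<or> (\<exists>\<alpha>. E dvd f1 - const3 \<alpha> * f2)"
  shows "E ^ n dvd (jacobian \<delta>1 \<delta>2 f0 f1 f2) ^ 2"
proof -
  interpret curve_field \<zeta> by fact
  interpret d1: derivation \<delta>1 by (rule d(1))
  interpret d2: derivation \<delta>2 by (rule d(2))
  have minus_one: "const3 (- 1) = (- 1 :: 'a tripoly)"
    by (simp only: ring_map.map_minus[OF ring_map_const3] ring_map.map_one[OF ring_map_const3])
  have E1: "\<not> E dvd 1" using E by (simp add: prime_elem_def)
  have E_curve: "E dvd curve_eq f0 f1 f2" using n by (meson dvd_power dvd_trans)
  have lin: "\<delta>1 (1 * a - const3 \<alpha> * b) = 1 * \<delta>1 a - const3 \<alpha> * \<delta>1 b"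
    "\<delta>2 (1 * a - const3 \<alpha> * b) = 1 * \<delta>2 a - const3 \<alpha> * \<delta>2 b" for a b \<alpha>
    by (simp_all only: d1.deriv_diff d1.deriv_mult d2.deriv_diff d2.deriv_mult const d1.deriv_1 d2.deriv_1
        mult_zero_left add_0_left)
  show ?thesis
  proof (cases "E dvd f2")
    case True
    \<comment> \<open>The image is [1:0:0] or [1:-1:0]; \<alpha> is its second coordinate.\<close>
    have "E dvd curve_eq f0 f1 f2 - curve_eq f0 f1 0"
      by (rule curve_cong) (use True in simp_all)
    then have "E dvd curve_eq f0 f1 0" using E_curve dvd_diff_iff by blast
    also have "curve_eq f0 f1 0 = f1 ^ 2 * (f0 + f1) ^ 5" by (simp add: curve_eq_def)
    finally have "E dvd f1 \<or> E dvd f0 + f1"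
      using E prime_elem_dvd_power by (auto simp: prime_elem_dvd_mult_iff)
    then obtain \<alpha> where \<alpha>: "E dvd 1 * f1 - const3 \<alpha> * f0" "\<alpha> = 0 \<or> \<alpha> = - 1"
    proof
      assume "E dvd f1" then show ?thesis using that[of 0] by simp
    next
      assume "E dvd f0 + f1"
      moreover have "1 * f1 - const3 (- 1) * f0 = f0 + f1" unfolding minus_one by (simp add: add.commute)
      ultimately show ?thesis using that[of "- 1"] by metis
    qed
    have f0: "\<not> E dvd f0"
    proof
      assume "E dvd f0"
      then have "E dvd (1 * f1 - const3 \<alpha> * f0) + const3 \<alpha> * f0" using \<alpha>(1) by (intro dvd_add dvd_mult)
      then have "E dvd f1" by simp
      with \<open>E dvd f0\<close> True f show False by blast
    qed
    have "\<not> E dvd curve_ZZ f0 f1 f2"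
    proof
      assume "E dvd curve_ZZ f0 f1 f2"
      moreover have "E dvd f1 - const3 \<alpha> * f0" using \<alpha>(1) by simp
      then have "E dvd curve_ZZ f0 f1 f2 - curve_ZZ f0 (const3 \<alpha> * f0) 0"
        by (intro curve_cong) (use True in simp_all)
      ultimately have "E dvd curve_ZZ f0 (const3 \<alpha> * f0) 0" using dvd_diff_iff by blast
      also have "curve_ZZ f0 (const3 \<alpha> * f0) 0 = const3 2 * f0 ^ 5"
      proof -
        have "curve_ZZ x (- x) 0 = 2 * x ^ 5" "curve_ZZ x 0 0 = 2 * x ^ 5" for x :: "'a tripoly"
          by (simp_all add: curve_ZZ_def)
        moreover have "const3 \<alpha> * f0 = 0 \<or> const3 \<alpha> * f0 = - f0"
          using \<alpha>(2)
        proof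
          assume "\<alpha> = - 1"
          then have "const3 \<alpha> * f0 = - f0" by (simp only: minus_one) simp
          then show ?thesis by blast
        qed simp
        moreover have "const3 2 = (2 :: 'a tripoly)" by (simp only: ring_map.map_numeral[OF ring_map_const3])
        ultimately show ?thesis by metis
      qed
      finally have "E dvd f0 ^ 5"
        using E prime_elem_not_dvd_const3[OF E two] prime_elem_dvd_multD by blast
      then show False using E f0 prime_elem_dvd_power by blast
    qed
    then have H: "\<exists>m' G0 G1 G2. gradient \<delta>1 \<delta>2 m' (curve_Z f0 f1 f2) (G0, G1, G2) (f1, f2, f0) \<and> \<not> E dvd G1"
      using gradient_curve_Z[OF d, of f0 f1 f2] by blast
    have "E ^ n dvd (jacobian \<delta>1 \<delta>2 f1 f2 f0) ^ 2"
      by (rule power_dvd_jacobian_square[OF d E E1 \<alpha>(1) n(1) gradient_curve_eq(3)[OF d] disjI2[OF H] refl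
            lin[of f1 \<alpha> f0]])
    then show ?thesis by (simp only: jacobian_square_perm[OF d])
  next
    case False
    then obtain \<alpha> where \<alpha>: "E dvd 1 * f1 - const3 \<alpha> * f2" using line by auto
    then have \<alpha>': "E dvd f1 - const3 \<alpha> * f2" by simp
    have "E dvd curve_eq f0 f1 f2 - curve_eq f0 (const3 \<alpha> * f2) f2"
      by (rule curve_cong) (use \<alpha>' in simp_all)
    then have E_curve': "E dvd curve_eq f0 (const3 \<alpha> * f2) f2" using E_curve dvd_diff_iff by blast
    show ?thesis
    proof (cases "\<alpha> = 0")
      case True
      \<comment> \<open>The image is [0:0:1].\<close>
      have "curve_eq f0 (const3 \<alpha> * f2) f2 = f0 ^ 5 * f2 ^ 2" using True by (simp add: curve_eq_def)
      then have "E dvd f0"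
        using E_curve' E False prime_elem_dvd_power by (auto simp: prime_elem_dvd_mult_iff)
      then have u: "E dvd 1 * f0 - const3 0 * f2" by simp
      have "\<not> E dvd curve_Y f0 f1 f2"
      proof
        assume "E dvd curve_Y f0 f1 f2"
        moreover have "E dvd curve_Y f0 f1 f2 - curve_Y 0 0 f2"
          by (intro curve_cong) (use \<open>E dvd f0\<close> \<alpha>' True in simp_all)
        ultimately have "E dvd curve_Y 0 0 f2" using dvd_diff_iff by blast
        then have "E dvd f2 ^ 6" by (simp add: curve_Y_def)
        then show False using E False prime_elem_dvd_power by blast
      qed
      then show ?thesis
        by (rule power_dvd_jacobian_square[OF d E E1 u n(1) gradient_curve_eq(2)[OF d] disjI1 refl
              lin[of f0 0 f2]])
    next
      case nz: False
      \<comment> \<open>One of the five factors of the equation on the line vanishes on E.  It is linear in the first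
        coordinate, which is therefore constant on E, equal to x f2.\<close>
      obtain s where s: "s ^ 5 = \<alpha>" using nth_root_exists[of 5 \<alpha>] by auto
      with nz have s0: "s \<noteq> 0" by auto
      note c3 = ring_map_const3[where 'a = 'a]
      obtain t where t: "t ^ 5 = \<alpha>" "E dvd (f0 + const3 \<alpha> * f2) * const3 t ^ 2 - f2 * const3 t + f0"
      proof -
        have "const3 \<zeta> ^ 4 + const3 \<zeta> ^ 3 + const3 \<zeta> ^ 2 + const3 \<zeta> + 1 = const3 (\<zeta> ^ 4 + \<zeta> ^ 3 + \<zeta> ^ 2 + \<zeta> + 1)"
          by (simp only: ring_map.map_simps[OF c3])
        then have "const3 \<zeta> ^ 4 + const3 \<zeta> ^ 3 + const3 \<zeta> ^ 2 + const3 \<zeta> + 1 = 0"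
          by (simp only: zeta_sum ring_map.map_zero[OF c3])
        moreover have "const3 \<alpha> * f2 = const3 s ^ 5 * f2"
          unfolding s[symmetric] by (simp only: ring_map.map_power[OF c3])
        note curve_eq_factorization[OF calculation this, of f0]
        with E_curve' have "E dvd f2 ^ 2 *
          (((f0 + const3 \<alpha> * f2) * const3 s ^ 2 - f2 * const3 s + f0) *
           ((f0 + const3 \<alpha> * f2) * (const3 \<zeta> * const3 s) ^ 2 - f2 * (const3 \<zeta> * const3 s) + f0) *
           ((f0 + const3 \<alpha> * f2) * (const3 \<zeta> ^ 2 * const3 s) ^ 2 - f2 * (const3 \<zeta> ^ 2 * const3 s) + f0) *
           ((f0 + const3 \<alpha> * f2) * (const3 \<zeta> ^ 3 * const3 s) ^ 2 - f2 * (const3 \<zeta> ^ 3 * const3 s) + f0) *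
           ((f0 + const3 \<alpha> * f2) * (const3 \<zeta> ^ 4 * const3 s) ^ 2 - f2 * (const3 \<zeta> ^ 4 * const3 s) + f0))"
          by (simp only:)
        moreover have "\<not> E dvd f2 ^ 2" using E False prime_elem_dvd_power by blast
        ultimately consider (a) "E dvd (f0 + const3 \<alpha> * f2) * const3 s ^ 2 - f2 * const3 s + f0"
          | (b) "E dvd (f0 + const3 \<alpha> * f2) * (const3 \<zeta> * const3 s) ^ 2 - f2 * (const3 \<zeta> * const3 s) + f0"
          | (c) "E dvd (f0 + const3 \<alpha> * f2) * (const3 \<zeta> ^ 2 * const3 s) ^ 2 - f2 * (const3 \<zeta> ^ 2 * const3 s) + f0"
          | (d) "E dvd (f0 + const3 \<alpha> * f2) * (const3 \<zeta> ^ 3 * const3 s) ^ 2 - f2 * (const3 \<zeta> ^ 3 * const3 s) + f0"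
          | (e) "E dvd (f0 + const3 \<alpha> * f2) * (const3 \<zeta> ^ 4 * const3 s) ^ 2 - f2 * (const3 \<zeta> ^ 4 * const3 s) + f0"
          using E prime_elem_dvd_multD by blast
        then obtain i where i: "E dvd (f0 + const3 \<alpha> * f2) * (const3 \<zeta> ^ i * const3 s) ^ 2 - f2 * (const3 \<zeta> ^ i * const3 s) + f0"
          by cases (metis mult_1 power_0, metis power_one_right, blast+)
        have "(\<zeta> ^ i) ^ 5 = 1" using root by (metis power_mult mult.commute power_one)
        then have "(\<zeta> ^ i * s) ^ 5 = \<alpha>" by (simp only: power_mult_distrib s mult_1_left)
        moreover have "const3 (\<zeta> ^ i * s) = const3 \<zeta> ^ i * const3 s" by (simp only: ring_map.map_simps[OF c3])
        ultimately show ?thesis using that i by metis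
      qed
      have t': "E dvd const3 (1 + t ^ 2) * f0 - const3 (t - \<alpha> * t ^ 2) * f2"
      proof -
        have "(f0 + const3 \<alpha> * f2) * const3 t ^ 2 - f2 * const3 t + f0
          = (1 + const3 t ^ 2) * f0 - (const3 t - const3 \<alpha> * const3 t ^ 2) * f2" by Groebner_Basis.algebra
        with t(2) show ?thesis by (simp only: ring_map.map_simps[OF c3])
      qed
      obtain x where x: "E dvd f0 - const3 x * f2"
      proof (cases "1 + t ^ 2 = 0")
        case True
        \<comment> \<open>The linear factor degenerates to - 2 t f2, and 2 t is a nonzero constant.\<close>
        moreover have "t - t ^ 5 * t ^ 2 = 2 * t - (1 + t ^ 2) * (t ^ 5 - t ^ 3 + t)" by Groebner_Basis.algebra
        ultimately have "t - \<alpha> * t ^ 2 = 2 * t" using t(1) by simp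
        with t' True have "E dvd - (const3 (2 * t) * f2)" by (simp only:) simp
        then have "E dvd const3 (2 * t) * f2" by (simp only: dvd_minus_iff)
        then have "E dvd const3 (2 * t)" using E False prime_elem_dvd_multD by blast
        moreover have "2 * t \<noteq> 0" using two t(1) nz by auto
        ultimately show ?thesis using prime_elem_not_dvd_const3[OF E] by blast
      next
        case t2: False
        let ?i = "inverse (1 + t ^ 2)"
        have "E dvd const3 ?i * (const3 (1 + t ^ 2) * f0 - const3 (t - \<alpha> * t ^ 2) * f2)" using t' by (rule dvd_mult)
        also have "\<dots> = const3 (?i * (1 + t ^ 2)) * f0 - const3 (?i * (t - \<alpha> * t ^ 2)) * f2"
          by (simp only: ring_map.map_mult[OF c3] right_diff_distrib[of "const3 ?i"] mult.assoc)
        also have "?i * (1 + t ^ 2) = 1" using t2 by simp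
        finally show ?thesis using that by (simp only: ring_map.map_one[OF c3] mult_1_left)
      qed
      have E_f2: "\<not> E dvd const3 c * f2 ^ k" if "c \<noteq> 0" for c k
        using that E False prime_elem_not_dvd_const3[OF E] prime_elem_dvd_multD prime_elem_dvd_power by blast
      note cong = curve_cong[OF x \<alpha>' dvd_diff_refl[of E f2]]
      have scale: "curve_eq (const3 x * f2) (const3 \<alpha> * f2) f2 = const3 (curve_eq x \<alpha> 1) * f2 ^ 7"
        "curve_X (const3 x * f2) (const3 \<alpha> * f2) f2 = const3 (curve_X x \<alpha> 1) * f2 ^ 6"
        "curve_XX (const3 x * f2) (const3 \<alpha> * f2) f2 = const3 (curve_XX x \<alpha> 1) * f2 ^ 5"
      proof -
        have "curve_eq (a * z) (b * z) z = curve_eq a b 1 * z ^ 7"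
          "curve_X (a * z) (b * z) z = curve_X a b 1 * z ^ 6"
          "curve_XX (a * z) (b * z) z = curve_XX a b 1 * z ^ 5" for a b z :: "'a tripoly"
          unfolding curve_eq_def curve_X_def curve_XX_def power_one mult_1_right
          by Groebner_Basis.algebra+
        moreover have "const3 (curve_eq x \<alpha> 1) = curve_eq (const3 x) (const3 \<alpha>) 1"
          "const3 (curve_X x \<alpha> 1) = curve_X (const3 x) (const3 \<alpha>) 1"
          "const3 (curve_XX x \<alpha> 1) = curve_XX (const3 x) (const3 \<alpha>) 1"
          unfolding curve_eq_def curve_X_def curve_XX_def by (simp_all only: ring_map.map_simps[OF c3])
        ultimately show "curve_eq (const3 x * f2) (const3 \<alpha> * f2) f2 = const3 (curve_eq x \<alpha> 1) * f2 ^ 7"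
          "curve_X (const3 x * f2) (const3 \<alpha> * f2) f2 = const3 (curve_X x \<alpha> 1) * f2 ^ 6"
          "curve_XX (const3 x * f2) (const3 \<alpha> * f2) f2 = const3 (curve_XX x \<alpha> 1) * f2 ^ 5"
          by (simp_all only:)
      qed
      have "E dvd const3 (curve_eq x \<alpha> 1) * f2 ^ 7"
        using E_curve dvd_diff_iff[OF cong(1)] unfolding scale by blast
      then have "curve_eq x \<alpha> 1 = 0" using E_f2 by blast
      then have "curve_X x \<alpha> 1 \<noteq> 0 \<or> curve_XX x \<alpha> 1 \<noteq> 0"
        using lines_meet_curve[OF \<zeta> s0] s by blast
      then have "\<not> E dvd curve_X f0 f1 f2 \<or> \<not> E dvd curve_XX f0 f1 f2"
        using dvd_diff_iff[OF cong(2)] dvd_diff_iff[OF cong(3)] E_f2 unfolding scale by blast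
      then have H: "\<not> E dvd curve_X f0 f1 f2 \<or> (\<exists>m' G0 G1 G2. gradient \<delta>1 \<delta>2 m' (curve_X f0 f1 f2) (G0, G1, G2) (f1, f0, f2) \<and> \<not> E dvd G1)"
        using gradient_curve_X[OF d, of f0 f1 f2] by blast
      have "E ^ n dvd (jacobian \<delta>1 \<delta>2 f1 f0 f2) ^ 2"
        by (rule power_dvd_jacobian_square[OF d E E1 \<alpha> n(1) gradient_curve_eq(1)[OF d] H refl
              lin[of f1 \<alpha> f2]])
      then show ?thesis by (simp only: jacobian_square_perm[OF d])
    qed
  qed
qed

section \<open>Plane Cremona maps preserving the curve\<close>

text \<open>
  If the Jacobian vanishes, there is a nonzero derivation \<delta> with \<delta> Z = 0 that multiplies f0, f1, f2
  by the same factor.  Then it also multiplies M X, M Y, M Z by a common factor, as they are forms of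
  the same degree in f0, f1, f2.  For M Z this shows that M is multiplied by that factor, and so
  \<delta> X = \<delta> Y = 0, a contradiction.  This is valid in every characteristic.
\<close>
lemma jacobian_nonzero:
  fixes f0 f1 f2 M :: "'a::idom tripoly"
  defines "\<delta>1 \<equiv> dir_deriv (1, 0, 0)" and "\<delta>2 \<equiv> dir_deriv (0, 1, 0)"
  assumes g: "homogeneous3 e g0" "homogeneous3 e g1" "homogeneous3 e g2"
    and gf: "subst3 const3 (f0, f1, f2) g0 = M * X3" "subst3 const3 (f0, f1, f2) g1 = M * Y3"
      "subst3 const3 (f0, f1, f2) g2 = M * Z3" and M: "M \<noteq> 0" and f2: "f2 \<noteq> 0"
  shows "jacobian \<delta>1 \<delta>2 f0 f1 f2 \<noteq> 0"
proof
  assume J: "jacobian \<delta>1 \<delta>2 f0 f1 f2 = 0"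
  have d: "derivation \<delta>1" "derivation \<delta>2" unfolding \<delta>1_def \<delta>2_def by (rule derivation_dir_deriv)+
  define p where "p \<delta> f = f2 * \<delta> f - f * \<delta> f2" for \<delta> :: "'a tripoly \<Rightarrow> 'a tripoly" and f
  have det: "p \<delta>1 f0 * p \<delta>2 f1 = p \<delta>2 f0 * p \<delta>1 f1"
  proof -
    have "p \<delta>1 f0 * p \<delta>2 f1 - p \<delta>2 f0 * p \<delta>1 f1 = f2 * jacobian \<delta>1 \<delta>2 f0 f1 f2"
      unfolding p_def jacobian_def[OF d] bracket_def[OF d] by Groebner_Basis.algebra
    with J show ?thesis by simp
  qed
  obtain b c where bc: "b \<noteq> 0 \<or> c \<noteq> 0" "b * p \<delta>1 f0 + c * p \<delta>2 f0 = 0" "b * p \<delta>1 f1 + c * p \<delta>2 f1 = 0"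
  proof -
    consider "p \<delta>1 f0 \<noteq> 0 \<or> p \<delta>2 f0 \<noteq> 0" | "p \<delta>1 f1 \<noteq> 0 \<or> p \<delta>2 f1 \<noteq> 0"
      | "p \<delta>1 f0 = 0" "p \<delta>2 f0 = 0" "p \<delta>1 f1 = 0" "p \<delta>2 f1 = 0" by blast
    then show ?thesis
    proof cases
      case 1 then show ?thesis using that[of "p \<delta>2 f0" "- p \<delta>1 f0"] det by (auto simp: mult.commute)
    next
      case 2 then show ?thesis using that[of "p \<delta>2 f1" "- p \<delta>1 f1"] det by (auto simp: mult.commute)
    next
      case 3 then show ?thesis using that[of 1 0] by simp
    qed
  qed
  \<comment> \<open>By the choice of b and c this derivation kills f0/f2 and f1/f2.\<close>
  define \<delta> where "\<delta> = dir_deriv (f2 * b, f2 * c, 0)"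
  define \<mu> where "\<mu> = b * \<delta>1 f2 + c * \<delta>2 f2"
  interpret \<delta>: derivation \<delta> unfolding \<delta>_def by (rule derivation_dir_deriv)
  have \<delta>: "\<delta> q = f2 * (b * \<delta>1 q + c * \<delta>2 q)" for q
    unfolding \<delta>_def \<delta>1_def \<delta>2_def by (subst dir_deriv_linear) (simp add: algebra_simps)
  have "\<delta> f0 = \<mu> * f0 + (b * p \<delta>1 f0 + c * p \<delta>2 f0)" "\<delta> f1 = \<mu> * f1 + (b * p \<delta>1 f1 + c * p \<delta>2 f1)"
    unfolding \<delta> \<mu>_def p_def by Groebner_Basis.algebra+
  then have f: "\<delta> f0 = \<mu> * f0" "\<delta> f1 = \<mu> * f1" "\<delta> f2 = \<mu> * f2"
    unfolding bc by (simp_all add: \<delta> \<mu>_def mult.commute)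
  have const: "\<delta> (const3 k) = 0" for k unfolding \<delta>_def by (rule dir_deriv_gens)
  note eig = derivation_homogeneous[OF \<delta>.derivation_axioms const f]
  have gens: "\<delta> X3 = f2 * b" "\<delta> Y3 = f2 * c" "\<delta> Z3 = 0"
    unfolding \<delta>_def by (simp_all add: dir_deriv_gens)
  define \<nu> where "\<nu> = of_nat e * \<mu>"
  have "\<delta> M * Z3 = \<nu> * M * Z3"
    using eig[OF g(3)] unfolding gf \<delta>.deriv_mult gens \<nu>_def by (simp add: mult.assoc)
  moreover have "Z3 \<noteq> (0 :: 'a tripoly)" by (simp add: Z3_def)
  ultimately have M': "\<delta> M = \<nu> * M" by simp
  have "M * (f2 * b) = 0"
    using eig[OF g(1)] unfolding gf \<delta>.deriv_mult gens M' \<nu>_def by (simp add: mult.assoc)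
  moreover have "M * (f2 * c) = 0"
    using eig[OF g(2)] unfolding gf \<delta>.deriv_mult gens M' \<nu>_def by (simp add: mult.assoc)
  ultimately show False using M f2 bc(1) by simp
qed

lemma prime_elem_Z3: "prime_elem (Z3 :: 'a::idom tripoly)"
  unfolding Z3_def by (rule prime_elem_indeterminate)

lemma not_Z3_dvd_X3: "\<not> Z3 dvd (X3 :: 'a::idom tripoly)"
  unfolding Z3_def indeterminate_dvd_iff by (simp add: X3_def)

text \<open>
  Euler's identity makes the determinants for two of the three partial derivatives proportional to
  the remaining variable.  The common quotient W has degree 3 (d - 1).
\<close>
lemma jacobian_homogeneous:
  fixes f0 f1 f2 :: "'a::idom tripoly"
  assumes f: "homogeneous3 d f0" "homogeneous3 d f1" "homogeneous3 d f2" and d: "d > 0"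
  obtains W where "jacobian (dir_deriv (1, 0, 0)) (dir_deriv (0, 1, 0)) f0 f1 f2 = Z3 * W"
    "jacobian (dir_deriv (0, 1, 0)) (dir_deriv (0, 0, 1)) f0 f1 f2 = X3 * W"
    "homogeneous3 (3 * d - 2) (jacobian (dir_deriv (1, 0, 0)) (dir_deriv (0, 1, 0)) f0 f1 f2)"
proof -
  let ?X = "dir_deriv (1, 0, 0) :: 'a tripoly \<Rightarrow> _" and ?Y = "dir_deriv (0, 1, 0) :: 'a tripoly \<Rightarrow> _"
    and ?Z = "dir_deriv (0, 0, 1) :: 'a tripoly \<Rightarrow> _"
  let ?n = "of_nat d :: 'a tripoly"
  have der: "derivation ?X" "derivation ?Y" "derivation ?Z" by (rule derivation_dir_deriv)+
  have euler: "X3 * ?X f = ?n * f - Y3 * ?Y f - Z3 * ?Z f" if "homogeneous3 d f" for f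
    using euler_homogeneous[OF that] by (simp add: algebra_simps)
  have "X3 * jacobian ?X ?Y f0 f1 f2 = f0 * ((X3 * ?X f1) * ?Y f2 - ?Y f1 * (X3 * ?X f2))
     + f1 * ((X3 * ?X f2) * ?Y f0 - ?Y f2 * (X3 * ?X f0)) + f2 * ((X3 * ?X f0) * ?Y f1 - ?Y f0 * (X3 * ?X f1))"
    unfolding jacobian_def[OF der(1,2)] bracket_def[OF der(1,2)] by Groebner_Basis.algebra
  also have "\<dots> = Z3 * jacobian ?Y ?Z f0 f1 f2"
    unfolding euler[OF f(1)] euler[OF f(2)] euler[OF f(3)] jacobian_def[OF der(2,3)] bracket_def[OF der(2,3)]
    by Groebner_Basis.algebra
  finally have eq: "X3 * jacobian ?X ?Y f0 f1 f2 = Z3 * jacobian ?Y ?Z f0 f1 f2" .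
  then have "Z3 dvd X3 * jacobian ?X ?Y f0 f1 f2" by simp
  then have "Z3 dvd jacobian ?X ?Y f0 f1 f2"
    using prime_elem_Z3 not_Z3_dvd_X3 prime_elem_dvd_multD by blast
  then obtain W where W: "jacobian ?X ?Y f0 f1 f2 = Z3 * W" by (elim dvdE)
  with eq have "Z3 * (X3 * W) = Z3 * jacobian ?Y ?Z f0 f1 f2" by (simp only: mult.left_commute)
  moreover have "Z3 \<noteq> (0 :: 'a tripoly)" by (simp add: Z3_def)
  ultimately have W': "jacobian ?Y ?Z f0 f1 f2 = X3 * W" by (metis mult_cancel_left)
  have summand: "homogeneous3 (3 * d - 2) (a * (?X b * ?Y c))" "homogeneous3 (3 * d - 2) (a * (?Y b * ?X c))"
    if "homogeneous3 d a" "homogeneous3 d b" "homogeneous3 d c" for a b c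
  proof -
    have e: "d + ((d - 1) + (d - 1)) = 3 * d - 2" using d by simp
    show "homogeneous3 (3 * d - 2) (a * (?X b * ?Y c))" "homogeneous3 (3 * d - 2) (a * (?Y b * ?X c))"
      unfolding e[symmetric] using that
      by (intro homogeneous3_mult homogeneous3_dir_deriv; simp)+
  qed
  have "homogeneous3 (3 * d - 2) (jacobian ?X ?Y f0 f1 f2)"
    unfolding jacobian_def[OF der(1,2)] bracket_def[OF der(1,2)] right_diff_distrib
    by (intro homogeneous3_add homogeneous3_diff summand f)
  then show ?thesis using that W W' by blast
qed

text \<open>
  A prime cannot divide both of the coprime elements p and q.
\<close>
lemma prime_power_dvd_cancel_disjoint:
  fixes E :: "'a::idom"
  assumes E: "prime_elem E" and p: "prime_elem p" "\<not> p dvd q"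
    and "E ^ n dvd (p * w) ^ 2" "E ^ n dvd (q * w) ^ 2"
  shows "E ^ n dvd w ^ 2"
proof -
  have "\<not> (E dvd p \<and> E dvd q)"
    using prime_elem_dvd_sym[OF E p(1)] p(2) dvd_trans by blast
  then consider "\<not> E dvd p ^ 2" | "\<not> E dvd q ^ 2" using E prime_elem_dvd_power by blast
  then show ?thesis
    using assms(4,5) prime_power_dvd_multD[OF E] unfolding power_mult_distrib by cases blast+
qed

text \<open>
  Every prime power dividing F(f) divides F W^2, with W from \<open>jacobian_homogeneous\<close>.  For the
  prime F itself this holds because F(f) divides M^7 F and F does not divide M.
  Any other prime factor E of F(f) divides M and hence some component i of g after substitution of f.
  Elimination of X from F and i gives a binary form in Y and Z that vanishes on the image of E, so the
  image lies in a line through [1:0:0] and \<open>contracted_bound\<close> applies.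
\<close>
theorem cremona_preserving_curve_linear:
  fixes f0 f1 f2 g0 g1 g2 M :: "'a::{alg_closed_field,field_gcd} tripoly"
  assumes \<zeta>: "curve_field (\<zeta> :: 'a)"
    and f: "homogeneous3 d f0" "homogeneous3 d f1" "homogeneous3 d f2"
    and coprime: "\<And>E. prime_elem E \<Longrightarrow> \<not> (E dvd f0 \<and> E dvd f1 \<and> E dvd f2)"
    and g: "homogeneous3 e g0" "homogeneous3 e g1" "homogeneous3 e g2"
    and g_C: "\<not> (curve_form dvd g0 \<and> curve_form dvd g1 \<and> curve_form dvd g2)"
    and gf: "subst3 const3 (f0, f1, f2) g0 = M * X3" "subst3 const3 (f0, f1, f2) g1 = M * Y3"
      "subst3 const3 (f0, f1, f2) g2 = M * Z3" and M: "M \<noteq> 0"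
    and preserve: "curve_form dvd curve_eq f0 f1 f2"
    and dominant: "\<And>G n. homogeneous3 n G \<Longrightarrow> curve_form dvd subst3 const3 (f0, f1, f2) G \<Longrightarrow> curve_form dvd G"
  shows "d = 1"
proof -
  interpret curve_field \<zeta> by fact
  let ?F = "curve_form :: 'a tripoly" and ?f = "subst3 const3 (f0, f1, f2)"
  let ?X = "dir_deriv (1, 0, 0) :: 'a tripoly \<Rightarrow> _" and ?Y = "dir_deriv (0, 1, 0) :: 'a tripoly \<Rightarrow> _"
    and ?Z = "dir_deriv (0, 0, 1) :: 'a tripoly \<Rightarrow> _"
  note F_prime = prime_elem_curve_form and F_hom = homogeneous3_curve_form
  interpret s: ring_map ?f by (rule ring_map_subst3[OF ring_map_const3])
  have F_dvd: "homogeneous3 n G \<Longrightarrow> ?F dvd ?f G \<Longrightarrow> ?F dvd G" for n G by (rule dominant)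
  have d0: "d > 0"
  proof (rule ccontr)
    assume "\<not> d > 0"
    then have "homogeneous3 (e * 0) (M * X3)" using homogeneous3_subst3[OF g(1) f] gf(1) by simp
    moreover have "M * X3 \<noteq> 0" using M by (simp add: X3_def)
    ultimately have "1 \<le> e * 0" using homogeneous3_dvd_degree_le[OF homogeneous3_X] by (metis dvd_triv_right)
    then show False by simp
  qed
  have f2: "f2 \<noteq> 0"
  proof
    assume "f2 = 0"
    then have "?F dvd ?f Z3" by (simp add: subst3_gens ring_map_const3)
    then have "?F dvd Z3" by (rule F_dvd[OF homogeneous3_Z])
    then have "7 \<le> (1::nat)" using homogeneous3_dvd_degree_le[OF F_hom homogeneous3_Z] by (simp add: Z3_def)
    then show False by simp
  qed
  have F_M: "\<not> ?F dvd M"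
  proof
    assume "?F dvd M"
    then have "?F dvd ?f g0" "?F dvd ?f g1" "?F dvd ?f g2" unfolding gf by simp_all
    then show False using F_dvd[OF g(1)] F_dvd[OF g(2)] F_dvd[OF g(3)] g_C by blast
  qed
  \<comment> \<open>A component of g that does not vanish identically on the curve.\<close>
  obtain i where i: "homogeneous3 e i" "\<not> ?F dvd i" "M dvd ?f i"
  proof -
    have "M dvd ?f g0" "M dvd ?f g1" "M dvd ?f g2" unfolding gf by simp_all
    then show ?thesis using that g g_C by blast
  qed
  \<comment> \<open>Since F(g(f)) = M^7 F vanishes on the curve and f is dominant on it, so does F(g).\<close>
  obtain Q where Q: "M ^ 7 * ?F = curve_eq f0 f1 f2 * Q"
  proof -
    have "?f (curve_eq g0 g1 g2) = curve_eq (M * X3) (M * Y3) (M * Z3)"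
      unfolding ring_map_curve_eq[OF s.ring_map_axioms] gf ..
    also have "\<dots> = M ^ 7 * ?F"
      unfolding curve_form_def curve_eq_def by Groebner_Basis.algebra
    finally have eq: "?f (curve_eq g0 g1 g2) = M ^ 7 * ?F" .
    have "homogeneous3 (7 * e) (curve_eq g0 g1 g2)"
      using homogeneous3_subst3[OF F_hom g] by (simp add: subst3_curve_form[OF ring_map_const3])
    then have "?F dvd curve_eq g0 g1 g2" by (rule F_dvd) (simp add: eq)
    then obtain G where "curve_eq g0 g1 g2 = ?F * G" by (elim dvdE)
    then have "?f (curve_eq g0 g1 g2) = curve_eq f0 f1 f2 * ?f G"
      by (simp only: s.map_mult subst3_curve_form[OF ring_map_const3])
    with eq show ?thesis using that by metis
  qed
  have F0: "?F \<noteq> 0" using F_prime by (simp add: prime_elem_def)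
  have Ff0: "curve_eq f0 f1 f2 \<noteq> 0" using Q M F0 by auto
  obtain W where W: "jacobian ?X ?Y f0 f1 f2 = Z3 * W" "jacobian ?Y ?Z f0 f1 f2 = X3 * W"
    "homogeneous3 (3 * d - 2) (jacobian ?X ?Y f0 f1 f2)"
    using jacobian_homogeneous[OF f d0] by blast
  have ZW0: "Z3 * W \<noteq> 0"
    using jacobian_nonzero[OF g gf M f2] unfolding W(1) .
  have bound: "E ^ n dvd ?F * W ^ 2" if E: "prime_elem E" and n: "E ^ n dvd curve_eq f0 f1 f2" "n > 0" for E n
  proof (cases "E dvd ?F")
    case True
    have "?F dvd E" by (rule prime_elem_dvd_sym[OF E F_prime True])
    have "n = 1"
    proof (rule ccontr)
      assume "n \<noteq> 1"
      then have "E ^ 2 dvd curve_eq f0 f1 f2" using n by (intro dvd_trans[OF le_imp_power_dvd n(1)]) auto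
      then have "?F ^ 2 dvd curve_eq f0 f1 f2" using \<open>?F dvd E\<close> dvd_power_same dvd_trans by blast
      then have "?F * ?F dvd ?F * M ^ 7" unfolding power2_eq_square using Q by (metis dvd_mult2 mult.commute)
      then have "?F dvd M ^ 7" using F0 by (metis dvd_mult_cancel_left)
      then show False using F_M F_prime prime_elem_dvd_power by blast
    qed
    then show ?thesis using True by simp
  next
    case False
    have "E dvd curve_eq f0 f1 f2" using n by (meson dvd_power dvd_trans)
    then have "E dvd M ^ 7 * ?F" unfolding Q by (rule dvd_mult2)
    then have "E dvd M" using False E prime_elem_dvd_multD prime_elem_dvd_power by blast
    then have E_i: "E dvd ?f i" using i(3) dvd_trans by blast
    obtain a b m r where r: "a * ?F + b * i = subst2 const3 (Z3, Y3) r" "homogeneous2 m r" "r \<noteq> 0"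
      by (rule eliminate_from_curve[OF i(1,2)])
    have "?f (subst2 const3 (Z3, Y3) r) = subst2 const3 (f2, f1) r"
      by (subst ring_map_subst2_comp[OF s.ring_map_axioms ring_map_const3])
         (simp add: subst3_gens[OF ring_map_const3])
    moreover have "?f (a * ?F + b * i) = ?f a * curve_eq f0 f1 f2 + ?f b * ?f i"
      by (simp only: s.map_simps subst3_curve_form[OF ring_map_const3])
    ultimately have "E dvd subst2 const3 (f2, f1) r"
      using E_i \<open>E dvd curve_eq f0 f1 f2\<close> unfolding r(1)[symmetric] by (metis dvd_add dvd_mult)
    then have line: "E dvd f2 \<or> (\<exists>\<alpha>. E dvd f1 - const3 \<alpha> * f2)"
      by (rule prime_dvd_homogeneous2[OF ring_map_const3 E r(2,3)])
    have jac: "E ^ n dvd (jacobian (dir_deriv v) (dir_deriv w) f0 f1 f2) ^ 2" for v w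
      by (rule contracted_bound[OF \<zeta> derivation_dir_deriv derivation_dir_deriv dir_deriv_gens(1) dir_deriv_gens(1)
            E coprime[OF E] n line])
    have "E ^ n dvd (Z3 * W) ^ 2" "E ^ n dvd (X3 * W) ^ 2"
      using jac[of "(1, 0, 0)" "(0, 1, 0)"] jac[of "(0, 1, 0)" "(0, 0, 1)"] unfolding W(1,2) .
    then have "E ^ n dvd W ^ 2"
      by (rule prime_power_dvd_cancel_disjoint[OF E prime_elem_Z3 not_Z3_dvd_X3])
    then show ?thesis by simp
  qed
  have W0: "?F * W ^ 2 \<noteq> 0" using ZW0 F0 by simp
  have "curve_eq f0 f1 f2 dvd ?F * W ^ 2"
  proof (rule multiplicity_le_imp_dvd[OF Ff0])
    fix p :: "'a tripoly" assume p: "prime p"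
    then have pe: "prime_elem p" by simp
    show "multiplicity p (curve_eq f0 f1 f2) \<le> multiplicity p (?F * W ^ 2)"
    proof (cases "multiplicity p (curve_eq f0 f1 f2) = 0")
      case False
      then have "p ^ multiplicity p (curve_eq f0 f1 f2) dvd ?F * W ^ 2"
        by (intro bound[OF pe multiplicity_dvd]) simp
      then show ?thesis using W0 pe by (intro multiplicity_geI) (auto simp: prime_elem_def)
    qed simp
  qed
  \<comment> \<open>The degree of W is known through Z W, a determinant in f0, f1, f2 and their derivatives.\<close>
  then have "curve_eq f0 f1 f2 * Z3 ^ 2 dvd (?F * W ^ 2) * Z3 ^ 2" by (rule mult_dvd_mono) simp
  also have "(?F * W ^ 2) * Z3 ^ 2 = ?F * (jacobian ?X ?Y f0 f1 f2) ^ 2"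
    unfolding W(1) by (simp add: power_mult_distrib mult_ac)
  finally have dvd: "curve_eq f0 f1 f2 * Z3 ^ 2 dvd ?F * (jacobian ?X ?Y f0 f1 f2) ^ 2" .
  have "homogeneous3 (7 * d + 2 * 1) (curve_eq f0 f1 f2 * Z3 ^ 2)"
    using homogeneous3_subst3[OF F_hom f]
    by (intro homogeneous3_mult homogeneous3_power homogeneous3_Z)
       (simp add: subst3_curve_form[OF ring_map_const3])
  moreover have "homogeneous3 (7 + 2 * (3 * d - 2)) (?F * (jacobian ?X ?Y f0 f1 f2) ^ 2)"
    by (intro homogeneous3_mult homogeneous3_power F_hom W(3))
  moreover have "?F * (jacobian ?X ?Y f0 f1 f2) ^ 2 \<noteq> 0" using F0 ZW0 unfolding W(1) by simp
  ultimately have "7 * d + 2 * 1 \<le> 7 + 2 * (3 * d - 2)" using dvd by (intro homogeneous3_dvd_degree_le)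
  then show ?thesis using d0 by simp
qed

section \<open>Maps between fields of fractions\<close>

text \<open>
  The map p/q to h(p)/h(q).  As h need not be injective, only the representations p/q in D are
  admitted; in them h(q) must not vanish.
\<close>
definition fract_map :: "('a \<Rightarrow> 'a \<Rightarrow> bool) \<Rightarrow> ('a::idom \<Rightarrow> 'b::idom) \<Rightarrow> 'a fract \<Rightarrow> 'b fract" where
  "fract_map D h x = (SOME y. \<exists>p q. D p q \<and> x = Fract p q \<and> y = Fract (h p) (h q))"

lemma fract_map_Fract:
  assumes h: "ring_map h" and D: "\<And>p q. D p q \<Longrightarrow> q \<noteq> 0 \<and> h q \<noteq> 0" and pq: "D p q"
  shows "fract_map D h (Fract p q) = Fract (h p) (h q)"
proof -
  interpret ring_map h by fact
  have eq: "Fract (h a) (h b) = Fract (h p) (h q)" if "D a b" "Fract p q = Fract a b" for a b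
  proof -
    have "p * b = a * q" using that D[OF pq] D[OF that(1)] by (simp add: eq_fract)
    then have "h p * h b = h a * h q" by (metis map_mult)
    then show ?thesis using D[OF pq] D[OF that(1)] by (simp add: eq_fract)
  qed
  show ?thesis
    unfolding fract_map_def
  proof (rule some1_equality)
    show "\<exists>!y. \<exists>a b. D a b \<and> Fract p q = Fract a b \<and> y = Fract (h a) (h b)"
      using pq eq by (intro ex1I[of _ "Fract (h p) (h q)"]) blast+
    show "\<exists>a b. D a b \<and> Fract p q = Fract a b \<and> Fract (h p) (h q) = Fract (h a) (h b)"
      using pq by blast
  qed
qed

section \<open>The Kummer extension k(t)/k(t^5)\<close>

abbreviation fifth_power :: "'a::field poly \<Rightarrow> 'a poly" where
  "fifth_power p \<equiv> pcompose p (monom 1 5)"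

text \<open>
  The automorphism t \<mapsto> c t of k(t), for nonzero c.
\<close>
definition rotate :: "'a::field \<Rightarrow> 'a poly fract \<Rightarrow> 'a poly fract" where
  "rotate c = fract_map (\<lambda>p q. q \<noteq> 0) (\<lambda>p. pcompose p [:0, c:])"

text \<open>
  The field k(t^5).
\<close>
definition kummer_base :: "'a::field poly fract set" where
  "kummer_base = {Fract (fifth_power p) (fifth_power q) | p q. q \<noteq> 0}"

definition kummer_gen :: "'a::field poly fract" where
  "kummer_gen = Fract [:0, 1:] 1"

definition fract_const :: "'a::field \<Rightarrow> 'a poly fract" where
  "fract_const c = Fract [:c:] 1"

lemma ring_map_fract_const: "ring_map (fract_const :: 'a::field \<Rightarrow> _)"
  by unfold_locales (simp_all add: fract_const_def One_fract_def one_pCons mult.commute)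

lemma pcompose_scale_eq_0: "c \<noteq> 0 \<Longrightarrow> pcompose p [:0, c:] = 0 \<Longrightarrow> p = (0 :: 'a::field poly)"
  using pcompose_eq_0[of p "[:0, c:]"] by simp

lemma fifth_power_eq_0: "fifth_power p = 0 \<Longrightarrow> p = (0 :: 'a::field poly)"
  using pcompose_eq_0[of p "monom 1 5"] by (simp add: degree_monom_eq)

lemma rotate_Fract: "c \<noteq> 0 \<Longrightarrow> q \<noteq> 0 \<Longrightarrow> rotate c (Fract p q) = Fract (pcompose p [:0, c:]) (pcompose q [:0, c:])"
  unfolding rotate_def by (rule fract_map_Fract[OF ring_map_pcompose]) (auto dest: pcompose_scale_eq_0)

lemma ring_map_rotate:
  assumes c: "c \<noteq> (0 :: 'a::field)"
  shows "ring_map (rotate c)"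
proof
  fix x y :: "'a poly fract"
  obtain a b p q where x: "x = Fract a b" "b \<noteq> 0" and y: "y = Fract p q" "q \<noteq> 0"
    by (metis Fract_cases)
  have nz: "pcompose b [:0, c:] \<noteq> 0" "pcompose q [:0, c:] \<noteq> 0" using x y c pcompose_scale_eq_0 by blast+
  show "rotate c (x + y) = rotate c x + rotate c y"
    using x y c nz by (simp add: rotate_Fract pcompose_add pcompose_mult)
  show "rotate c (x * y) = rotate c x * rotate c y"
    using x y c nz by (simp add: rotate_Fract pcompose_mult)
next
  show "rotate c 1 = 1" unfolding One_fract_def using c by (simp add: rotate_Fract pcompose_1)
qed

lemma rotate_gens:
  assumes "c \<noteq> (0 :: 'a::field)"
  shows "rotate c kummer_gen = fract_const c * kummer_gen" "rotate c (fract_const b) = fract_const b"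
  using assms by (simp_all add: kummer_gen_def fract_const_def rotate_Fract pcompose_pCons pcompose_1)

lemma rotate_kummer_base:
  assumes "c \<noteq> 0" "c ^ 5 = 1" "x \<in> kummer_base"
  shows "rotate c x = (x :: 'a::field poly fract)"
proof -
  obtain p q where x: "x = Fract (fifth_power p) (fifth_power q)" "q \<noteq> 0"
    using assms(3) by (auto simp: kummer_base_def)
  have "pcompose (monom 1 5) [:0, c:] = monom 1 5"
  proof -
    have "pcompose ([:0, 1:] ^ 5) [:0, c:] = [:0, c:] ^ 5"
      by (subst ring_map.map_power[OF ring_map_pcompose]) (simp add: pcompose_pCons)
    also have "[:0, c:] = [:c:] * [:0, 1:]" by simp
    also have "\<dots> ^ 5 = [:c ^ 5:] * [:0, 1:] ^ 5"
      by (simp only: power_mult_distrib ring_map.map_power[OF ring_map_const_poly])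
    finally show ?thesis using assms(2) by (simp add: monom_altdef one_pCons)
  qed
  then have "pcompose (fifth_power p) [:0, c:] = fifth_power p" for p
    by (simp add: pcompose_assoc[symmetric])
  moreover have nz: "fifth_power q \<noteq> 0" using x(2) fifth_power_eq_0 by blast
  ultimately show ?thesis using rotate_Fract[OF assms(1) nz, of "fifth_power p"] by (simp only: x(1))
qed

lemma poly_mod_5:
  "\<exists>r. p = (\<Sum>i<5. fifth_power (r i) * [:0, 1:] ^ i)"
proof (induction p)
  case 0
  show ?case by (intro exI[of _ "\<lambda>_. 0"]) simp
next
  case (pCons a p)
  then obtain r where r: "p = (\<Sum>i<5. fifth_power (r i) * [:0, 1:] ^ i)" by blast
  define r' where "r' i = (case i of 0 \<Rightarrow> [:a:] + [:0, 1:] * r 4 | Suc j \<Rightarrow> r j)" for i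
  have "pCons a p = [:a:] + [:0, 1:] * p" by simp
  also have "\<dots> = (\<Sum>i<5. fifth_power (r' i) * [:0, 1:] ^ i)"
  proof -
    have f0: "fifth_power (r' 0) = [:a:] + [:0, 1:] ^ 5 * fifth_power (r 4)"
      by (simp add: r'_def pcompose_add pcompose_mult pcompose_pCons monom_altdef)
    have S: "(\<Sum>i<5. g i) = g 0 + g 1 + g 2 + g 3 + g 4" for g :: "nat \<Rightarrow> 'a poly"
      by (simp add: eval_nat_numeral)
    have r'S: "r' 1 = r 0" "r' 2 = r 1" "r' 3 = r 2" "r' 4 = r 3"
      by (simp_all add: r'_def numeral_eq_Suc)
    show ?thesis unfolding r S f0 r'S by Groebner_Basis.algebra
  qed
  finally show ?case by blast
qed

lemma supported_on_multiples_of_5: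
  assumes "\<And>n. \<not> 5 dvd n \<Longrightarrow> coeff p n = 0"
  shows "\<exists>r. p = fifth_power r"
  using assms
proof (induction "degree p" arbitrary: p rule: less_induct)
  case (less p)
  obtain a0 a1 a2 a3 a4 p' where p: "p = pCons a0 (pCons a1 (pCons a2 (pCons a3 (pCons a4 p'))))"
    by (metis pCons_cases)
  have "coeff p 1 = 0" "coeff p 2 = 0" "coeff p 3 = 0" "coeff p 4 = 0" by (rule less.prems; simp)+
  then have a: "a1 = 0" "a2 = 0" "a3 = 0" "a4 = 0" by (simp_all add: p numeral_eq_Suc)
  have p5: "p = [:a0:] + monom 1 5 * p'" unfolding p a by (simp add: monom_altdef eval_nat_numeral)
  show ?case
  proof (cases "p' = 0")
    case True
    then show ?thesis using p5 by (intro exI[of _ "[:a0:]"]) simp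
  next
    case False
    have "coeff p' n = 0" if "\<not> 5 dvd n" for n
    proof -
      have "\<not> 5 dvd n + 5" using that by simp
      then have "coeff p (n + 5) = 0" by (rule less.prems)
      then show ?thesis by (simp add: p numeral_eq_Suc)
    qed
    moreover have "degree p' < degree p" using False by (simp add: p)
    ultimately obtain r where "p' = fifth_power r" using less.hyps by blast
    then have "p = fifth_power ([:a0:] + [:0, 1:] * r)"
      unfolding p5 by (simp add: pcompose_add pcompose_mult pcompose_pCons)
    then show ?thesis by blast
  qed
qed

context curve_field begin

lemma rotation_invariant:
  assumes "pcompose p [:0, \<zeta>:] = p"
  shows "\<exists>r. p = fifth_power r"
proof (rule supported_on_multiples_of_5)
  fix n :: nat assume n: "\<not> 5 dvd n"
  have "\<zeta> ^ n = \<zeta> ^ (5 * (n div 5) + n mod 5)" by simp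
  also have "\<dots> = \<zeta> ^ (n mod 5)" by (simp only: power_add power_mult root power_one mult_1_left)
  finally have "\<zeta> ^ n \<noteq> 1" using primitive[of "n mod 5"] n by (simp add: mod_greater_zero_iff_not_dvd)
  moreover have "\<zeta> ^ n * coeff p n = coeff p n"
    using arg_cong[OF assms, of "\<lambda>p. coeff p n"] by (simp add: coeff_pcompose_linear)
  ultimately show "coeff p n = 0" by simp
qed

text \<open>
  The fraction is extended by the conjugates of its denominator.  The new denominator is a norm,
  hence invariant under rotation.
\<close>
lemma fract_fifth_power_denominator:
  fixes x :: "'a poly fract"
  obtains p q where "x = Fract p (fifth_power q)" "q \<noteq> 0"
proof -
  obtain a b where x: "x = Fract a b" "b \<noteq> 0" by (cases x) auto
  define c where "c i = pcompose b [:0, \<zeta> ^ i:]" for i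
  define N where "N = (\<Prod>i<5. c i)"
  have c_Suc: "pcompose (c i) [:0, \<zeta>:] = c (Suc i)" for i
    unfolding c_def by (simp add: pcompose_assoc[symmetric] pcompose_pCons mult.commute)
  have "pcompose N [:0, \<zeta>:] = (\<Prod>i<5. c (Suc i))"
    unfolding N_def by (simp only: ring_map.map_prod[OF ring_map_pcompose] c_Suc)
  also have "\<dots> = N"
  proof -
    have "c 5 = c 0" by (simp add: c_def root)
    then show ?thesis unfolding N_def by (simp add: eval_nat_numeral mult_ac)
  qed
  finally obtain q where q: "N = fifth_power q" using rotation_invariant by blast
  have c_nz: "c i \<noteq> 0" for i
    using x(2) zeta_nonzero pcompose_scale_eq_0[of "\<zeta> ^ i" b] by (auto simp: c_def)
  then have N: "N \<noteq> 0" by (simp add: N_def)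
  have "N = c 0 * (\<Prod>i<4. c (Suc i))"
    unfolding N_def by (simp add: eval_nat_numeral mult_ac)
  moreover have "c 0 = b" by (simp add: c_def pcompose_idR)
  ultimately have "x = Fract (a * (\<Prod>i<4. c (Suc i))) (fifth_power q)"
    using x N q by (simp add: eq_fract mult_ac)
  moreover have "q \<noteq> 0" using N q by auto
  ultimately show ?thesis using that by blast
qed

lemma rotate_fixed_iff: "rotate \<zeta> x = x \<longleftrightarrow> x \<in> kummer_base"
proof
  assume fixed: "rotate \<zeta> x = x"
  obtain p q where x: "x = Fract p (fifth_power q)" "q \<noteq> 0" by (rule fract_fifth_power_denominator)
  have nz: "fifth_power q \<noteq> 0" using x(2) fifth_power_eq_0 by blast
  have "Fract (fifth_power q) 1 \<in> kummer_base"
    unfolding kummer_base_def by (intro CollectI exI[of _ q] exI[of _ 1]) (simp add: pcompose_1)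
  then have q: "rotate \<zeta> (Fract (fifth_power q) 1) = Fract (fifth_power q) 1"
    by (rule rotate_kummer_base[OF zeta_nonzero root])
  have "Fract p 1 = x * Fract (fifth_power q) 1" using x nz by (simp add: eq_fract)
  then have "rotate \<zeta> (Fract p 1) = Fract p 1"
    using fixed q ring_map.map_mult[OF ring_map_rotate[OF zeta_nonzero]] by metis
  then have "pcompose p [:0, \<zeta>:] = p" using zeta_nonzero by (simp add: rotate_Fract pcompose_1 eq_fract)
  then obtain r where "p = fifth_power r" using rotation_invariant by blast
  with x show "x \<in> kummer_base" by (auto simp: kummer_base_def)
qed (rule rotate_kummer_base[OF zeta_nonzero root])

lemma kummer_decomposition:
  fixes x :: "'a poly fract"
  obtains k where "\<And>i. k i \<in> kummer_base" "x = (\<Sum>i<5. k i * kummer_gen ^ i)"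
proof -
  obtain p q where x: "x = Fract p (fifth_power q)" "q \<noteq> 0" by (rule fract_fifth_power_denominator)
  have nz: "fifth_power q \<noteq> 0" using x(2) fifth_power_eq_0 by blast
  obtain r where r: "p = (\<Sum>i<5. fifth_power (r i) * [:0, 1:] ^ i)" using poly_mod_5 by blast
  interpret f: ring_map "\<lambda>p :: 'a poly. Fract p 1"
    by unfold_locales (simp_all add: One_fract_def)
  have x': "x = Fract 1 (fifth_power q) * Fract p 1" using x nz by simp
  also have "\<dots> = (\<Sum>i<5. Fract (fifth_power (r i)) (fifth_power q) * kummer_gen ^ i)"
    unfolding r f.map_sum f.map_mult f.map_power kummer_gen_def[symmetric] sum_distrib_left
    by (intro sum.cong) (simp_all add: mult.assoc[symmetric])
  finally have "x = (\<Sum>i<5. Fract (fifth_power (r i)) (fifth_power q) * kummer_gen ^ i)" .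
  moreover have "Fract (fifth_power (r i)) (fifth_power q) \<in> kummer_base" for i
    using x(2) by (auto simp: kummer_base_def)
  ultimately show ?thesis using that[of "\<lambda>i. Fract (fifth_power (r i)) (fifth_power q)"] by blast
qed

lemma fract_const_in_kummer_base: "fract_const c \<in> kummer_base"
  unfolding kummer_base_def fract_const_def
  by (intro CollectI exI[of _ "[:c:]"] exI[of _ 1]) (simp add: pcompose_1)

lemma kummer_base_closed:
  fixes x y :: "'a poly fract"
  assumes "x \<in> kummer_base" "y \<in> kummer_base"
  shows "x + y \<in> kummer_base" "x * y \<in> kummer_base" "- x \<in> kummer_base" "inverse x \<in> kummer_base"
    "x - y \<in> kummer_base"
proof -
  interpret ring_map "rotate \<zeta>" by (rule ring_map_rotate[OF zeta_nonzero])
  note fixed = rotate_fixed_iff[symmetric]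
  show "x + y \<in> kummer_base" "x * y \<in> kummer_base" "- x \<in> kummer_base" "x - y \<in> kummer_base"
    using assms by (simp_all add: fixed map_simps)
  show "inverse x \<in> kummer_base"
  proof (cases "x = 0")
    case False
    then have "rotate \<zeta> (inverse x) * x = 1"
      using assms(1) map_mult[of "inverse x" x] by (simp add: fixed map_one)
    then have "rotate \<zeta> (inverse x) = inverse x" using False by (simp add: eq_divide_eq inverse_eq_divide)
    then show ?thesis by (simp add: fixed)
  qed (use assms in simp)
qed

definition kummer_span :: "nat \<Rightarrow> 'a poly fract set" where
  "kummer_span m = {(\<Sum>i<m. k i * kummer_gen ^ i) | k. \<forall>i. k i \<in> kummer_base}"

lemma kummer_spanI:
  "(\<And>i. k i \<in> kummer_base) \<Longrightarrow> (\<Sum>i<m. k i * kummer_gen ^ i) \<in> kummer_span m"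
  unfolding kummer_span_def by blast

lemma kummer_span_closed:
  assumes "x \<in> kummer_span m"
  shows "y \<in> kummer_span m \<Longrightarrow> x - y \<in> kummer_span m" "c \<in> kummer_base \<Longrightarrow> c * x \<in> kummer_span m"
    "rotate \<zeta> x \<in> kummer_span m"
proof -
  interpret ring_map "rotate \<zeta>" by (rule ring_map_rotate[OF zeta_nonzero])
  obtain k where k: "\<And>i. k i \<in> kummer_base" "x = (\<Sum>i<m. k i * kummer_gen ^ i)"
    using assms by (auto simp: kummer_span_def)
  show "x - y \<in> kummer_span m" if y: "y \<in> kummer_span m"
  proof -
    obtain l where l: "\<And>i. l i \<in> kummer_base" "y = (\<Sum>i<m. l i * kummer_gen ^ i)"
      using y by (auto simp: kummer_span_def)
    have "x - y = (\<Sum>i<m. (k i - l i) * kummer_gen ^ i)"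
      unfolding k l by (simp add: sum_subtractf left_diff_distrib)
    then show ?thesis by (simp only:) (intro kummer_spanI kummer_base_closed k l)
  qed
  show "c * x \<in> kummer_span m" if "c \<in> kummer_base"
  proof -
    have "c * x = (\<Sum>i<m. (c * k i) * kummer_gen ^ i)"
      unfolding k by (simp add: sum_distrib_left mult.assoc)
    then show ?thesis using that by (simp only:) (intro kummer_spanI kummer_base_closed k)
  qed
  have "rotate \<zeta> (k i) = k i" for i using k(1) rotate_fixed_iff by blast
  then have "rotate \<zeta> x = (\<Sum>i<m. (k i * fract_const \<zeta> ^ i) * kummer_gen ^ i)"
    unfolding k(2) map_sum map_mult map_power rotate_gens(1)[OF zeta_nonzero] power_mult_distrib
    by (simp add: mult.assoc)
  moreover have "fract_const \<zeta> ^ i \<in> kummer_base" for i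
    unfolding ring_map.map_power[OF ring_map_fract_const, symmetric] by (rule fract_const_in_kummer_base)
  ultimately show "rotate \<zeta> x \<in> kummer_span m"
    by (simp only:) (intro kummer_spanI kummer_base_closed k)
qed

text \<open>
  The power t^i is an eigenvector of the rotation with eigenvalue \<zeta>^i, and these are distinct for
  i < 5.  Subtracting \<zeta>^m times the identity from the rotation removes the highest term of an
  element of the span and keeps eigenvectors.
\<close>
lemma kummer_eigenvector_zero:
  assumes "x \<in> kummer_span m" "rotate \<zeta> x = fract_const \<zeta> ^ j * x" "m \<le> j" "j < 5"
  shows "x = 0"
  using assms
proof (induction m arbitrary: x)
  case 0
  then show ?case by (simp add: kummer_span_def)
next
  case (Suc m)
  interpret ring_map "rotate \<zeta>" by (rule ring_map_rotate[OF zeta_nonzero])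
  interpret c: ring_map "fract_const :: 'a \<Rightarrow> _" by (rule ring_map_fract_const)
  obtain k where k: "\<And>i. k i \<in> kummer_base" "x = (\<Sum>i<Suc m. k i * kummer_gen ^ i)"
    using Suc.prems by (auto simp: kummer_span_def)
  define e where "e = (\<Sum>i<m. k i * kummer_gen ^ i)"
  have e: "e \<in> kummer_span m" unfolding e_def by (intro kummer_spanI k)
  have x: "x = e + k m * kummer_gen ^ m" by (simp add: k e_def)
  define y where "y = fract_const (\<zeta> ^ j - \<zeta> ^ m) * x"
  have "y = rotate \<zeta> x - fract_const \<zeta> ^ m * x"
    unfolding y_def Suc.prems(2) c.map_diff c.map_power by (simp add: left_diff_distrib)
  also have "\<dots> = rotate \<zeta> e - fract_const \<zeta> ^ m * e"
  proof -
    have "rotate \<zeta> (k m) = k m" using k rotate_fixed_iff by blast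
    then show ?thesis
      unfolding x map_add map_mult map_power rotate_gens(1)[OF zeta_nonzero] power_mult_distrib
      by (simp add: algebra_simps)
  qed
  also have "\<dots> \<in> kummer_span m"
    unfolding c.map_power[symmetric]
    by (intro kummer_span_closed e fract_const_in_kummer_base)
  finally have y: "y \<in> kummer_span m" .
  have "rotate \<zeta> y = fract_const \<zeta> ^ j * y"
    unfolding y_def map_mult rotate_gens(2)[OF zeta_nonzero] Suc.prems(2) by (rule mult.left_commute)
  then have "y = 0" using Suc.IH[OF y] Suc.prems by simp
  moreover have "fract_const (\<zeta> ^ j - \<zeta> ^ m) \<noteq> 0"
    using zeta_power_inj[of j m] Suc.prems by (auto simp: fract_const_def Zero_fract_def eq_fract)
  ultimately show ?case unfolding y_def by simp
qed

lemma kummer_gen_not_in_span: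
  assumes "m < 5"
  shows "kummer_gen ^ m \<notin> kummer_span m"
proof
  interpret ring_map "rotate \<zeta>" by (rule ring_map_rotate[OF zeta_nonzero])
  assume "kummer_gen ^ m \<in> kummer_span m"
  moreover have "rotate \<zeta> (kummer_gen ^ m) = fract_const \<zeta> ^ m * kummer_gen ^ m"
    unfolding map_power rotate_gens(1)[OF zeta_nonzero] by (rule power_mult_distrib)
  ultimately have "kummer_gen ^ m = (0 :: 'a poly fract)" using kummer_eigenvector_zero assms by blast
  then have "kummer_gen = (0 :: 'a poly fract)" by simp
  then show False by (simp add: kummer_gen_def Zero_fract_def eq_fract)
qed

end

section \<open>Extension to the plane\<close>

lemma homogeneous3_linear:
  assumes "homogeneous3 1 p"
  obtains a b c where "p = const3 a * X3 + const3 b * Y3 + const3 c * Z3"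
proof -
  have "\<exists>a b c. p = const3 a * X3 + const3 b * Y3 + const3 c * Z3"
    using assms
  proof (induction rule: homogeneous3_induct)
    case zero
    show ?case by (intro exI[of _ 0]) simp
  next
    case (add p q)
    then obtain a b c a' b' c' where "p = const3 a * X3 + const3 b * Y3 + const3 c * Z3"
      "q = const3 a' * X3 + const3 b' * Y3 + const3 c' * Z3" by blast
    then have "p + q = const3 (a + a') * X3 + const3 (b + b') * Y3 + const3 (c + c') * Z3"
      by (simp only: ring_map.map_add[OF ring_map_const3] distrib_right) (simp only: add_ac)
    then show ?case by blast
  next
    case (monomial k i j l)
    then consider "i = 1" "j = 0" "l = 0" | "i = 0" "j = 1" "l = 0" | "i = 0" "j = 0" "l = 1" by linarith
    then show ?case
    proof cases
      case 1 then show ?thesis by (intro exI[of _ k] exI[of _ 0]) simp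
    next
      case 2 then show ?thesis by (intro exI[of _ 0] exI[of _ k] exI[of _ 0]) simp
    next
      case 3 then show ?thesis by (intro exI[of _ 0] exI[of _ 0] exI[of _ k]) simp
    qed
  qed
  then show ?thesis using that by blast
qed

lemma proportional_to_variables:
  fixes h0 h1 h2 :: "'a::idom tripoly"
  assumes "h0 * Z3 = h2 * X3" "h1 * Z3 = h2 * Y3" "h0 \<noteq> 0 \<or> h1 \<noteq> 0 \<or> h2 \<noteq> 0"
  obtains M where "h0 = M * X3" "h1 = M * Y3" "h2 = M * Z3" "M \<noteq> 0"
proof -
  have Z0: "Z3 \<noteq> (0 :: 'a tripoly)" by (simp add: Z3_def)
  have "Z3 dvd h2 * X3" unfolding assms(1)[symmetric] by simp
  then have "Z3 dvd h2" using prime_elem_Z3 not_Z3_dvd_X3 prime_elem_dvd_multD by blast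
  then obtain M where M: "h2 = Z3 * M" by (elim dvdE)
  have "Z3 * h0 = Z3 * (M * X3)" "Z3 * h1 = Z3 * (M * Y3)"
    using assms(1,2) unfolding M by (simp_all only: mult_ac)
  then have h: "h0 = M * X3" "h1 = M * Y3" using Z0 by (metis mult_cancel_left)+
  then show ?thesis using that[of M] assms(3) M by (auto simp: mult.commute)
qed

lemma remove_common_factor:
  fixes f0 f1 f2 :: "'a::field_gcd tripoly"
  assumes f: "homogeneous3 d f0" "homogeneous3 d f1" "homogeneous3 d f2" and nz: "f0 \<noteq> 0 \<or> f1 \<noteq> 0 \<or> f2 \<noteq> 0"
  obtains c d' g0 g1 g2 where "c \<noteq> 0" "f0 = c * g0" "f1 = c * g1" "f2 = c * g2"
    "homogeneous3 d' g0" "homogeneous3 d' g1" "homogeneous3 d' g2"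
    "\<And>E. prime_elem E \<Longrightarrow> \<not> (E dvd g0 \<and> E dvd g1 \<and> E dvd g2)"
proof -
  define c where "c = gcd f0 (gcd f1 f2)"
  have c0: "c \<noteq> 0" using nz by (auto simp: c_def)
  have "c dvd f0" "c dvd f1" "c dvd f2"
    unfolding c_def by (auto intro: dvd_trans[OF gcd_dvd2])
  then obtain g0 g1 g2 where g: "f0 = c * g0" "f1 = c * g1" "f2 = c * g2" by (auto elim!: dvdE)
  have factor: "\<exists>i j. homogeneous3 i c \<and> homogeneous3 j h \<and> i + j = d" if "homogeneous3 d (c * h)" "c * h \<noteq> 0" for h
    using homogeneous3_factor[OF that] .
  obtain i j where i: "homogeneous3 i c" "i + j = d"
    using nz factor f unfolding g by metis
  have hom: "homogeneous3 j h" if h: "homogeneous3 d (c * h)" for h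
  proof (cases "h = 0")
    case False
    then obtain i' j' where ij: "homogeneous3 i' c" "homogeneous3 j' h" "i' + j' = d" using factor[OF h] c0 by auto
    have "i' = i" using ij(1) i(1) c0 unfolding homogeneous3_iff_scale3 by (metis degree_monom_eq)
    then have "j' = j" using ij(3) i(2) by linarith
    then show ?thesis using ij(2) by simp
  qed (simp add: homogeneous3_0)
  have "\<not> (E dvd g0 \<and> E dvd g1 \<and> E dvd g2)" if E: "prime_elem E" for E
  proof
    assume "E dvd g0 \<and> E dvd g1 \<and> E dvd g2"
    then have "c * E dvd f0" "c * E dvd f1" "c * E dvd f2" unfolding g by (simp_all add: mult_dvd_mono)
    then have "c * E dvd c" unfolding c_def by simp
    then have "c * E dvd c * 1" by simp
    then have "E dvd 1" using c0 by (metis dvd_mult_cancel_left)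
    with E show False by (simp add: prime_elem_def)
  qed
  then show ?thesis using that[OF c0 g, of j] hom f unfolding g by blast
qed

text \<open>
  The triple maps the point with parameter t to the point with parameter \<eta> t.  Only the third
  coordinate serves as a denominator.
\<close>
definition restricts_to_rotation :: "'a::field \<Rightarrow> 'a tripoly \<times> 'a tripoly \<times> 'a tripoly \<Rightarrow> bool" where
  "restricts_to_rotation \<eta> = (\<lambda>(f0, f1, f2). on_curve f2 \<noteq> 0 \<and>
     on_curve f0 * pcompose (on_curve Z3) [:0, \<eta>:] = on_curve f2 * pcompose (on_curve X3) [:0, \<eta>:] \<and>
     on_curve f1 * pcompose (on_curve Z3) [:0, \<eta>:] = on_curve f2 * pcompose (on_curve Y3) [:0, \<eta>:])"

lemma on_curve_rotated:
  "pcompose (on_curve Z3) [:0, \<eta>:] = [:1, 0, \<eta> ^ 2:]"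
  "pcompose (on_curve X3) [:0, \<eta>:] = [:0, \<eta>, 0, 0, 0, 0, 0, - (\<eta> ^ 7):]"
  "pcompose (on_curve Y3) [:0, \<eta>:] = smult (\<eta> ^ 5) ([:0, 1:] ^ 5 * [:1, 0, \<eta> ^ 2:])"
proof -
  interpret c: ring_map "\<lambda>p :: 'a poly. pcompose p [:0, \<eta>:]" by (rule ring_map_pcompose)
  have x: "pcompose [:0, 1:] [:0, \<eta>:] = [:0, \<eta>:]" by (simp add: pcompose_pCons)
  have e: "[:0, \<eta>:] = [:\<eta>:] * [:0, 1:]" by simp
  have pow: "[:0, \<eta>:] ^ n = smult (\<eta> ^ n) ([:0, 1:] ^ n)" for n
    unfolding e power_mult_distrib ring_map.map_power[OF ring_map_const_poly, symmetric] by simp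
  show Z: "pcompose (on_curve Z3) [:0, \<eta>:] = [:1, 0, \<eta> ^ 2:]"
    unfolding on_curve_gens c.map_simps x by (simp add: power2_eq_square one_pCons)
  show "pcompose (on_curve X3) [:0, \<eta>:] = [:0, \<eta>, 0, 0, 0, 0, 0, - (\<eta> ^ 7):]"
    unfolding on_curve_gens c.map_simps x pow by (simp add: eval_nat_numeral)
  show "pcompose (on_curve Y3) [:0, \<eta>:] = smult (\<eta> ^ 5) ([:0, 1:] ^ 5 * [:1, 0, \<eta> ^ 2:])"
    unfolding on_curve_gens c.map_mult c.map_power x pow Z[unfolded on_curve_gens] by (rule mult_smult_left)
qed

text \<open>
  Both sides are the form G evaluated at two proportional triples; [:1, 0, \<eta>^2:] is the third
  coordinate of the point with parameter \<eta> t.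
\<close>
lemma restricts_to_rotation_subst3:
  assumes "restricts_to_rotation \<eta> (f0, f1, f2)" and G: "homogeneous3 n G"
  shows "[:1, 0, \<eta> ^ 2:] ^ n * on_curve (subst3 const3 (f0, f1, f2) G) = on_curve f2 ^ n * pcompose (on_curve G) [:0, \<eta>:]"
proof -
  note cp = ring_map_const_poly
  let ?w = "pcompose (on_curve Z3) [:0, \<eta>:]"
  have r: "?w * on_curve f0 = on_curve f2 * pcompose (on_curve X3) [:0, \<eta>:]"
    "?w * on_curve f1 = on_curve f2 * pcompose (on_curve Y3) [:0, \<eta>:]" "?w * on_curve f2 = on_curve f2 * ?w"
    using assms(1) by (simp_all add: restricts_to_rotation_def mult.commute)
  have "on_curve (subst3 const3 (f0, f1, f2) G) = subst3 (\<lambda>c. [:c:]) (on_curve f0, on_curve f1, on_curve f2) G"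
    by (subst ring_map_subst3_comp[OF ring_map_on_curve ring_map_const3]) (simp add: on_curve_gens)
  then have "?w ^ n * on_curve (subst3 const3 (f0, f1, f2) G)
    = subst3 (\<lambda>c. [:c:]) (?w * on_curve f0, ?w * on_curve f1, ?w * on_curve f2) G"
    by (simp only: subst3_homogeneous_scale[OF G cp])
  also have "\<dots> = on_curve f2 ^ n * subst3 (\<lambda>c. [:c:]) (pcompose (on_curve X3) [:0, \<eta>:],
      pcompose (on_curve Y3) [:0, \<eta>:], pcompose (on_curve Z3) [:0, \<eta>:]) G"
    unfolding r by (rule subst3_homogeneous_scale[OF G cp])
  also have "subst3 (\<lambda>c. [:c:]) (pcompose (on_curve X3) [:0, \<eta>:],
      pcompose (on_curve Y3) [:0, \<eta>:], pcompose (on_curve Z3) [:0, \<eta>:]) G = pcompose (on_curve G) [:0, \<eta>:]"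
  proof -
    have "on_curve G = on_curve (subst3 const3 (X3, Y3, Z3) G)" by (simp add: subst3_variables)
    also have "\<dots> = subst3 (\<lambda>c. [:c:]) (on_curve X3, on_curve Y3, on_curve Z3) G"
      by (subst ring_map_subst3_comp[OF ring_map_on_curve ring_map_const3]) (simp only: on_curve_gens)
    finally show ?thesis
      by (simp only:) (subst ring_map_subst3_comp[OF ring_map_pcompose cp], simp)
  qed
  finally show ?thesis unfolding on_curve_rotated .
qed

text \<open>
  On the curve a linear form is c + a t + c t^2 + b t^5 + (b - a) t^7.  Since f1/f2 is t^5, the forms
  f1 and f2 are multiples of Y and Z on the curve by the same constant, and comparing the
  coefficients of t and t^3 in f0/f2 = \<eta> (t - \<eta>^6 t^7) / (1 + \<eta>^2 t^2) gives \<eta>^2 = 1.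
\<close>
lemma linear_rotation_trivial:
  fixes \<eta> :: "'a::field"
  assumes f: "homogeneous3 1 f0" "homogeneous3 1 f1" "homogeneous3 1 f2"
    and rot: "restricts_to_rotation \<eta> (f0, f1, f2)" and \<eta>: "\<eta> ^ 5 = 1"
  shows "\<eta> = 1"
proof -
  let ?t = "[:0, 1:] :: 'a poly"
  have lin: "\<exists>a b c. on_curve p = [:c, a, c, 0, 0, b, 0, b - a:]" if p: "homogeneous3 1 p" for p :: "'a tripoly"
  proof -
    obtain a b c where "p = const3 a * X3 + const3 b * Y3 + const3 c * Z3" by (rule homogeneous3_linear[OF p])
    then have "on_curve p = [:a:] * (?t - ?t ^ 7) + [:b:] * (?t ^ 5 * (?t ^ 2 + 1)) + [:c:] * (?t ^ 2 + 1)"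
      by (simp only: ring_map.map_add[OF ring_map_on_curve] ring_map.map_mult[OF ring_map_on_curve] on_curve_gens)
    also have "\<dots> = [:c, a, c, 0, 0, b, 0, b - a:]" by (simp add: eval_nat_numeral one_pCons)
    finally show ?thesis by blast
  qed
  obtain a0 b0 c0 where f0: "on_curve f0 = [:c0, a0, c0, 0, 0, b0, 0, b0 - a0:]" using lin[OF f(1)] by blast
  obtain a1 b1 c1 where f1: "on_curve f1 = [:c1, a1, c1, 0, 0, b1, 0, b1 - a1:]" using lin[OF f(2)] by blast
  have w: "[:1, 0, \<eta> ^ 2:] \<noteq> 0" by simp
  have "on_curve f1 * [:1, 0, \<eta> ^ 2:] = on_curve f2 * (?t ^ 5 * [:1, 0, \<eta> ^ 2:])"
    using rot \<eta> unfolding restricts_to_rotation_def on_curve_rotated by simp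
  then have "on_curve f1 * [:1, 0, \<eta> ^ 2:] = (?t ^ 5 * on_curve f2) * [:1, 0, \<eta> ^ 2:]" by (simp only: mult_ac)
  then have "on_curve f1 = ?t ^ 5 * on_curve f2" using w by (metis mult_cancel_right)
  also have "\<dots> = pCons 0 (pCons 0 (pCons 0 (pCons 0 (pCons 0 (on_curve f2)))))" by (simp add: eval_nat_numeral)
  finally have f2: "on_curve f2 = [:b1, 0, b1:]" and "a1 = 0" unfolding f1 by auto
  have b1: "b1 \<noteq> 0" using rot f2 by (auto simp: restricts_to_rotation_def)
  have eq: "on_curve f0 * [:1, 0, \<eta> ^ 2:] = on_curve f2 * [:0, \<eta>, 0, 0, 0, 0, 0, - (\<eta> ^ 7):]"
    using rot unfolding restricts_to_rotation_def on_curve_rotated by simp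
  have "a0 = b1 * \<eta>" using arg_cong[OF eq, of "\<lambda>p. coeff p 1"] unfolding f0 f2
    by (simp add: mult.commute)
  moreover have "a0 * \<eta> ^ 2 = b1 * \<eta>"
    using arg_cong[OF eq, of "\<lambda>p. coeff p 3"] unfolding f0 f2
    by (simp add: numeral_3_eq_3 mult.commute)
  ultimately have "(b1 * \<eta>) * \<eta> ^ 2 = (b1 * \<eta>) * 1" by simp
  moreover have "\<eta> \<noteq> 0" using \<eta> by auto
  ultimately have \<eta>2: "\<eta> ^ 2 = 1" using b1 by (metis mult_cancel_left mult_eq_0_iff)
  have "\<eta> ^ 5 = (\<eta> ^ 2) ^ 2 * \<eta>" by (simp add: eval_nat_numeral)
  then show ?thesis using \<eta> \<eta>2 by simp
qed

text \<open>
  Removing the common factors of f and of g does not change the maps, and brings them into the form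
  required by \<open>cremona_preserving_curve_linear\<close>.
\<close>
theorem cremona_rotation_trivial:
  fixes f0 f1 f2 g0 g1 g2 M :: "'a::{alg_closed_field,field_gcd} tripoly"
  assumes \<zeta>: "curve_field (\<zeta> :: 'a)"
    and f: "homogeneous3 d f0" "homogeneous3 d f1" "homogeneous3 d f2"
    and g: "homogeneous3 e g0" "homogeneous3 e g1" "homogeneous3 e g2"
    and gf: "subst3 const3 (f0, f1, f2) g0 = M * X3" "subst3 const3 (f0, f1, f2) g1 = M * Y3"
      "subst3 const3 (f0, f1, f2) g2 = M * Z3" and M: "M \<noteq> 0"
    and rot: "restricts_to_rotation \<eta> (f0, f1, f2)" and \<eta>: "\<eta> ^ 5 = 1"
  shows "\<eta> = 1"
proof -
  interpret curve_field \<zeta> by fact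
  interpret oc: ring_map "on_curve :: 'a tripoly \<Rightarrow> _" by (rule ring_map_on_curve)
  interpret s: ring_map "subst3 const3 (f0, f1, f2)" by (rule ring_map_subst3[OF ring_map_const3])
  have "f2 \<noteq> 0" using rot by (auto simp: restricts_to_rotation_def oc.map_zero)
  then obtain c d' p0 p1 p2 where c: "c \<noteq> 0" and p: "f0 = c * p0" "f1 = c * p1" "f2 = c * p2"
    and hp: "homogeneous3 d' p0" "homogeneous3 d' p1" "homogeneous3 d' p2"
    and coprime_p: "\<And>E. prime_elem E \<Longrightarrow> \<not> (E dvd p0 \<and> E dvd p1 \<and> E dvd p2)"
    using remove_common_factor[OF f] by metis
  have "M * Z3 \<noteq> 0" using M by (simp add: Z3_def)
  then have "g2 \<noteq> 0" using gf(3) s.map_zero by auto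
  then obtain b e' q0 q1 q2 where b: "b \<noteq> 0" and q: "g0 = b * q0" "g1 = b * q1" "g2 = b * q2"
    and hq: "homogeneous3 e' q0" "homogeneous3 e' q1" "homogeneous3 e' q2"
    and coprime_q: "\<And>E. prime_elem E \<Longrightarrow> \<not> (E dvd q0 \<and> E dvd q1 \<and> E dvd q2)"
    using remove_common_factor[OF g] by metis
  have rot': "restricts_to_rotation \<eta> (p0, p1, p2)"
  proof -
    have nz: "on_curve c \<noteq> 0" "on_curve p2 \<noteq> 0"
      using rot unfolding p restricts_to_rotation_def prod.case oc.map_mult by auto
    have "on_curve c * (on_curve p0 * pcompose (on_curve Z3) [:0, \<eta>:]) = on_curve c * (on_curve p2 * pcompose (on_curve X3) [:0, \<eta>:])"
      "on_curve c * (on_curve p1 * pcompose (on_curve Z3) [:0, \<eta>:]) = on_curve c * (on_curve p2 * pcompose (on_curve Y3) [:0, \<eta>:])"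
      using rot unfolding p restricts_to_rotation_def prod.case oc.map_mult by (simp_all only: mult.assoc)
    then show ?thesis using nz unfolding restricts_to_rotation_def prod.case by (simp only: mult_cancel_left) blast
  qed
  define A where "A = subst3 const3 (f0, f1, f2) b * c ^ e'"
  have A: "subst3 const3 (f0, f1, f2) (b * h) = A * subst3 const3 (p0, p1, p2) h" if h: "homogeneous3 e' h" for h
    unfolding s.map_mult unfolding p A_def subst3_homogeneous_scale[OF h ring_map_const3] by (simp add: mult.assoc)
  have eqs: "A * subst3 const3 (p0, p1, p2) q0 = M * X3" "A * subst3 const3 (p0, p1, p2) q1 = M * Y3"
    "A * subst3 const3 (p0, p1, p2) q2 = M * Z3"
    using gf A hq unfolding q by auto
  have A0: "A \<noteq> 0" using eqs(3) \<open>M * Z3 \<noteq> 0\<close> by auto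
  let ?h = "subst3 const3 (p0, p1, p2)"
  have "A * (?h q0 * Z3) = A * (?h q2 * X3)" "A * (?h q1 * Z3) = A * (?h q2 * Y3)"
    unfolding mult.assoc[symmetric] eqs by (simp_all only: mult_ac)
  then have "?h q0 * Z3 = ?h q2 * X3" "?h q1 * Z3 = ?h q2 * Y3" using A0 by (metis mult_cancel_left)+
  moreover have "?h q2 \<noteq> 0" using eqs(3) \<open>M * Z3 \<noteq> 0\<close> by auto
  ultimately obtain M' where M': "?h q0 = M' * X3" "?h q1 = M' * Y3" "?h q2 = M' * Z3" "M' \<noteq> 0"
    using proportional_to_variables[of "?h q0" "?h q2" "?h q1"] by metis
  have w: "[:1, 0, \<eta> ^ 2:] \<noteq> (0 :: 'a poly)" by simp
  have \<eta>0: "\<eta> \<noteq> 0" using \<eta> by auto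
  have "d' = 1"
  proof (rule cremona_preserving_curve_linear[OF \<zeta> hp coprime_p hq _ M'])
    show "\<not> (curve_form dvd q0 \<and> curve_form dvd q1 \<and> curve_form dvd q2)"
      using coprime_q[OF prime_elem_curve_form] .
    have hF: "homogeneous3 (7 * d') (curve_eq p0 p1 p2)"
      using homogeneous3_subst3[OF homogeneous3_curve_form hp] by (simp add: subst3_curve_form[OF ring_map_const3])
    have "[:1, 0, \<eta> ^ 2:] ^ 7 * on_curve (curve_eq p0 p1 p2) = 0"
      using restricts_to_rotation_subst3[OF rot' homogeneous3_curve_form]
      by (simp add: subst3_curve_form[OF ring_map_const3] on_curve_curve_form)
    then have "on_curve (curve_eq p0 p1 p2) = 0" using w by (metis mult_eq_0_iff power_not_zero)
    then show "curve_form dvd curve_eq p0 p1 p2"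
      using on_curve_eq_0_iff[OF hF] curve_C_eq by blast
    show "curve_form dvd G" if G: "homogeneous3 n G" "curve_form dvd ?h G" for n G
    proof -
      have "on_curve (?h G) = 0"
        using G(2) on_curve_curve_form[where 'a = 'a] by (auto simp: oc.map_mult elim!: dvdE)
      then have "on_curve p2 ^ n * pcompose (on_curve G) [:0, \<eta>:] = 0"
        using restricts_to_rotation_subst3[OF rot' G(1)] by simp
      moreover have "on_curve p2 \<noteq> 0" using rot' by (simp add: restricts_to_rotation_def)
      ultimately have "pcompose (on_curve G) [:0, \<eta>:] = 0" by simp
      then have "on_curve G = 0" using pcompose_scale_eq_0[OF \<eta>0] by blast
      then show ?thesis using on_curve_eq_0_iff[OF G(1)] curve_C_eq by blast
    qed
  qed
  then show ?thesis using linear_rotation_trivial[OF _ _ _ rot' \<eta>] hp by simp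
qed

section \<open>Galois theory of the Kummer extension\<close>

definition field_ring :: "'f::field ring" where
  "field_ring = \<lparr>carrier = UNIV, monoid.mult = (*), one = 1, zero = 0, add = (+)\<rparr>"

lemma field_ring_simps:
  "carrier field_ring = UNIV" "x \<otimes>\<^bsub>field_ring\<^esub> y = x * y" "\<one>\<^bsub>field_ring\<^esub> = 1"
  "\<zero>\<^bsub>field_ring\<^esub> = 0" "x \<oplus>\<^bsub>field_ring\<^esub> y = x + y"
  by (simp_all add: field_ring_def)

lemma field_field_ring: "field (field_ring :: 'f::field ring)"
proof -
  have "cring (field_ring :: 'f ring)"
  proof (rule cringI)
    show "abelian_group (field_ring :: 'f ring)"
      by (rule abelian_groupI) (auto simp: field_ring_simps add_ac intro: exI[of _ "- _"] right_minus left_minus ab_left_minus)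
    show "comm_monoid (field_ring :: 'f ring)"
      by (rule comm_monoidI) (auto simp: field_ring_simps mult_ac)
  qed (simp_all add: field_ring_simps distrib_right)
  then show ?thesis
  proof (rule cring.cring_fieldI2)
    show "\<exists>b\<in>carrier field_ring. a \<otimes>\<^bsub>field_ring\<^esub> b = \<one>\<^bsub>field_ring\<^esub>"
      if "a \<noteq> \<zero>\<^bsub>field_ring\<^esub>" for a :: 'f
      using that by (intro bexI[of _ "inverse a"]) (simp_all add: field_ring_simps)
  qed (simp add: field_ring_simps)
qed

context curve_field begin

lemma kummer_base_subfield: "subfield (kummer_base :: 'a poly fract set) field_ring"
proof -
  interpret F: field "field_ring :: 'a poly fract ring" by (rule field_field_ring)
  have neg: "\<ominus>\<^bsub>field_ring\<^esub> x = - x" for x :: "'a poly fract"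
    by (rule F.minus_equality) (simp_all add: field_ring_simps)
  have one: "1 \<in> (kummer_base :: 'a poly fract set)"
    using fract_const_in_kummer_base[of 1] by (simp add: ring_map.map_one[OF ring_map_fract_const])
  have "subring (kummer_base :: 'a poly fract set) field_ring"
    by (rule F.subringI) (auto simp: field_ring_simps neg one intro: kummer_base_closed)
  then show ?thesis
  proof (rule F.subfieldI')
    fix k :: "'a poly fract" assume k: "k \<in> kummer_base - {\<zero>\<^bsub>field_ring\<^esub>}"
    have "inv\<^bsub>field_ring\<^esub> k = inverse k"
      by (rule F.inv_char) (use k in \<open>simp_all add: field_ring_simps\<close>)
    then show "inv\<^bsub>field_ring\<^esub> k \<in> kummer_base" using k kummer_base_closed(4)[of k k] by simp
  qed
qed

text \<open>
  The span of 1, t, ..., t^m is a line extension of the previous one because t^m is not in it.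
\<close>
lemma kummer_dimension: "ring.dimension field_ring 5 (kummer_base :: 'a poly fract set) UNIV"
proof -
  interpret F: field "field_ring :: 'a poly fract ring" by (rule field_field_ring)
  have "F.dimension m kummer_base (kummer_span m)" if "m \<le> 5" for m
    using that
  proof (induction m)
    case 0
    have "kummer_span 0 = {\<zero>\<^bsub>field_ring\<^esub> :: 'a poly fract}"
      using fract_const_in_kummer_base by (auto simp: kummer_span_def field_ring_simps)
    then show ?case using F.zero_dim by simp
  next
    case (Suc m)
    have "kummer_span (Suc m) = F.line_extension kummer_base (kummer_gen ^ m) (kummer_span m)"
    proof (intro Set.set_eqI iffI)
      fix x assume "x \<in> kummer_span (Suc m)"
      then obtain k where k: "\<And>i. k i \<in> kummer_base" "x = (\<Sum>i<Suc m. k i * kummer_gen ^ i)"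
        by (auto simp: kummer_span_def)
      then show "x \<in> F.line_extension kummer_base (kummer_gen ^ m) (kummer_span m)"
        unfolding F.line_extension_mem_iff field_ring_simps
        by (intro bexI[of _ "k m"] bexI[of _ "\<Sum>i<m. k i * kummer_gen ^ i"] kummer_spanI) (auto simp: add.commute)
    next
      fix x assume "x \<in> F.line_extension kummer_base (kummer_gen ^ m) (kummer_span m)"
      then obtain c k where k: "c \<in> kummer_base" "\<And>i. k i \<in> kummer_base"
        "x = c * kummer_gen ^ m + (\<Sum>i<m. k i * kummer_gen ^ i)"
        by (auto simp: F.line_extension_mem_iff field_ring_simps kummer_span_def)
      have "x = (\<Sum>i<Suc m. (if i = m then c else k i) * kummer_gen ^ i)" by (simp add: k(3))
      also have "\<dots> \<in> kummer_span (Suc m)" by (rule kummer_spanI) (simp add: k)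
      finally show "x \<in> kummer_span (Suc m)" .
    qed
    moreover have "F.dimension (Suc m) kummer_base (F.line_extension kummer_base (kummer_gen ^ m) (kummer_span m))"
      using Suc kummer_gen_not_in_span by (intro F.Suc_dim) (auto simp: field_ring_simps)
    ultimately show ?case by simp
  qed
  moreover have "kummer_span 5 = (UNIV :: 'a poly fract set)"
  proof -
    have "x \<in> kummer_span 5" for x :: "'a poly fract"
    proof -
      obtain k where "\<And>i. k i \<in> kummer_base" "x = (\<Sum>i<5. k i * kummer_gen ^ i)"
        using kummer_decomposition[of x] by blast
      then show ?thesis using kummer_spanI by blast
    qed
    then show ?thesis by blast
  qed
  ultimately show ?thesis by (metis order_refl)
qed

text \<open>
  The image of t is a fifth root of t^5, that is, a conjugate of t, and it determines the embedding.
  The five conjugates come from \<open>norm_quadratic\<close> with vanishing leading coefficient.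
\<close>
lemma kummer_automorphism:
  fixes \<chi> :: "'a poly fract \<Rightarrow> 'a poly fract"
  assumes \<chi>: "ring_map \<chi>" and fixed: "\<And>x. x \<in> kummer_base \<Longrightarrow> \<chi> x = x"
  obtains j where "j < 5" "\<chi> = rotate (\<zeta> ^ j)"
proof -
  interpret \<chi>: ring_map \<chi> by (rule \<chi>)
  interpret c: ring_map "fract_const :: 'a \<Rightarrow> _" by (rule ring_map_fract_const)
  have fr: "ring_map (\<lambda>p :: 'a poly. Fract p 1)"
    by unfold_locales (simp_all add: One_fract_def)
  define y where "y = (kummer_gen :: 'a poly fract)"
  define z where "z = fract_const \<zeta>"
  have "y ^ 5 \<in> kummer_base"
  proof -
    have "y ^ 5 = Fract (fifth_power [:0, 1:]) (fifth_power 1)"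
      unfolding y_def kummer_gen_def ring_map.map_power[OF fr, symmetric] by (simp add: pcompose_pCons pcompose_1 monom_altdef)
    then show ?thesis
      unfolding kummer_base_def by (intro CollectI exI[of _ "[:0, 1:]"] exI[of _ 1]) simp
  qed
  then have "\<chi> y ^ 5 = y ^ 5" using fixed by (simp flip: \<chi>.map_power)
  moreover have z4: "z ^ 4 + z ^ 3 + z ^ 2 + z + 1 = 0"
    using arg_cong[OF zeta_sum, of fract_const] by (simp add: c.map_simps z_def)
  note norm_quadratic[OF this, of 0 y 1 "\<chi> y"]
  ultimately have "(\<chi> y - y) * (\<chi> y - z * y) * (\<chi> y - z ^ 2 * y) * (\<chi> y - z ^ 3 * y) * (\<chi> y - z ^ 4 * y) = 0"
    by simp
  then have "\<chi> y = z ^ 0 * y \<or> \<chi> y = z ^ 1 * y \<or> \<chi> y = z ^ 2 * y \<or> \<chi> y = z ^ 3 * y \<or> \<chi> y = z ^ 4 * y" by auto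
  then obtain j where j: "j < 5" "\<chi> y = z ^ j * y"
    by (elim disjE) (erule that[rotated]; simp)+
  have \<zeta>j: "\<zeta> ^ j \<noteq> 0" using zeta_nonzero by simp
  have poly: "\<chi> (Fract p 1) = rotate (\<zeta> ^ j) (Fract p 1)" for p
  proof (rule ring_map_poly_eqI[OF ring_map_comp[OF fr \<chi>] ring_map_comp[OF fr ring_map_rotate[OF \<zeta>j]]])
    show "\<chi> (Fract [:c:] 1) = rotate (\<zeta> ^ j) (Fract [:c:] 1)" for c
      using fixed[OF fract_const_in_kummer_base[of c]] rotate_gens(2)[OF \<zeta>j, of c] by (simp add: fract_const_def)
    show "\<chi> (Fract [:0, 1:] 1) = rotate (\<zeta> ^ j) (Fract [:0, 1:] 1)"
      using j(2) rotate_gens(1)[OF \<zeta>j] by (simp add: y_def kummer_gen_def z_def c.map_power)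
  qed
  have "\<chi> x = rotate (\<zeta> ^ j) x" for x
  proof -
    obtain p q where x: "x = Fract p q" "q \<noteq> 0" by (cases x) auto
    then have "x * Fract q 1 = Fract p 1" by (simp add: eq_fract)
    then have "\<chi> x * \<chi> (Fract q 1) = \<chi> (Fract p 1)"
      "rotate (\<zeta> ^ j) x * rotate (\<zeta> ^ j) (Fract q 1) = rotate (\<zeta> ^ j) (Fract p 1)"
      by (simp_all only: \<chi>.map_mult[symmetric] ring_map.map_mult[OF ring_map_rotate[OF \<zeta>j], symmetric])
    then have "\<chi> x * rotate (\<zeta> ^ j) (Fract q 1) = rotate (\<zeta> ^ j) x * rotate (\<zeta> ^ j) (Fract q 1)"
      unfolding poly by simp
    moreover have "rotate (\<zeta> ^ j) (Fract q 1) \<noteq> 0"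
      using x(2) \<zeta>j pcompose_scale_eq_0[OF \<zeta>j, of q]
      by (auto simp: rotate_Fract pcompose_1 Zero_fract_def eq_fract)
    ultimately show ?thesis by simp
  qed
  then have "\<chi> = rotate (\<zeta> ^ j)" by (rule ext)
  then show ?thesis using that j(1) by blast
qed

lemma rotate_inverse:
  assumes c: "c \<noteq> (0 :: 'a)"
  shows "rotate c (rotate (inverse c) x) = x"
proof -
  obtain p q where x: "x = Fract p q" "q \<noteq> 0" by (cases x) auto
  have "pcompose (pcompose r [:0, inverse c:]) [:0, c:] = r" for r
    using c by (simp add: pcompose_assoc[symmetric] pcompose_pCons pcompose_idR)
  moreover have "pcompose q [:0, inverse c:] \<noteq> 0" using x(2) c pcompose_scale_eq_0[of "inverse c" q] by auto
  ultimately show ?thesis using x c by (simp add: rotate_Fract)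
qed

text \<open>
  The results on k(t)/k(t^5) are transported to an extension L/K along an isomorphism \<Phi> from L to k(t)
  that maps K onto k(t^5).
\<close>
context
  fixes L :: "'b ring" and \<Phi> :: "'b \<Rightarrow> 'a poly fract" and K :: "'b set"
  assumes L: "ring L" and iso: "\<Phi> \<in> ring_iso L field_ring"
    and K: "K \<subseteq> carrier L" "\<Phi> ` K = kummer_base"
begin

lemma \<Phi>_hom:
  assumes "x \<in> carrier L" "y \<in> carrier L"
  shows "\<Phi> (x \<otimes>\<^bsub>L\<^esub> y) = \<Phi> x * \<Phi> y" "\<Phi> (x \<oplus>\<^bsub>L\<^esub> y) = \<Phi> x + \<Phi> y"
  using ring_iso_memE(2,3)[OF iso assms] by (simp_all add: field_ring_simps)

lemma \<Phi>_one: "\<Phi> \<one>\<^bsub>L\<^esub> = 1"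
  using ring_iso_memE(4)[OF iso] by (simp add: field_ring_simps)

lemma \<Phi>_bij: "bij_betw \<Phi> (carrier L) UNIV"
  using ring_iso_memE(5)[OF iso] by (simp add: field_ring_simps)

definition \<Psi> :: "'a poly fract \<Rightarrow> 'b" where
  "\<Psi> = inv_into (carrier L) \<Phi>"

lemma \<Psi>_carrier: "\<Psi> y \<in> carrier L"
  using \<Phi>_bij unfolding \<Psi>_def by (metis UNIV_I bij_betw_imp_surj_on inv_into_into)

lemma \<Phi>_\<Psi>: "\<Phi> (\<Psi> y) = y"
  using \<Phi>_bij unfolding \<Psi>_def by (metis UNIV_I bij_betw_inv_into_right)

lemma \<Psi>_\<Phi>: "x \<in> carrier L \<Longrightarrow> \<Psi> (\<Phi> x) = x"
  using \<Phi>_bij unfolding \<Psi>_def by (metis bij_betw_inv_into_left)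

lemma \<Phi>_inj: "x \<in> carrier L \<Longrightarrow> y \<in> carrier L \<Longrightarrow> \<Phi> x = \<Phi> y \<Longrightarrow> x = y"
  by (metis \<Psi>_\<Phi>)

lemma \<Psi>_iso: "\<Psi> \<in> ring_iso field_ring L"
  unfolding \<Psi>_def by (rule ring_iso_set_sym[OF L iso])

lemma \<Psi>_hom: "\<Psi> (x * y) = \<Psi> x \<otimes>\<^bsub>L\<^esub> \<Psi> y" "\<Psi> (x + y) = \<Psi> x \<oplus>\<^bsub>L\<^esub> \<Psi> y" "\<Psi> 1 = \<one>\<^bsub>L\<^esub>"
  using ring_iso_memE(2,3)[OF \<Psi>_iso, of x y] ring_iso_memE(4)[OF \<Psi>_iso] by (simp_all add: field_ring_simps)

lemma mem_K_iff: "x \<in> carrier L \<Longrightarrow> x \<in> K \<longleftrightarrow> \<Phi> x \<in> kummer_base"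
proof
  assume x: "x \<in> carrier L"
  show "\<Phi> x \<in> kummer_base" if "x \<in> K" using that K(2) by blast
  assume "\<Phi> x \<in> kummer_base"
  then obtain y where "y \<in> K" "\<Phi> x = \<Phi> y" using K(2) by blast
  then show "x \<in> K" using x K(1) \<Phi>_inj by blast
qed

lemma K_image: "K = \<Psi> ` kummer_base"
proof -
  have "\<Psi> ` \<Phi> ` K = (\<lambda>x. \<Psi> (\<Phi> x)) ` K" by (rule image_image)
  also have "\<dots> = (\<lambda>x. x) ` K" using K(1) \<Psi>_\<Phi> by (intro image_cong) auto
  finally show ?thesis using K(2) by simp
qed

lemma field_L: "field L"
proof -
  interpret F: field "field_ring :: 'a poly fract ring" by (rule field_field_ring)
  interpret h: ring_hom_ring "field_ring :: 'a poly fract ring" L \<Psi>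
    by (rule ring_hom_ringI2[OF F.ring_axioms L]) (use \<Psi>_iso in \<open>simp add: ring_iso_def\<close>)
  have "field (L \<lparr> zero := \<Psi> \<zero>\<^bsub>field_ring\<^esub> \<rparr>)" by (rule F.ring_iso_imp_img_field[OF \<Psi>_iso])
  then show ?thesis by simp
qed

lemma dimension_subfield_L:
  shows "ring.dimension L 5 K (carrier L)" and "subfield K L"
proof -
  interpret F: field "field_ring :: 'a poly fract ring" by (rule field_field_ring)
  interpret L: field L by (rule field_L)
  interpret h: ring_hom_ring "field_ring :: 'a poly fract ring" L \<Psi>
    by (rule ring_hom_ringI2[OF F.ring_axioms L]) (use \<Psi>_iso in \<open>simp add: ring_iso_def\<close>)
  have surj: "\<Psi> ` UNIV = carrier L"
    using bij_betw_imp_surj_on[OF ring_iso_memE(5)[OF \<Psi>_iso]] by (simp add: field_ring_simps)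
  have "inj_on \<Psi> UNIV" by (metis \<Phi>_\<Psi> injI)
  then show "ring.dimension L 5 K (carrier L)"
    using h.inj_hom_dimension[OF kummer_base_subfield L.one_not_zero _ kummer_dimension]
    unfolding K_image surj by simp
  show "subfield K L"
    unfolding K_image by (rule h.img_is_subfield(2)[OF kummer_base_subfield L.one_not_zero])
qed

lemma galois_extension_L: "galois_extension L K"
proof -
  interpret L: field L by (rule field_L)
  interpret r: ring_map "rotate \<zeta>" by (rule ring_map_rotate[OF zeta_nonzero])
  define \<sigma> where "\<sigma> = (\<lambda>x\<in>carrier L. \<Psi> (rotate \<zeta> (\<Phi> x)))"
  have \<sigma>: "\<sigma> x = \<Psi> (rotate \<zeta> (\<Phi> x))" if "x \<in> carrier L" for x using that by (simp add: \<sigma>_def)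
  have rot_inj: "rotate \<zeta> x = rotate \<zeta> y \<Longrightarrow> x = y" for x y
  proof -
    assume "rotate \<zeta> x = rotate \<zeta> y"
    then have "rotate \<zeta> (x - y) = 0" by (simp add: r.map_diff)
    moreover have "rotate \<zeta> (x - y) * rotate \<zeta> (inverse (x - y)) = 1" if "x \<noteq> y"
      using that by (simp add: r.map_mult[symmetric] r.map_one)
    ultimately show "x = y" by fastforce
  qed
  have "bij_betw \<sigma> (carrier L) (carrier L)"
  proof (rule bij_betwI')
    show "\<sigma> x = \<sigma> y \<longleftrightarrow> x = y" if "x \<in> carrier L" "y \<in> carrier L" for x y
      using that \<sigma> rot_inj \<Phi>_inj \<Phi>_\<Psi> by metis
    show "\<sigma> x \<in> carrier L" if "x \<in> carrier L" for x using that by (simp add: \<sigma> \<Psi>_carrier)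
    show "\<exists>x\<in>carrier L. y = \<sigma> x" if y: "y \<in> carrier L" for y
    proof (rule bexI)
      show "y = \<sigma> (\<Psi> (rotate (inverse \<zeta>) (\<Phi> y)))"
        by (simp add: \<sigma>[OF \<Psi>_carrier] \<Phi>_\<Psi> rotate_inverse[OF zeta_nonzero] \<Psi>_\<Phi>[OF y])
    qed (rule \<Psi>_carrier)
  qed
  then have "\<sigma> \<in> Bij (carrier L)" by (simp add: Bij_def \<sigma>_def)
  moreover have "\<sigma> \<in> ring_hom L L"
    by (rule ring_hom_memI)
       (simp_all add: \<sigma> \<Psi>_carrier \<Phi>_hom \<Psi>_hom r.map_mult r.map_add \<Phi>_one r.map_one)
  moreover have "\<sigma> x = x" if "x \<in> K" for x
  proof -
    have x: "x \<in> carrier L" "\<Phi> x \<in> kummer_base" using that K by auto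
    then have "rotate \<zeta> (\<Phi> x) = \<Phi> x" using rotate_fixed_iff by blast
    then show ?thesis using x(1) \<Psi>_\<Phi> by (simp add: \<sigma>)
  qed
  ultimately have gal: "\<sigma> \<in> carrier (galois_group L K)" by (simp add: galois_group_def)
  have "{x \<in> carrier L. \<forall>\<tau>\<in>carrier (galois_group L K). \<tau> x = x} = K"
  proof (intro equalityI subsetI)
    fix x assume "x \<in> {x \<in> carrier L. \<forall>\<tau>\<in>carrier (galois_group L K). \<tau> x = x}"
    then have x: "x \<in> carrier L" "\<sigma> x = x" using gal by auto
    then have "rotate \<zeta> (\<Phi> x) = \<Phi> x" using \<sigma> \<Phi>_\<Psi> by metis
    then show "x \<in> K" using x(1) mem_K_iff rotate_fixed_iff by blast
  next
    fix x assume "x \<in> K"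
    then show "x \<in> {x \<in> carrier L. \<forall>\<tau>\<in>carrier (galois_group L K). \<tau> x = x}"
      using K(1) by (auto simp: galois_group_def)
  qed
  moreover have "(L.algebraic over K) x" if "x \<in> carrier L" for x
  proof (rule L.finite_dimension_imp_algebraic)
    show "L.finite_dimension K (carrier L)"
      using dimension_subfield_L(1) L.finite_dimension_def by blast
  qed (use that dimension_subfield_L(2) L.carrier_is_subring in auto)
  ultimately show ?thesis
    using field_L dimension_subfield_L(2) by (simp add: galois_extension_def)
qed

lemma galois_group_rotation:
  assumes "\<sigma> \<in> carrier (galois_group L K)"
  obtains j where "j < 5" "\<And>x. x \<in> carrier L \<Longrightarrow> \<Phi> (\<sigma> x) = rotate (\<zeta> ^ j) (\<Phi> x)"
proof -
  have \<sigma>: "\<sigma> \<in> ring_hom L L" "\<And>x. x \<in> K \<Longrightarrow> \<sigma> x = x"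
    using assms by (auto simp: galois_group_def)
  note hom = ring_hom_memE[OF \<sigma>(1)]
  define \<chi> where "\<chi> y = \<Phi> (\<sigma> (\<Psi> y))" for y
  have "ring_map \<chi>"
    by unfold_locales (simp_all add: \<chi>_def \<Psi>_hom \<Psi>_carrier hom \<Phi>_hom \<Phi>_one)
  moreover have "\<chi> y = y" if "y \<in> kummer_base" for y
    using that \<sigma>(2)[of "\<Psi> y"] by (simp add: \<chi>_def K_image \<Phi>_\<Psi>)
  ultimately obtain j where "j < 5" "\<chi> = rotate (\<zeta> ^ j)" by (rule kummer_automorphism)
  moreover have "\<Phi> (\<sigma> x) = \<chi> (\<Phi> x)" if "x \<in> carrier L" for x
    using that by (simp add: \<chi>_def \<Psi>_\<Phi>)
  ultimately show ?thesis using that by metis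
qed

end

end

section \<open>The function field of the curve\<close>

lemma homogeneous3_subst2_YZ:
  assumes "homogeneous2 d a"
  shows "homogeneous3 d (subst2 const3 (Y3, Z3) a)"
  using assms
proof (induction rule: homogeneous2_induct)
  case (monomial c i j)
  have "homogeneous3 (0 + i * 1 + j * 1) (const3 c * Y3 ^ i * Z3 ^ j)"
    by (intro homogeneous3_mult homogeneous3_const homogeneous3_power homogeneous3_Y homogeneous3_Z)
  then show ?case
    using monomial by (simp only: ring_map.map_simps[OF ring_map_subst2[OF ring_map_const3]] subst2_gens[OF ring_map_const3]) simp
qed (simp_all add: ring_map.map_simps[OF ring_map_subst2[OF ring_map_const3]] homogeneous3_0 homogeneous3_add)

lemma on_curve_subst2_YZ:
  fixes a :: "'a::field bipoly"
  assumes a: "homogeneous2 d a"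
  shows "on_curve (subst2 const3 (Y3, Z3) a) = ([:0, 1:] ^ 2 + 1) ^ d * fifth_power (subst2 (\<lambda>c. [:c:]) ([:0, 1:], 1) a)"
proof -
  note cp = ring_map_const_poly[where 'a = 'a]
  let ?t = "[:0, 1:] :: 'a poly"
  define w where "w = ?t ^ 2 + 1"
  have "on_curve (subst2 const3 (Y3, Z3) a) = subst2 (\<lambda>c. [:c:]) (on_curve Y3, on_curve Z3) a"
    by (subst ring_map_subst2_comp[OF ring_map_on_curve ring_map_const3]) (simp only: on_curve_gens)
  also have "\<dots> = w ^ d * subst2 (\<lambda>c. [:c:]) (?t ^ 5, 1) a"
  proof -
    interpret s: ring_map "subst2 (\<lambda>c. [:c:]) (?t ^ 5, 1 :: 'a poly)" by (rule ring_map_subst2[OF cp])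
    interpret s': ring_map "subst2 (\<lambda>c. [:c:]) (?t ^ 5 * w, w)" by (rule ring_map_subst2[OF cp])
    show ?thesis unfolding on_curve_gens w_def[symmetric] using a
    proof (induction rule: homogeneous2_induct)
      case (monomial c i j)
      have "([:c:] * (?t ^ 5 * w) ^ i) * w ^ j = w ^ (i + j) * ([:c:] * (?t ^ 5) ^ i * 1 ^ j)"
        unfolding power_mult_distrib power_add power_one by (simp only: mult_ac mult_1_left mult_1_right)
      then show ?case
        using monomial by (simp only: s.map_simps s'.map_simps subst2_gens[OF cp])
    qed (simp_all only: s.map_simps s'.map_simps distrib_left mult_zero_right)
  qed
  also have "subst2 (\<lambda>c. [:c:]) (?t ^ 5, 1) a = fifth_power (subst2 (\<lambda>c. [:c:]) (?t, 1) a)"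
    by (subst ring_map_subst2_comp[OF ring_map_pcompose cp]) (simp add: pcompose_pCons pcompose_1 monom_altdef)
  finally show ?thesis unfolding w_def .
qed

lemma binary_form_homogeneous3:
  assumes a: "homogeneous3 m a" and b: "homogeneous3 m b"
  shows "homogeneous3 (n * m) (binary_form const3 n q a b)"
  unfolding binary_form_def
proof (rule homogeneous3_sum)
  fix i assume "i \<in> {..n}"
  then have e: "n * m = 0 + i * m + (n - i) * m" by (simp add: add_mult_distrib[symmetric])
  show "homogeneous3 (n * m) (const3 (coeff q i) * b ^ i * a ^ (n - i))"
    unfolding e by (intro homogeneous3_mult homogeneous3_const homogeneous3_power a b)
qed

lemma homogeneous2_binary_form: "homogeneous2 n (binary_form const2 n q V2 U2)"
proof -
  have "homogeneous2 n (const2 c * U2 ^ i * V2 ^ (n - i))" if "i \<le> n" for c :: 'a and i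
  proof -
    have "const2 c * U2 ^ i * V2 ^ (n - i) = monom (monom c i) (n - i)"
      by (simp add: U2_def V2_def monom_altdef ring_map.map_power[OF ring_map_const_poly, symmetric])
    then show ?thesis using that by (simp add: homogeneous2_def)
  qed
  then show ?thesis
    unfolding binary_form_def
    by (intro sum_closed[of "homogeneous2 n"]) (auto simp: homogeneous2_def, metis add_0)
qed

lemma ring_map_binary_form:
  assumes "ring_map \<psi>"
  shows "\<psi> (binary_form h n q a b) = binary_form (\<lambda>c. \<psi> (h c)) n q (\<psi> a) (\<psi> b)"
  by (simp add: binary_form_def ring_map.map_sum[OF assms] ring_map.map_mult[OF assms] ring_map.map_power[OF assms])

lemma binary_form_const_poly:
  assumes "degree q \<le> n"
  shows "binary_form (\<lambda>c. [:c:]) n q a ([:0, 1:] * a) = a ^ n * q"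
proof -
  have "binary_form (\<lambda>c. [:c:]) n q a ([:0, 1:] * a) = (\<Sum>i\<le>n. a ^ n * ([:coeff q i:] * [:0, 1:] ^ i))"
    unfolding binary_form_def
  proof (rule sum.cong)
    fix i assume "i \<in> {..n}"
    then have "a ^ n = a ^ i * a ^ (n - i)" by (simp add: power_add[symmetric])
    then show "[:coeff q i:] * ([:0, 1:] * a) ^ i * a ^ (n - i) = a ^ n * ([:coeff q i:] * [:0, 1:] ^ i)"
      by (simp only: power_mult_distrib mult_ac)
  qed simp
  also have "\<dots> = a ^ n * (\<Sum>i\<le>n. [:coeff q i:] * [:0, 1:] ^ i)" by (rule sum_distrib_left[symmetric])
  also have "(\<Sum>i\<le>n. [:coeff q i:] * [:0, 1:] ^ i) = (\<Sum>i\<le>degree q. [:coeff q i:] * [:0, 1:] ^ i)"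
    using assms by (intro sum.mono_neutral_right) (auto simp: coeff_eq_0)
  also have "\<dots> = q" by (rule poly_as_sum_of_powers)
  finally show ?thesis .
qed

text \<open>
  The forms N and D come from reducing the relation t^5 = Y/Z modulo (X + Y) t^2 - Z t + X = 0.  This
  leaves a linear equation D t = N.
\<close>
lemma inverse_of_parametrization:
  obtains N D :: "'a::field tripoly" where "homogeneous3 5 N" "homogeneous3 5 D" "on_curve D \<noteq> 0"
    "on_curve N = [:0, 1:] * on_curve D"
proof -
  define D :: "'a tripoly" where "D = Z3 * (Z3 ^ 4 - const3 3 * (X3 * (X3 + Y3)) * Z3 ^ 2 + X3 ^ 2 * (X3 + Y3) ^ 2)"
  define N :: "'a tripoly" where "N = Y3 * (X3 + Y3) ^ 4 + X3 * Z3 ^ 2 * (Z3 ^ 2 - const3 2 * (X3 * (X3 + Y3)))"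
  have h: "homogeneous3 1 (X3 :: 'a tripoly)" "homogeneous3 1 (Y3 :: 'a tripoly)" "homogeneous3 1 (Z3 :: 'a tripoly)"
    by (rule homogeneous3_X homogeneous3_Y homogeneous3_Z)+
  have m: "homogeneous3 n (p * q)" if "homogeneous3 d p" "homogeneous3 e q" "n = d + e"
    for n d e and p q :: "'a tripoly" using homogeneous3_mult[OF that(1,2)] that(3) by simp
  have pow: "homogeneous3 n (p ^ n)" if "homogeneous3 1 p" for n and p :: "'a tripoly"
    using homogeneous3_power[OF that, of n] by simp
  have XY: "homogeneous3 1 (X3 + Y3 :: 'a tripoly)" by (intro homogeneous3_add h)
  have XXY: "homogeneous3 2 (const3 c * (X3 * (X3 + Y3)) :: 'a tripoly)" for c
    by (rule m[OF homogeneous3_const m[OF h(1) XY refl]]) simp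
  have "homogeneous3 5 D"
    unfolding D_def
  proof (rule m[OF h(3)])
    show "homogeneous3 4 (Z3 ^ 4 - const3 3 * (X3 * (X3 + Y3)) * Z3 ^ 2 + X3 ^ 2 * (X3 + Y3) ^ 2 :: 'a tripoly)"
      by (intro homogeneous3_add homogeneous3_diff pow h m[OF XXY pow[OF h(3)]] m[OF pow[OF h(1)] pow[OF XY]])
         simp_all
  qed simp
  moreover have "homogeneous3 5 N"
    unfolding N_def
  proof (rule homogeneous3_add)
    show "homogeneous3 5 (Y3 * (X3 + Y3) ^ 4 :: 'a tripoly)"
      by (rule m[OF h(2) pow[OF XY]]) simp
    show "homogeneous3 5 (X3 * Z3 ^ 2 * (Z3 ^ 2 - const3 2 * (X3 * (X3 + Y3))) :: 'a tripoly)"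
      by (rule m[OF m[OF h(1) pow[OF h(3)] refl] homogeneous3_diff[OF pow[OF h(3)] XXY]]) simp
  qed
  moreover have "on_curve N = [:0, 1:] * on_curve D"
  proof -
    have e: "const3 (numeral n) = (numeral n :: 'a tripoly)" for n
      by (rule ring_map.map_numeral[OF ring_map_const3])
    have "(t ^ 5 * (t ^ 2 + 1)) * ((t - t ^ 7) + t ^ 5 * (t ^ 2 + 1)) ^ 4
       + (t - t ^ 7) * (t ^ 2 + 1) ^ 2 * ((t ^ 2 + 1) ^ 2 - 2 * ((t - t ^ 7) * ((t - t ^ 7) + t ^ 5 * (t ^ 2 + 1))))
      = t * ((t ^ 2 + 1) * ((t ^ 2 + 1) ^ 4 - 3 * ((t - t ^ 7) * ((t - t ^ 7) + t ^ 5 * (t ^ 2 + 1))) * (t ^ 2 + 1) ^ 2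
          + (t - t ^ 7) ^ 2 * ((t - t ^ 7) + t ^ 5 * (t ^ 2 + 1)) ^ 2))" for t :: "'a poly"
      by Groebner_Basis.algebra
    from this[of "[:0, 1:]"] show ?thesis
      unfolding N_def D_def e ring_map.map_simps[OF ring_map_on_curve] on_curve_gens .
  qed
  moreover have "on_curve D \<noteq> 0"
  proof -
    interpret ev: ring_map "\<lambda>p :: 'a poly. poly p 0" by (rule ring_map_poly)
    have "poly (on_curve D) 0 = 1"
      unfolding D_def ring_map.map_simps[OF ring_map_on_curve] on_curve_gens ev.map_simps by simp
    then show ?thesis by auto
  qed
  ultimately show ?thesis using that[of N D] by simp
qed

definition is_fraction :: "'a::field tripoly \<Rightarrow> 'a tripoly \<Rightarrow> bool" where
  "is_fraction A B \<longleftrightarrow> (\<exists>d. homogeneous3 d A \<and> homogeneous3 d B) \<and> B \<notin> curve_C"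

text \<open>
  Restriction to the curve, followed by pullback along the parametrization.
\<close>
definition restrict_fraction :: "'a::field tripoly fract \<Rightarrow> 'a poly fract" where
  "restrict_fraction = fract_map is_fraction on_curve"

context curve_field begin

lemma is_fraction_denominator:
  fixes B :: "'a tripoly"
  assumes "is_fraction A B"
  shows "B \<noteq> 0 \<and> on_curve B \<noteq> 0"
  using assms on_curve_eq_0_iff ring_map.map_zero[OF ring_map_on_curve[where 'a = 'a]]
  by (auto simp: is_fraction_def)

lemma is_fractionI:
  fixes A B :: "'a tripoly"
  shows "homogeneous3 d A \<Longrightarrow> homogeneous3 d B \<Longrightarrow> on_curve B \<noteq> 0 \<Longrightarrow> is_fraction A B"
  using on_curve_eq_0_iff by (auto simp: is_fraction_def)

lemma restrict_fraction_Fract: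
  fixes A B :: "'a tripoly"
  shows "is_fraction A B \<Longrightarrow> restrict_fraction (Fract A B) = Fract (on_curve A) (on_curve B)"
  unfolding restrict_fraction_def
  by (rule fract_map_Fract[OF ring_map_on_curve]) (use is_fraction_denominator in auto)

lemma is_fraction_arith:
  fixes A B A' B' :: "'a tripoly"
  assumes "is_fraction A B" "is_fraction A' B'"
  shows "is_fraction (A * A') (B * B')" "is_fraction (A * B' + A' * B) (B * B')" "is_fraction (- A) B"
proof -
  obtain d where d: "homogeneous3 d A" "homogeneous3 d B" using assms by (auto simp: is_fraction_def)
  obtain e where e: "homogeneous3 e A'" "homogeneous3 e B'" using assms by (auto simp: is_fraction_def)
  have nz: "on_curve (B * B') \<noteq> 0" "on_curve B \<noteq> 0"
    using assms is_fraction_denominator by (auto simp: ring_map.map_mult[OF ring_map_on_curve])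
  show "is_fraction (A * A') (B * B')"
    by (rule is_fractionI[OF homogeneous3_mult[OF d(1) e(1)] homogeneous3_mult[OF d(2) e(2)] nz(1)])
  show "is_fraction (A * B' + A' * B) (B * B')"
    by (rule is_fractionI[OF homogeneous3_add[OF homogeneous3_mult[OF d(1) e(2)]]
          homogeneous3_mult[OF d(2) e(2)] nz(1)])
       (use homogeneous3_mult[OF e(1) d(2)] in \<open>simp add: add.commute\<close>)
  show "is_fraction (- A) B" by (rule is_fractionI[OF homogeneous3_minus[OF d(1)] d(2) nz(2)])
qed

lemma is_fraction_one: "is_fraction 1 (1 :: 'a tripoly)" "is_fraction 0 (1 :: 'a tripoly)"
proof -
  have "homogeneous3 0 (1 :: 'a tripoly)" using homogeneous3_const[of "1 :: 'a"] by (simp add: one_pCons)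
  then show "is_fraction 1 (1 :: 'a tripoly)" "is_fraction 0 (1 :: 'a tripoly)"
    by (auto intro!: is_fractionI homogeneous3_0 simp: ring_map.map_one[OF ring_map_on_curve])
qed

abbreviation "C_local \<equiv> (generic_local_ring curve_C :: 'a tripoly fract ring)"

lemma C_local_simps:
  "x \<otimes>\<^bsub>C_local\<^esub> y = x * y" "\<one>\<^bsub>C_local\<^esub> = 1" "\<zero>\<^bsub>C_local\<^esub> = 0" "x \<oplus>\<^bsub>C_local\<^esub> y = x + y"
  by (simp_all add: generic_local_ring_def)

lemma C_local_carrier: "carrier C_local = {Fract A B | A B. is_fraction A B}"
  by (auto simp: generic_local_ring_def is_fraction_def)

lemma C_local_closed:
  assumes "x \<in> carrier C_local" "y \<in> carrier C_local"
  shows "x + y \<in> carrier C_local" "x * y \<in> carrier C_local" "- x \<in> carrier C_local"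
proof -
  obtain A B A' B' where x: "x = Fract A B" "is_fraction A B" and y: "y = Fract A' B'" "is_fraction A' B'"
    using assms by (auto simp: C_local_carrier)
  note nz = is_fraction_denominator[OF x(2)] is_fraction_denominator[OF y(2)]
  note cl = is_fraction_arith[OF x(2) y(2)]
  show "x + y \<in> carrier C_local" using cl(2) nz by (auto simp: x(1) y(1) C_local_carrier)
  show "x * y \<in> carrier C_local" using cl(1) nz by (auto simp: x(1) y(1) C_local_carrier)
  show "- x \<in> carrier C_local" using cl(3) nz by (auto simp: x(1) C_local_carrier)
qed

lemma cring_C_local: "cring C_local"
proof (rule cringI)
  have zero: "0 \<in> carrier C_local" and one: "1 \<in> carrier C_local"
    using is_fraction_one by (auto simp: C_local_carrier Zero_fract_def One_fract_def)
  show "abelian_group C_local"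
  proof (rule abelian_groupI)
    show "\<exists>y\<in>carrier C_local. y \<oplus>\<^bsub>C_local\<^esub> x = \<zero>\<^bsub>C_local\<^esub>" if "x \<in> carrier C_local" for x
      using C_local_closed(3)[OF that that] by (intro bexI[of _ "- x"]) (simp_all add: C_local_simps)
  qed (auto simp: C_local_simps zero add_ac intro: C_local_closed)
  show "comm_monoid C_local"
    by (rule comm_monoidI) (auto simp: C_local_simps one mult_ac intro: C_local_closed)
qed (simp add: C_local_simps distrib_right)

lemma ring_hom_restrict_fraction: "ring_hom_ring C_local field_ring restrict_fraction"
proof (rule ring_hom_ringI)
  show "ring C_local" using cring_C_local by (simp add: cring_def)
  show "ring (field_ring :: 'a poly fract ring)" by (rule field.is_ring[OF field_field_ring])
  show "restrict_fraction \<one>\<^bsub>C_local\<^esub> = \<one>\<^bsub>field_ring\<^esub>"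
    using restrict_fraction_Fract[OF is_fraction_one(1)]
    by (simp add: C_local_simps field_ring_simps One_fract_def ring_map.map_one[OF ring_map_on_curve])
  fix x y assume "x \<in> carrier C_local" "y \<in> carrier C_local"
  then obtain A B A' B' where x: "x = Fract A B" "is_fraction A B" and y: "y = Fract A' B'" "is_fraction A' B'"
    by (auto simp: C_local_carrier)
  note nz = is_fraction_denominator[OF x(2)] is_fraction_denominator[OF y(2)]
  note cl = is_fraction_arith[OF x(2) y(2)]
  note simps = restrict_fraction_Fract[OF x(2)] restrict_fraction_Fract[OF y(2)]
    restrict_fraction_Fract[OF cl(1)] restrict_fraction_Fract[OF cl(2)] ring_map.map_simps[OF ring_map_on_curve]
  show "restrict_fraction (x \<otimes>\<^bsub>C_local\<^esub> y) = restrict_fraction x \<otimes>\<^bsub>field_ring\<^esub> restrict_fraction y"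
    using nz by (simp add: x(1) y(1) C_local_simps field_ring_simps simps)
  show "restrict_fraction (x \<oplus>\<^bsub>C_local\<^esub> y) = restrict_fraction x \<oplus>\<^bsub>field_ring\<^esub> restrict_fraction y"
    using nz by (simp add: x(1) y(1) C_local_simps field_ring_simps simps)
qed (simp add: field_ring_simps)

text \<open>
  A fraction p(t)/q(t) is the restriction of p(N/D)/q(N/D), made into a quotient of forms.
\<close>
lemma restrict_fraction_surj: "restrict_fraction ` carrier C_local = carrier field_ring"
proof -
  have "\<exists>z\<in>carrier C_local. x = restrict_fraction z" for x :: "'a poly fract"
  proof -
    obtain p q where x: "x = Fract p q" "q \<noteq> 0" by (cases x) auto
    obtain N D :: "'a tripoly" where ND: "homogeneous3 5 N" "homogeneous3 5 D" "on_curve D \<noteq> 0"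
      "on_curve N = [:0, 1:] * on_curve D" by (rule inverse_of_parametrization)
    define n where "n = max (degree p) (degree q)"
    define A where "A r = binary_form const3 n r D N" for r
    have hom: "homogeneous3 (n * 5) (A r)" for r unfolding A_def by (rule binary_form_homogeneous3[OF ND(2,1)])
    have on: "on_curve (A r) = on_curve D ^ n * r" if "degree r \<le> n" for r
      unfolding A_def ring_map_binary_form[OF ring_map_on_curve] ND(4) on_curve_gens
      by (rule binary_form_const_poly[OF that])
    have "degree p \<le> n" "degree q \<le> n" by (simp_all add: n_def)
    note on = on[OF this(1)] on[OF this(2)]
    have "on_curve (A q) \<noteq> 0" using on(2) ND(3) x(2) by simp
    then have frac: "is_fraction (A p) (A q)" by (rule is_fractionI[OF hom hom])
    then have "restrict_fraction (Fract (A p) (A q)) = Fract (on_curve D ^ n * p) (on_curve D ^ n * q)"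
      by (simp add: restrict_fraction_Fract on)
    also have "\<dots> = x" using ND(3) x by (simp add: eq_fract)
    finally show ?thesis using frac C_local_carrier by blast
  qed
  then show ?thesis by (auto simp: field_ring_simps)
qed

lemma a_kernel_restrict_fraction: "a_kernel C_local field_ring restrict_fraction = generic_maximal_ideal curve_C"
proof -
  have "x \<in> a_kernel C_local field_ring restrict_fraction \<longleftrightarrow> (\<exists>A B. x = Fract A B \<and> is_fraction A B \<and> A \<in> curve_C)" for x
  proof -
    have "restrict_fraction (Fract A B) = 0 \<longleftrightarrow> A \<in> curve_C" if AB: "is_fraction A B" for A B :: "'a tripoly"
    proof -
      obtain d where "homogeneous3 d A" using AB by (auto simp: is_fraction_def)
      then show ?thesis
        using is_fraction_denominator[OF AB] on_curve_eq_0_iff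
        by (simp add: restrict_fraction_Fract[OF AB] Zero_fract_def eq_fract)
    qed
    then show ?thesis unfolding a_kernel_def' C_local_carrier field_ring_simps by auto
  qed
  then show ?thesis unfolding generic_maximal_ideal_def is_fraction_def by blast
qed

definition evaluate_on_curve :: "'a tripoly fract set \<Rightarrow> 'a poly fract" where
  "evaluate_on_curve X' = the_elem (restrict_fraction ` X')"

lemma function_field_iso: "evaluate_on_curve \<in> ring_iso (function_field curve_C) field_ring"
  using ring_hom_ring.FactRing_iso_set[OF ring_hom_restrict_fraction restrict_fraction_surj]
  unfolding a_kernel_restrict_fraction function_field_def evaluate_on_curve_def .

lemma evaluate_rational_function:
  assumes "is_fraction A B"
  shows "evaluate_on_curve (rational_function curve_C A B) = Fract (on_curve A) (on_curve B)"
    and "rational_function curve_C A B \<in> carrier (function_field curve_C)"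
proof -
  interpret h: ring_hom_ring C_local field_ring restrict_fraction by (rule ring_hom_restrict_fraction)
  have c: "Fract A B \<in> carrier C_local" using assms C_local_carrier by blast
  show "evaluate_on_curve (rational_function curve_C A B) = Fract (on_curve A) (on_curve B)"
    using h.the_elem_simp[OF c]
    unfolding a_kernel_restrict_fraction rational_function_def evaluate_on_curve_def restrict_fraction_Fract[OF assms] .
  show "rational_function curve_C A B \<in> carrier (function_field curve_C)"
    using c unfolding rational_function_def function_field_def FactRing_simps by (auto simp: a_r_coset_def)
qed

lemma ring_function_field: "ring (function_field (curve_C :: 'a tripoly set))"
proof -
  interpret h: ring_hom_ring C_local field_ring restrict_fraction by (rule ring_hom_restrict_fraction)
  show ?thesis
    using ideal.quotient_is_ring[OF h.kernel_is_ideal]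
    unfolding a_kernel_restrict_fraction function_field_def .
qed

lemma projection_fraction:
  fixes a b :: "'a bipoly"
  assumes "homogeneous2 d a" "homogeneous2 d b" "subst2 const3 (Y3, Z3) b \<notin> curve_C"
  shows "is_fraction (subst2 const3 (Y3, Z3) a) (subst2 const3 (Y3, Z3) b)"
  using assms homogeneous3_subst2_YZ by (auto simp: is_fraction_def)

text \<open>
  On the curve Y/Z is t^5, and every rational function of Y/Z is a quotient of binary forms.
\<close>
lemma projection_subfield_image:
  "projection_subfield (curve_C :: 'a tripoly set) \<subseteq> carrier (function_field curve_C)"
  "evaluate_on_curve ` projection_subfield curve_C = kummer_base"
proof -
  show "projection_subfield (curve_C :: 'a tripoly set) \<subseteq> carrier (function_field curve_C)"
    using projection_fraction evaluate_rational_function(2) by (auto simp: projection_subfield_def)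
  show "evaluate_on_curve ` projection_subfield curve_C = kummer_base"
  proof (intro equalityI subsetI)
    fix x assume "x \<in> evaluate_on_curve ` projection_subfield curve_C"
    then obtain a b d where ab: "homogeneous2 d a" "homogeneous2 d b" "subst2 const3 (Y3, Z3) b \<notin> curve_C"
      and x: "x = evaluate_on_curve (rational_function curve_C (subst2 const3 (Y3, Z3) a) (subst2 const3 (Y3, Z3) b))"
      by (auto simp: projection_subfield_def)
    note frac = projection_fraction[OF ab]
    let ?w = "[:0, 1:] ^ 2 + 1 :: 'a poly" and ?e = "subst2 (\<lambda>c. [:c:]) ([:0, 1:], 1) :: 'a bipoly \<Rightarrow> 'a poly"
    have "on_curve (subst2 const3 (Y3, Z3) b) \<noteq> 0" using is_fraction_denominator[OF frac] by blast
    then have nz: "?w ^ d \<noteq> 0" "fifth_power (?e b) \<noteq> 0" unfolding on_curve_subst2_YZ[OF ab(2)] by auto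
    have "x = Fract (fifth_power (?e a)) (fifth_power (?e b))"
      unfolding x evaluate_rational_function(1)[OF frac] on_curve_subst2_YZ[OF ab(1)] on_curve_subst2_YZ[OF ab(2)]
      using nz by (simp add: eq_fract del: power_eq_0_iff)
    moreover have "?e b \<noteq> 0" using nz(2) by auto
    ultimately show "x \<in> kummer_base" unfolding kummer_base_def by blast
  next
    fix x :: "'a poly fract" assume "x \<in> kummer_base"
    then obtain p q where x: "x = Fract (fifth_power p) (fifth_power q)" "q \<noteq> 0" by (auto simp: kummer_base_def)
    define n where "n = max (degree p) (degree q)"
    define A where "A r = binary_form const2 n r V2 U2" for r :: "'a poly"
    have hom: "homogeneous2 n (A r)" for r unfolding A_def by (rule homogeneous2_binary_form)
    have e: "subst2 (\<lambda>c. [:c:]) ([:0, 1:], 1) (A r) = r" if "degree r \<le> n" for r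
      unfolding A_def ring_map_binary_form[OF ring_map_subst2[OF ring_map_const_poly]] subst2_gens[OF ring_map_const_poly]
      using binary_form_const_poly[OF that, of 1] by simp
    have deg: "degree p \<le> n" "degree q \<le> n" by (simp_all add: n_def)
    let ?w = "[:0, 1:] ^ 2 + 1 :: 'a poly"
    have w: "?w \<noteq> 0" using on_curve_Z3_nonzero unfolding on_curve_gens .
    have on: "on_curve (subst2 const3 (Y3, Z3) (A r)) = ?w ^ n * fifth_power r" if "degree r \<le> n" for r
      unfolding on_curve_subst2_YZ[OF hom] e[OF that] ..
    have nz: "fifth_power q \<noteq> 0" using x(2) fifth_power_eq_0 by blast
    then have "on_curve (subst2 const3 (Y3, Z3) (A q)) \<noteq> 0" unfolding on[OF deg(2)] using w by simp
    then have notin: "subst2 const3 (Y3, Z3) (A q) \<notin> curve_C"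
      using on_curve_eq_0_iff[OF homogeneous3_subst2_YZ[OF hom]] by blast
    have "?w ^ n * fifth_power q \<noteq> 0" using nz w by simp
    then have "x = Fract (?w ^ n * fifth_power p) (?w ^ n * fifth_power q)"
      unfolding x(1) using nz by (subst eq_fract(1)) (simp_all only: mult_ac not_False_eq_True)
    also have "\<dots> = evaluate_on_curve (rational_function curve_C (subst2 const3 (Y3, Z3) (A p)) (subst2 const3 (Y3, Z3) (A q)))"
      unfolding evaluate_rational_function(1)[OF projection_fraction[OF hom hom notin]] on[OF deg(1)] on[OF deg(2)] ..
    finally have "x = evaluate_on_curve (rational_function curve_C (subst2 const3 (Y3, Z3) (A p)) (subst2 const3 (Y3, Z3) (A q)))" .
    then show "x \<in> evaluate_on_curve ` projection_subfield curve_C"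
      unfolding projection_subfield_def using hom notin by blast
  qed
qed

end

section \<open>Passage to the algebraic closure\<close>

text \<open>
  The points to which curves are contracted are found as roots of polynomials.  So the triples of
  forms are extended to the algebraic closure before \<open>cremona_rotation_trivial\<close> is applied.
\<close>
instance alg_closure :: (field) field_gcd ..

definition extend_scalars :: "'a::field tripoly \<Rightarrow> 'a alg_closure tripoly" where
  "extend_scalars = subst3 (\<lambda>c. const3 (to_ac c)) (X3, Y3, Z3)"

lemma ring_map_to_ac: "ring_map (to_ac :: 'a::field \<Rightarrow> _)"
  by unfold_locales simp_all

lemma ring_map_const3_to_ac: "ring_map (\<lambda>c::'a::field. const3 (to_ac c))"
  by (rule ring_map_comp[OF ring_map_to_ac ring_map_const3])

lemma ring_map_extend_scalars: "ring_map extend_scalars"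
  unfolding extend_scalars_def by (intro ring_map_subst3 ring_map_const3_to_ac)

lemma extend_scalars_gens:
  "extend_scalars (const3 c) = const3 (to_ac c)" "extend_scalars X3 = X3"
  "extend_scalars Y3 = Y3" "extend_scalars Z3 = Z3"
  unfolding extend_scalars_def by (rule subst3_gens[OF ring_map_const3_to_ac])+

lemma coeff_extend_scalars:
  "coeff (coeff (coeff (extend_scalars p) l) j) i = to_ac (coeff (coeff (coeff p l) j) i)"
proof (induction p rule: tripoly_induct)
  case (3 c i' j' l')
  have "extend_scalars (const3 c * X3 ^ i' * Y3 ^ j' * Z3 ^ l') = const3 (to_ac c) * X3 ^ i' * Y3 ^ j' * Z3 ^ l'"
    by (simp only: ring_map.map_simps[OF ring_map_extend_scalars] extend_scalars_gens)
  then show ?case by (simp only: coeff_monomial3) simp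
qed (simp_all add: ring_map.map_simps[OF ring_map_extend_scalars])

lemma extend_scalars_eq_0_iff: "extend_scalars p = 0 \<longleftrightarrow> p = 0"
  by (simp add: poly_eq_iff coeff_extend_scalars)

lemma homogeneous3_extend_scalars: "homogeneous3 d p \<Longrightarrow> homogeneous3 d (extend_scalars p)"
  by (simp add: homogeneous3_def coeff_extend_scalars)

lemma extend_scalars_subst3:
  "extend_scalars (subst3 const3 (a, b, c) G) = subst3 const3 (extend_scalars a, extend_scalars b, extend_scalars c) (extend_scalars G)"
proof -
  note s = ring_map_subst3[OF ring_map_const3]
  have G: "extend_scalars G = subst3 (\<lambda>c. const3 (to_ac c)) (X3, Y3, Z3) G" by (simp add: extend_scalars_def)
  have "subst3 const3 (extend_scalars a, extend_scalars b, extend_scalars c) (extend_scalars G)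
    = subst3 (\<lambda>c. const3 (to_ac c)) (extend_scalars a, extend_scalars b, extend_scalars c) G"
    unfolding G
    by (subst ring_map_subst3_comp[OF s ring_map_const3_to_ac]) (simp only: subst3_gens[OF ring_map_const3])
  also have "\<dots> = extend_scalars (subst3 const3 (a, b, c) G)"
    by (subst ring_map_subst3_comp[OF ring_map_extend_scalars ring_map_const3]) (simp only: extend_scalars_gens)
  finally show ?thesis ..
qed

lemma ring_map_map_poly_to_ac: "ring_map (map_poly (to_ac :: 'a::field \<Rightarrow> _))"
  by unfold_locales
     (auto intro!: poly_eqI simp: coeff_map_poly coeff_mult to_ac_sum)

lemma on_curve_extend_scalars: "on_curve (extend_scalars p) = map_poly to_ac (on_curve p)"
proof -
  interpret m: ring_map "map_poly (to_ac :: 'a \<Rightarrow> _)" by (rule ring_map_map_poly_to_ac)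
  interpret t: ring_map "to_ac :: 'a \<Rightarrow> _" by (rule ring_map_to_ac)
  have x: "map_poly to_ac [:0, 1 :: 'a:] = [:0, 1:]" by (simp only: t.map_poly_pCons) simp
  show ?thesis
  proof (rule ring_map_tripoly_eqI[OF ring_map_comp[OF ring_map_extend_scalars ring_map_on_curve]
        ring_map_comp[OF ring_map_on_curve ring_map_map_poly_to_ac]])
    show "on_curve (extend_scalars (const3 c)) = map_poly to_ac (on_curve (const3 c))" for c :: 'a
      unfolding extend_scalars_gens on_curve_gens by (simp only: t.map_poly_pCons) simp
  qed (simp_all only: extend_scalars_gens on_curve_gens m.map_simps x)
qed

lemma map_poly_to_ac_pcompose:
  "map_poly to_ac (pcompose p [:0, c:]) = pcompose (map_poly to_ac p) [:0, to_ac c:]"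
  by (rule poly_eqI) (simp add: coeff_map_poly coeff_pcompose_linear)

lemma restricts_to_rotation_extend_scalars:
  assumes "restricts_to_rotation \<eta> (f0, f1, f2)"
  shows "restricts_to_rotation (to_ac \<eta>) (extend_scalars f0, extend_scalars f1, extend_scalars f2)"
proof -
  interpret m: ring_map "map_poly (to_ac :: 'a \<Rightarrow> _)" by (rule ring_map_map_poly_to_ac)
  have gen: "pcompose (on_curve Z3) [:0, to_ac \<eta>:] = map_poly to_ac (pcompose (on_curve Z3) [:0, \<eta>:])"
    "pcompose (on_curve X3) [:0, to_ac \<eta>:] = map_poly to_ac (pcompose (on_curve X3) [:0, \<eta>:])"
    "pcompose (on_curve Y3) [:0, to_ac \<eta>:] = map_poly to_ac (pcompose (on_curve Y3) [:0, \<eta>:])"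
    unfolding map_poly_to_ac_pcompose on_curve_extend_scalars[symmetric] extend_scalars_gens by (rule refl)+
  have "map_poly to_ac (on_curve f2) \<noteq> 0"
    using assms by (auto simp: restricts_to_rotation_def poly_eq_iff coeff_map_poly)
  then show ?thesis
    using assms unfolding restricts_to_rotation_def prod.case gen on_curve_extend_scalars m.map_mult[symmetric] by simp
qed

lemma curve_field_to_ac:
  assumes "curve_field \<zeta>"
  shows "curve_field (to_ac \<zeta>)"
proof -
  interpret curve_field \<zeta> by fact
  show ?thesis
  proof
    show "(2 :: 'a alg_closure) \<noteq> 0" using two to_ac_eq_0_iff[of "2 :: 'a"] by simp
    show "to_ac \<zeta> ^ 5 = 1" using root by (simp flip: to_ac_power)
    show "to_ac \<zeta> ^ m \<noteq> 1" if "0 < m" "m < 5" for m using primitive[OF that] by (simp flip: to_ac_power)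
  qed
qed

section \<open>Galois automorphisms that extend to the plane\<close>

context curve_field begin

abbreviation "C_field \<equiv> function_field (curve_C :: 'a tripoly set)"
abbreviation "C_base \<equiv> projection_subfield (curve_C :: 'a tripoly set)"

lemma identity_extends: "extends_to_Bir_plane (curve_C :: 'a tripoly set) (\<lambda>x\<in>carrier C_field. x)"
proof -
  have id: "subst3 const3 (X3, Y3, Z3) G = G" for G :: "'a tripoly" by (rule subst3_variables)
  have bir: "birational_self_map I (X3, Y3, Z3)" if I: "0 \<in> I" "Z3 \<notin> I" for I :: "'a tripoly set"
  proof -
    have rat: "rational_self_map I (X3, Y3, Z3)"
      using I(2) homogeneous3_X homogeneous3_Y homogeneous3_Z by (auto simp: rational_self_map_def id)
    moreover have "inverse_rational_maps I (X3, Y3, Z3) (X3, Y3, Z3)"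
      using rat I(1) by (simp add: inverse_rational_maps_def comp_triple_def id same_rational_map_def)
    ultimately show ?thesis unfolding birational_self_map_def by blast
  qed
  have Z: "Z3 \<notin> (curve_C :: 'a tripoly set)"
    using on_curve_eq_0_iff[OF homogeneous3_Z] on_curve_Z3_nonzero by blast
  have "is_pullback (curve_C :: 'a tripoly set) (X3, Y3, Z3) (\<lambda>x\<in>carrier C_field. x)"
    unfolding is_pullback_def id
    using evaluate_rational_function(2) by (auto simp: is_fraction_def)
  moreover have "birational_self_map plane_ideal (X3, Y3, Z3 :: 'a tripoly)"
    by (rule bir) (simp_all add: plane_ideal_def Z3_def)
  moreover have "preserves (X3, Y3, Z3) (curve_C :: 'a tripoly set)"
    unfolding preserves_def by (rule bir[OF _ Z]) (simp add: curve_C_eq)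
  ultimately show ?thesis unfolding extends_to_Bir_plane_def by blast
qed

text \<open>
  The pullback is evaluated at the functions X/Z and Y/Z.
\<close>
lemma pullback_restricts_to_rotation:
  fixes f0 f1 f2 :: "'a tripoly"
  assumes f: "homogeneous3 d f0" "homogeneous3 d f1" "homogeneous3 d f2"
    and pull: "is_pullback curve_C (f0, f1, f2) \<sigma>" and c: "c \<noteq> 0"
    and rot: "\<And>x. x \<in> carrier C_field \<Longrightarrow> evaluate_on_curve (\<sigma> x) = rotate c (evaluate_on_curve x)"
  shows "restricts_to_rotation c (f0, f1, f2)"
proof -
  note gens = subst3_gens[OF ring_map_const3]
  note onZ = on_curve_Z3_nonzero[where 'a = 'a]
  have Z: "Z3 \<notin> (curve_C :: 'a tripoly set)"
    using on_curve_eq_0_iff[OF homogeneous3_Z] onZ by blast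
  have pullback: "f2 \<notin> curve_C \<and> \<sigma> (rational_function curve_C A Z3) = rational_function curve_C (subst3 const3 (f0, f1, f2) A) f2"
    if "homogeneous3 1 A" for A
    using pull that homogeneous3_Z Z unfolding is_pullback_def gens by (metis gens(4))
  have f2: "f2 \<notin> curve_C" using pullback[OF homogeneous3_X] by blast
  then have onf2: "on_curve f2 \<noteq> 0" using on_curve_eq_0_iff[OF f(3)] by blast
  have nz: "pcompose (on_curve (Z3 :: 'a tripoly)) [:0, c:] \<noteq> 0" using onZ c pcompose_scale_eq_0 by blast
  have eq: "on_curve g * pcompose (on_curve Z3) [:0, c:] = on_curve f2 * pcompose (on_curve A) [:0, c:]"
    if A: "homogeneous3 1 A" and g: "subst3 const3 (f0, f1, f2) A = g" "homogeneous3 d g" for A g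
  proof -
    have frA: "is_fraction A Z3" using A homogeneous3_Z Z by (auto simp: is_fraction_def)
    have frg: "is_fraction g f2" using g(2) f(3) f2 by (auto simp: is_fraction_def)
    have "evaluate_on_curve (\<sigma> (rational_function curve_C A Z3)) = rotate c (Fract (on_curve A) (on_curve Z3))"
      using rot[OF evaluate_rational_function(2)[OF frA]] evaluate_rational_function(1)[OF frA] by simp
    moreover have "evaluate_on_curve (\<sigma> (rational_function curve_C A Z3)) = Fract (on_curve g) (on_curve f2)"
      using pullback[OF A] evaluate_rational_function(1)[OF frg] g(1) by simp
    ultimately have "Fract (on_curve g) (on_curve f2) = Fract (pcompose (on_curve A) [:0, c:]) (pcompose (on_curve Z3) [:0, c:])"
      using rotate_Fract[OF c onZ] by simp
    then show ?thesis using onf2 nz by (simp add: eq_fract mult.commute)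
  qed
  show ?thesis
    unfolding restricts_to_rotation_def prod.case
    using onf2 eq[OF homogeneous3_X gens(2) f(1)] eq[OF homogeneous3_Y gens(3) f(2)] by blast
qed

lemma extending_rotation_trivial:
  fixes f0 f1 f2 :: "'a tripoly"
  assumes bir: "birational_self_map plane_ideal (f0, f1, f2)" and rot: "restricts_to_rotation \<eta> (f0, f1, f2)"
    and \<eta>: "\<eta> ^ 5 = 1"
  shows "\<eta> = 1"
proof -
  obtain d where f: "homogeneous3 d f0" "homogeneous3 d f1" "homogeneous3 d f2"
    using bir by (auto simp: birational_self_map_def rational_self_map_def)
  obtain g0 g1 g2 where rg: "rational_self_map plane_ideal (g0, g1, g2)"
    and inv: "inverse_rational_maps plane_ideal (f0, f1, f2) (g0, g1, g2)"
    using bir unfolding birational_self_map_def by (metis prod_cases3)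
  obtain e where g: "homogeneous3 e g0" "homogeneous3 e g1" "homogeneous3 e g2"
    using rg by (auto simp: rational_self_map_def)
  let ?h = "subst3 const3 (f0, f1, f2)"
  have nz: "?h g0 \<noteq> 0 \<or> ?h g1 \<noteq> 0 \<or> ?h g2 \<noteq> 0"
    using inv by (auto simp: inverse_rational_maps_def rational_self_map_def comp_triple_def plane_ideal_def)
  have proportional: "?h g0 * Z3 = ?h g2 * X3" "?h g1 * Z3 = ?h g2 * Y3"
    using inv by (simp_all add: inverse_rational_maps_def same_rational_map_def comp_triple_def plane_ideal_def)
  obtain M where M: "?h g0 = M * X3" "?h g1 = M * Y3" "?h g2 = M * Z3" "M \<noteq> 0"
    by (rule proportional_to_variables[OF proportional nz])
  let ?E = "extend_scalars :: 'a tripoly \<Rightarrow> _"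
  have ext: "subst3 const3 (?E f0, ?E f1, ?E f2) (?E G) = ?E N * V" if "?h G = N * W" "?E W = V" for G N W V
    unfolding extend_scalars_subst3[symmetric] that(1) ring_map.map_mult[OF ring_map_extend_scalars] that(2) ..
  have "to_ac \<eta> = 1"
  proof (rule cremona_rotation_trivial)
    show "curve_field (to_ac \<zeta>)" by (rule curve_field_to_ac) (rule curve_field_axioms)
    show "subst3 const3 (?E f0, ?E f1, ?E f2) (?E g0) = ?E M * X3"
      "subst3 const3 (?E f0, ?E f1, ?E f2) (?E g1) = ?E M * Y3"
      "subst3 const3 (?E f0, ?E f1, ?E f2) (?E g2) = ?E M * Z3"
      by (rule ext[OF M(1)] ext[OF M(2)] ext[OF M(3)], rule extend_scalars_gens)+
    show "?E M \<noteq> 0" using M(4) by (simp add: extend_scalars_eq_0_iff)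
    show "restricts_to_rotation (to_ac \<eta>) (?E f0, ?E f1, ?E f2)"
      by (rule restricts_to_rotation_extend_scalars[OF rot])
    show "to_ac \<eta> ^ 5 = 1" using \<eta> by (simp flip: to_ac_power)
  qed (rule homogeneous3_extend_scalars f g)+
  then show ?thesis by simp
qed

lemma function_field_context:
  "ring C_field" "evaluate_on_curve \<in> ring_iso C_field field_ring" "C_base \<subseteq> carrier C_field"
  "evaluate_on_curve ` C_base = kummer_base"
  by (rule ring_function_field function_field_iso projection_subfield_image)+

lemma extending_automorphisms:
  "{\<sigma> \<in> carrier (galois_group C_field C_base). extends_to_Bir_plane curve_C \<sigma>} = {\<one>\<^bsub>galois_group C_field C_base\<^esub>}"
proof -
  note ctxt = function_field_context
  have one: "\<one>\<^bsub>galois_group C_field C_base\<^esub> = (\<lambda>x\<in>carrier C_field. x)"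
    by (simp add: galois_group_def BijGroup_def)
  have "(\<lambda>x\<in>carrier C_field. x) \<in> carrier (galois_group C_field C_base)"
  proof -
    interpret ring C_field by (rule ctxt)
    have "(\<lambda>x\<in>carrier C_field. x) \<in> ring_hom C_field C_field" by (rule ring_hom_memI) auto
    then show ?thesis using ctxt(3) by (auto simp: galois_group_def id_Bij)
  qed
  moreover have "\<sigma> = (\<lambda>x\<in>carrier C_field. x)"
    if \<sigma>: "\<sigma> \<in> carrier (galois_group C_field C_base)" and ext: "extends_to_Bir_plane curve_C \<sigma>" for \<sigma>
  proof -
    obtain f0 f1 f2 where bir: "birational_self_map plane_ideal (f0, f1, f2)" and pull: "is_pullback curve_C (f0, f1, f2) \<sigma>"
      using ext unfolding extends_to_Bir_plane_def by (metis prod_cases3)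
    obtain d where f: "homogeneous3 d f0" "homogeneous3 d f1" "homogeneous3 d f2"
      using bir by (auto simp: birational_self_map_def rational_self_map_def)
    obtain j where j: "\<And>x. x \<in> carrier C_field \<Longrightarrow> evaluate_on_curve (\<sigma> x) = rotate (\<zeta> ^ j) (evaluate_on_curve x)"
      using galois_group_rotation[OF ctxt \<sigma>] by metis
    have "\<zeta> ^ j \<noteq> 0" using zeta_nonzero by simp
    then have "restricts_to_rotation (\<zeta> ^ j) (f0, f1, f2)"
      using pullback_restricts_to_rotation[OF f pull _ j] by blast
    moreover have "(\<zeta> ^ j) ^ 5 = 1" using root by (metis power_mult mult.commute power_one)
    ultimately have "\<zeta> ^ j = 1" using extending_rotation_trivial[OF bir] by blast
    moreover have "rotate 1 y = y" for y :: "'a poly fract"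
      by (cases y) (simp add: rotate_Fract pcompose_idR)
    ultimately have "evaluate_on_curve (\<sigma> x) = evaluate_on_curve x" if "x \<in> carrier C_field" for x
      using j that by simp
    moreover have "\<sigma> x \<in> carrier C_field" if "x \<in> carrier C_field" for x
      using \<sigma> that by (auto simp: galois_group_def ring_hom_def)
    ultimately have "\<sigma> x = x" if "x \<in> carrier C_field" for x
      using \<Phi>_inj[OF ctxt] that by blast
    moreover have "\<sigma> \<in> extensional (carrier C_field)" using \<sigma> by (auto simp: galois_group_def Bij_def)
    ultimately show ?thesis by (intro extensionalityI[of _ "carrier C_field"]) auto
  qed
  ultimately show ?thesis using identity_extends unfolding one by blast
qed

lemma curve_point: "point_on (1, 0, 0) (curve_C :: 'a tripoly set)"
proof -
  have id: "ring_map (id :: 'a \<Rightarrow> 'a)" using ring_map_id[where 'a = 'a] by (simp add: id_def)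
  have "subst3 id (1, 0, 0) (curve_form :: 'a tripoly) = 0"
    by (simp add: subst3_curve_form[OF id] curve_eq_def)
  then show ?thesis
    unfolding point_on_def curve_C_eq by (auto simp: ring_map.map_mult[OF ring_map_subst3[OF id]] elim!: dvdE)
qed

lemma curve_C_irreducible: "irreducible_plane_curve (curve_C :: 'a tripoly set)"
  unfolding irreducible_plane_curve_def
  using homogeneous3_curve_form prime_elem_imp_irreducible[OF prime_elem_curve_form] curve_C_eq by blast

end

theorem theorem3:
  fixes \<zeta> :: "'k::field"
  assumes "CHAR('k) \<noteq> 5"
    and "CHAR('k) \<noteq> 2"
    and "\<zeta> ^ 5 = 1" and "\<forall>m. 0 < m \<and> m < 5 \<longrightarrow> \<zeta> ^ m \<noteq> 1"
  shows "irreducible_plane_curve (curve_C :: 'k tripoly set) \<and>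
    inner_galois_point (curve_C :: 'k tripoly set) \<and>
    ring.dimension (function_field (curve_C :: 'k tripoly set)) 5
      (projection_subfield curve_C) (carrier (function_field curve_C)) \<and>
    {\<sigma> \<in> carrier (galois_group (function_field (curve_C :: 'k tripoly set))
                     (projection_subfield curve_C)).
        extends_to_Bir_plane curve_C \<sigma>}
      = {\<one>\<^bsub>galois_group (function_field (curve_C :: 'k tripoly set)) (projection_subfield curve_C)\<^esub>}"
proof -
  have "(2 :: 'k) \<noteq> 0"
  proof
    assume "(2 :: 'k) = 0"
    then have "CHAR('k) dvd 2" using of_nat_eq_0_iff_char_dvd[of 2, where 'a = 'k] by simp
    moreover have "CHAR('k) \<noteq> 1" by simp
    ultimately show False using assms(2) prime_nat_iff two_is_prime_nat by metis
  qed
  then interpret curve_field \<zeta> by unfold_locales (use assms(3,4) in auto)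
  note ctxt = function_field_context
  show ?thesis
    using curve_C_irreducible galois_extension_L[OF ctxt] curve_point dimension_subfield_L(1)[OF ctxt]
      extending_automorphisms
    by (simp add: inner_galois_point_def galois_point_def)
qed

end
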